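(* Let $p\in\mathbb{N}$ and let $\boldsymbol{\mu}=(\mu^{i,j})_{i,j=1,\dots,p}$ be a $p\times p$ matrix of locally finite measures on $[0,\infty)$ which is non-lattice. Let $\vartheta\in\mathbb{R}$ lie in the interior of $\mathcal{D}(\mathcal{L}\boldsymbol{\mu})$, suppose that the spectral radius of the matrix $\boldsymbol{\mu}(0)=(\mu^{i,j}(\{0\}))_{i,j}$ is strictly smaller than $1$, and suppose that $$\sup_{\eta\in\mathbb{R}}\big\|(\mathbf{I}_p-\mathcal{L}\boldsymbol{\mu}(\vartheta+\mathrm{i}\eta))^{-1}\big\|<\infty$$ (in particular, all these inverses exist). Suppose further that $\Lambda_\vartheta$ is finite. Let $f:\mathbb{R}\to\mathbb{R}^p$ be a (column vector-valued) right-continuous function with existing left limits, vanishing on the negative half-line, such that (componentwise) $$\int_0^\infty e^{-\theta x}\,\mathrm{V}\!f(x)\,\mathrm{d}x<\infty$$ for some $\theta>\vartheta$ with $\Lambda_\vartheta=\Lambda_\theta$. Let $F=\boldsymbol{U}*f$ be the unique locally bounded solution of the Markov renewal equation $F(t)=f(t)+\boldsymbol{\mu}*F(t)$, $t\in\mathbb{R}$. Then there exist matrices $B_{\lambda,k}\in\mathbb{C}^{p\times p}$ and vectors $b_{\lambda,k,f}\in\mathbb{C}^p$, $k=0,\dots,\mathtt{k}(\lambda)-1$, $\lambda\in\Lambda_\vartheta$, such that, as $t\to\infty$, $$F(t)=\sum_{\lambda\in\Lambda_\theta}e^{\lambda t}\sum_{k=0}^{\mathtt{k}(\lambda)-1}B_{\lambda,k}\int_0^t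 f(x)(t-x)^k e^{-\lambda x}\,\mathrm{d}x+O(e^{\theta t}),$$ $$F(t)=\sum_{\lambda\in\Lambda_\theta}e^{\lambda t}\sum_{k=0}^{\mathtt{k}(\lambda)-1}B_{\lambda,k}\int_0^\infty f(x)(t-x)^k e^{-\lambda x}\,\mathrm{d}x+O(e^{(\theta+\varepsilon)t}),$$ $$F(t)=\sum_{\lambda\in\Lambda_\theta}e^{\lambda t}\sum_{k=0}^{\mathtt{k}(\lambda)-1}t^k\,b_{\lambda,k,f}+O(e^{(\theta+\varepsilon)t}),$$ where the error bounds are to be read component by component and $\varepsilon>0$ can be chosen arbitrarily small, in particular such that $\theta+\varepsilon<\mathrm{Re}(\lambda)$ for every $\lambda\in\Lambda_\theta$.
   Context: $\mathbf{I}_p$ is the $p\times p$ identity matrix; $\|\cdot\|$ is a matrix norm on $\mathbb{C}^{p\times p}$. $\mathcal{L}\boldsymbol{\mu}(z)=(\mathcal{L}\mu^{i,j}(z))_{i,j}$ with $\mathcal{L}\mu^{i,j}(z)=\int_{[0,\infty)} e^{-zx}\,\mu^{i,j}(\mathrm{d}x)$, and $$\mathcal{D}(\mathcal{L}\boldsymbol{\mu})=\Big\{z\in\mathbb{C}:\int e^{-\mathrm{Re}(z)x}\,\mu^{i,j}(\mathrm{d}x)<\infty\text{ for all }i,j\Big\}.$$ Non-lattice: for all $h>0$ and all $h_1,\dots,h_p\in[0,h)$ there exist $i,j$ with $\mu^{i,j}\big((h_j-h_i+h\mathbb{Z})^{\mathsf{c}}\big)>0$. Roots: $\Lambda=\{\lambda\in\mathcal{D}(\mathcal{L}\boldsymbol{\mu}):\det(\mathbf{I}_p-\mathcal{L}\boldsymbol{\mu}(\lambda))=0\}$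 and, for $\theta\in\mathbb{R}$, $\Lambda_\theta=\{\lambda\in\Lambda:\mathrm{Re}(\lambda)>\theta\}$. For $\lambda\in\Lambda$, $\mathtt{k}(\lambda)\in\mathbb{N}=\{1,2,\dots\}$ is the maximal order of the poles of the entries of $(\mathbf{I}_p-\mathcal{L}\boldsymbol{\mu}(z))^{-1}$ at $z=\lambda$, i.e. the smallest natural number such that all entries of $(z-\lambda)^{\mathtt{k}(\lambda)}(\mathbf{I}_p-\mathcal{L}\boldsymbol{\mu}(z))^{-1}$ are holomorphic in some neighborhood of $\lambda$. Convolutions: $(\boldsymbol{\mu}*F)_i(t)=\sum_{j=1}^p\int F_j(t-x)\,\mu^{i,j}(\mathrm{d}x)$. The renewal measure is $\boldsymbol{U}=\sum_{n=0}^\infty\boldsymbol{\mu}^{*n}$, where $\boldsymbol{\mu}^{*n}$ is the $n$-fold matrix convolution power ($\boldsymbol{\mu}^{*0}=\mathbf{I}_p\delta_0$), and $\boldsymbol{U}*f$ is defined analogously to $\boldsymbol{\mu}*F$. Total variation function: for $g:\mathbb{R}\to\mathbb{R}$, $$\mathrm{V}\!g(x)=\sup\Big\{\sum_{j=1}^n|g(x_j)-g(x_{j-1})|:-\infty<x_0<\dots<x_n\le x,\ n\in\mathbb{N}\Big\},$$ and $\mathrm{V}\!f=(\mathrm{V}\!f_1,\dots,\mathrm{V}\!f_p)^{\mathsf{T}}$ for $f=(f_1,\dots,f_p)^{\mathsf{T}}$. *)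

theory Defs
  imports "HOL-Probability.Probability" "HOL-Complex_Analysis.Complex_Analysis"
begin

section \<open>Matrices of measures\<close>

text \<open>
  A \<open>p \<times> p\<close> matrix of measures is a function \<open>'n \<Rightarrow> 'n \<Rightarrow> real measure\<close> with a finite index type
  \<open>'n\<close>, \<open>p = CARD('n) \<ge> 1\<close>. Measures on \<open>[0,\<infinity>)\<close> are Borel measures on the real line without mass on
  the negative half-line, so that the library's \<^const>\<open>convolution\<close> applies.
\<close>

definition locally_finite_nonneg :: "real measure \<Rightarrow> bool" where
  "locally_finite_nonneg M \<longleftrightarrow>
     sets M = sets borel \<and> emeasure M {..<0} = 0 \<and> (\<forall>K. compact K \<longrightarrow> emeasure M K < \<infinity>)"

definition non_lattice :: "('n::finite \<Rightarrow> 'n \<Rightarrow> real measure) \<Rightarrow> bool" where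
  "non_lattice \<mu> \<longleftrightarrow>
     (\<forall>h>0. \<forall>hs :: 'n \<Rightarrow> real. (\<forall>i. hs i \<in> {0..<h}) \<longrightarrow>
        (\<exists>i j. emeasure (\<mu> i j) (- {hs j - hs i + h * of_int m |m. True}) > 0))"

definition laplace_domain :: "('n::finite \<Rightarrow> 'n \<Rightarrow> real measure) \<Rightarrow> complex set" where
  "laplace_domain \<mu> =
     {z. \<forall>i j. (\<integral>\<^sup>+x\<in>{0..}. ennreal (exp (- Re z * x)) \<partial>\<mu> i j) < \<infinity>}"

definition laplace :: "('n::finite \<Rightarrow> 'n \<Rightarrow> real measure) \<Rightarrow> complex \<Rightarrow> complex^'n^'n" where
  "laplace \<mu> z = (\<chi> i j. LINT x:{0..}|\<mu> i j. exp (- z * complex_of_real x))"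

definition atom0 :: "('n::finite \<Rightarrow> 'n \<Rightarrow> real measure) \<Rightarrow> complex^'n^'n" where
  "atom0 \<mu> = (\<chi> i j. complex_of_real (measure (\<mu> i j) {0}))"

definition spectral_radius :: "complex^'n^'n \<Rightarrow> real" where
  "spectral_radius A = Max (cmod ` {l. \<exists>v. v \<noteq> 0 \<and> A *v v = l *s v})"


section \<open>Roots and pole orders\<close>

definition roots :: "('n::finite \<Rightarrow> 'n \<Rightarrow> real measure) \<Rightarrow> complex set" where
  "roots \<mu> = {l \<in> laplace_domain \<mu>. det (mat 1 - laplace \<mu> l) = 0}"

definition roots_gt :: "('n::finite \<Rightarrow> 'n \<Rightarrow> real measure) \<Rightarrow> real \<Rightarrow> complex set" where
  "roots_gt \<mu> \<theta> = {l \<in> roots \<mu>. Re l > \<theta>}"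

text \<open>
  ``Holomorphic in some neighborhood of \<open>l\<close>'' is understood up to a removable singularity at \<open>l\<close>
  itself: the inverse does not exist at a root.
\<close>

definition pole_order :: "('n::finite \<Rightarrow> 'n \<Rightarrow> real measure) \<Rightarrow> complex \<Rightarrow> nat" where
  "pole_order \<mu> l = (LEAST k. 1 \<le> k \<and>
     (\<exists>r>0. \<exists>G :: 'n \<Rightarrow> 'n \<Rightarrow> complex \<Rightarrow> complex.
        (\<forall>i j. G i j holomorphic_on ball l r) \<and>
        (\<forall>z\<in>ball l r - {l}. z \<in> laplace_domain \<mu> \<and> invertible (mat 1 - laplace \<mu> z) \<and>
           (\<forall>i j. G i j z = (z - l) ^ k * matrix_inv (mat 1 - laplace \<mu> z) $ i $ j))))"


section \<open>Convolutions and the renewal measure\<close>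

definition mat_convolution ::
    "('n::finite \<Rightarrow> 'n \<Rightarrow> real measure) \<Rightarrow> ('n \<Rightarrow> 'n \<Rightarrow> real measure) \<Rightarrow> 'n \<Rightarrow> 'n \<Rightarrow> real measure" where
  "mat_convolution M N i j =
     measure_of UNIV (sets borel) (\<lambda>S. \<Sum>k\<in>UNIV. emeasure (convolution (M i k) (N k j)) S)"

primrec conv_power :: "('n::finite \<Rightarrow> 'n \<Rightarrow> real measure) \<Rightarrow> nat \<Rightarrow> 'n \<Rightarrow> 'n \<Rightarrow> real measure" where
  "conv_power \<mu> 0 = (\<lambda>i j. if i = j then return borel 0 else null_measure borel)"
| "conv_power \<mu> (Suc n) = mat_convolution \<mu> (conv_power \<mu> n)"

definition renewal_measure :: "('n::finite \<Rightarrow> 'n \<Rightarrow> real measure) \<Rightarrow> 'n \<Rightarrow> 'n \<Rightarrow> real measure" where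
  "renewal_measure \<mu> i j = measure_of UNIV (sets borel) (\<lambda>S. \<Sum>n. emeasure (conv_power \<mu> n i j) S)"

text \<open>The set functions above are measures, so \<^const>\<open>measure_of\<close> does not collapse to zero.\<close>

lemma sets_mat_convolution [simp]: "sets (mat_convolution M N i j) = sets borel"
  using sets.sigma_sets_eq[of "borel :: real measure"] by (simp add: mat_convolution_def)

lemma sets_conv_power [simp]: "sets (conv_power \<mu> n i j) = sets borel"
  by (cases n) auto

lemma sets_renewal_measure [simp]: "sets (renewal_measure \<mu> i j) = sets borel"
  using sets.sigma_sets_eq[of "borel :: real measure"] by (simp add: renewal_measure_def)

lemma emeasure_mat_convolution:
  assumes "S \<in> sets borel"
  shows "emeasure (mat_convolution M N i j) S =
    (\<Sum>k\<in>UNIV. emeasure (convolution (M i k) (N k j)) S)"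
proof (rule emeasure_measure_of[OF mat_convolution_def])
  have "(\<Sum>n. \<Sum>k\<in>UNIV. emeasure (convolution (M i k) (N k j)) (A n)) =
      (\<Sum>k\<in>UNIV. emeasure (convolution (M i k) (N k j)) (\<Union>n. A n))"
    if "range A \<subseteq> sets borel" "disjoint_family A" for A :: "nat \<Rightarrow> real set"
    using that by (subst suminf_sum) (auto intro!: sum.cong suminf_emeasure)
  then show "countably_additive (sets (mat_convolution M N i j))
      (\<lambda>S. \<Sum>k\<in>UNIV. emeasure (convolution (M i k) (N k j)) S)"
    by (simp add: countably_additive_def)
qed (use assms in \<open>auto simp: positive_def\<close>)

lemma emeasure_renewal_measure:
  assumes "S \<in> sets borel"
  shows "emeasure (renewal_measure \<mu> i j) S = (\<Sum>n. emeasure (conv_power \<mu> n i j) S)"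
proof (rule emeasure_measure_of[OF renewal_measure_def])
  have "(\<Sum>m. \<Sum>n. emeasure (conv_power \<mu> n i j) (A m)) =
      (\<Sum>n. emeasure (conv_power \<mu> n i j) (\<Union>m. A m))"
    if "range A \<subseteq> sets borel" "disjoint_family A" for A :: "nat \<Rightarrow> real set"
  proof -
    have "(\<Sum>m. \<Sum>n. emeasure (conv_power \<mu> n i j) (A m)) =
        (\<Sum>n. \<Sum>m. emeasure (conv_power \<mu> n i j) (A m))"
      unfolding nn_integral_count_space_nat[symmetric]
      by (rule pair_sigma_finite.Fubini')
        (auto simp: pair_sigma_finite_def sigma_finite_measure_count_space pair_measure_countable)
    also have "\<dots> = (\<Sum>n. emeasure (conv_power \<mu> n i j) (\<Union>m. A m))"
      using that by (intro suminf_cong suminf_emeasure) auto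
    finally show ?thesis .
  qed
  then show "countably_additive (sets (renewal_measure \<mu> i j))
      (\<lambda>S. \<Sum>n. emeasure (conv_power \<mu> n i j) S)"
    by (simp add: countably_additive_def)
qed (use assms in \<open>auto simp: positive_def\<close>)

definition conv_fun ::
    "('n::finite \<Rightarrow> 'n \<Rightarrow> real measure) \<Rightarrow> (real \<Rightarrow> real^'n) \<Rightarrow> real \<Rightarrow> real^'n" where
  "conv_fun M F t = (\<chi> i. \<Sum>j\<in>UNIV. LINT x|M i j. F (t - x) $ j)"

text \<open>
  Solutions are required to vanish on the negative half-line: without this, uniqueness fails,
  since \<open>t \<mapsto> exp (l * t)\<close> solves the homogeneous scalar equation for each real root \<open>l\<close>.
\<close>

definition locally_bounded_renewal_solution ::
    "('n::finite \<Rightarrow> 'n \<Rightarrow> real measure) \<Rightarrow> (real \<Rightarrow> real^'n) \<Rightarrow> (real \<Rightarrow> real^'n) \<Rightarrow> bool" where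
  "locally_bounded_renewal_solution \<mu> f F \<longleftrightarrow>
     F \<in> borel_measurable borel \<and> (\<forall>K. compact K \<longrightarrow> bounded (F ` K)) \<and>
     (\<forall>t<0. F t = 0) \<and> (\<forall>t. F t = f t + conv_fun \<mu> F t)"


section \<open>Regularity of functions on the real line\<close>

definition cadlag :: "(real \<Rightarrow> 'a::topological_space) \<Rightarrow> bool" where
  "cadlag f \<longleftrightarrow> (\<forall>t. (f \<longlongrightarrow> f t) (at_right t) \<and> (\<exists>l. (f \<longlongrightarrow> l) (at_left t)))"

definition total_variation :: "(real \<Rightarrow> real) \<Rightarrow> real \<Rightarrow> ennreal" where
  "total_variation g x =
     (SUP (n, xs) \<in> {(n, xs :: nat \<Rightarrow> real). 1 \<le> n \<and> strict_mono_on {0..n} xs \<and> xs n \<le> x}.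
        \<Sum>j=1..n. ennreal \<bar>g (xs j) - g (xs (j - 1))\<bar>)"


section \<open>Asymptotic expansions\<close>

definition main_integral ::
    "real set \<Rightarrow> (real \<Rightarrow> real^'n) \<Rightarrow> real \<Rightarrow> nat \<Rightarrow> complex \<Rightarrow> complex^'n" where
  "main_integral A f t k l =
     (\<chi> i. LINT x:A|lborel. complex_of_real (f x $ i * (t - x) ^ k) * exp (- l * complex_of_real x))"

definition bigo_vec :: "(real \<Rightarrow> real^'n) \<Rightarrow> (real \<Rightarrow> complex^'n) \<Rightarrow> real \<Rightarrow> bool" where
  "bigo_vec F G a \<longleftrightarrow>
     (\<forall>i. (\<lambda>t. complex_of_real (F t $ i) - G t $ i) \<in> O[at_top](\<lambda>t. complex_of_real (exp (a * t))))"

end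

theory Submission
  imports Defs
begin

text \<open>
  The Laplace transform of the renewal measure \<open>U\<close> is \<open>(I - L\<mu>)\<^sup>-\<^sup>1\<close>. Subtracting its principal parts at the
  roots leaves a function \<open>H\<close> that is holomorphic to the right of \<open>\<theta>\<^sub>0\<close>; by the theorems of Montel and
  Hurwitz, boundedness of the inverse on the line \<open>Re z = \<theta>\<^sub>0\<close> and finiteness of the set of roots
  force \<open>H\<close> to be bounded on vertical strips. The principal parts are the Laplace transforms of the
  exponential polynomials of the expansion. Inverting \<open>H z / z\<^sup>2\<close>, which is absolutely integrable on
  vertical lines, and shifting the line of integration gives an expansion of the integrated renewal
  function. Differencing it with a step \<open>h\<close> that decreases exponentially in \<open>t\<close>, together with the
  monotonicity of \<open>t \<mapsto> U {..t}\<close>, yields \<open>U {..t}\<close> up to \<open>O(exp (\<theta> t))\<close> for each \<open>\<theta> > \<theta>\<^sub>0\<close>, the loss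
  from \<open>\<theta>\<^sub>0\<close> to \<open>\<theta>\<close> absorbing the factor \<open>h powr (-e)\<close> that differencing costs.
  A function of tempered variation is a difference of two increasing functions, and for an increasing
  \<open>g\<close> the convolution \<open>U * g\<close> is an integral of \<open>U {..t - y}\<close> against the Stieltjes measure of \<open>g\<close>.
  For \<open>\<theta> \<le> 0\<close> the variation condition forces \<open>f = 0\<close>.
\<close>

section \<open>Integrals over vertical lines\<close>

text \<open>The obstacle is that \<open>U\<close> is only a measure: its transform need not decay
  along vertical lines, so two divisions by \<open>z\<close> buy absolute convergence and must be
  undone without any smoothness of \<open>U\<close>. The balance is as follows. A step
  \<open>h = exp (- (\<beta> - \<theta>) * t)\<close> makes the mass of the residue density in a
  window of length \<open>h\<close>, of order \<open>h * exp (\<beta> * t)\<close>, comparable to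
  \<open>exp (\<theta> * t)\<close>, and the remainder \<open>exp (a * t) * h powr (-e)\<close>
  stays below this for small \<open>e\<close>. The kernel \<open>1 / z^2\<close> has a pole at
  \<open>0\<close>, so the line is moved only to some \<open>a > 0\<close>; this is where the sign
  of \<open>\<theta>\<close> enters. Far to the right, the renewal series converges because the
  transform of \<open>\<mu>\<close> tends to its atoms at \<open>0\<close>, and a positive vector
  adapted to that matrix gives a weighted norm in which convolution contracts. The same norm yields
  uniqueness of the solution. The coefficient matrices come from the poles to the right of
  \<open>\<theta>\<^sub>0\<close> alone, before \<open>f\<close> and \<open>\<theta>\<close> are
  given; the abscissa \<open>\<sigma>\<close> is chosen afterwards, beyond
  \<open>\<theta>\<close>.\<close>

text \<open>Common majorant of the vertical integrals: \<open>e = 1\<close> matches the kernel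
  \<open>1 / z^2\<close>, a small \<open>e\<close> what differencing leaves of it.\<close>

lemma integrable_one_plus_abs_powr:
  assumes "e > (0::real)"
  shows "integrable lborel (\<lambda>y::real. (1 + \<bar>y\<bar>) powr (-1 - e))"
proof (rule integrableI_nonneg)
  let ?f = "\<lambda>x::real. (1 + \<bar>x\<bar>) powr (-1 - e)"
  let ?F = "\<lambda>x::real. - ((1 + x) powr (-e)) / e"
  let ?g = "\<lambda>x::real. ennreal (?f x) * indicator {0..} x"
  have lim: "(?F \<longlongrightarrow> 0) at_top"
    using assms by real_asymp
  have "(\<integral>\<^sup>+x. ?g x \<partial>lborel) = (\<integral>\<^sup>+x. ennreal ((1 + x) powr (-1 - e)) * indicator {0..} x \<partial>lborel)"
    by (intro nn_integral_cong) (auto split: split_indicator)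
  also have "\<dots> = ennreal (0 - ?F 0)"
  proof (rule nn_integral_FTC_atLeast[OF _ _ _ lim])
    show "DERIV ?F x :> (1 + x) powr (-1 - e)" if "0 \<le> x" for x
    proof -
      have "((\<lambda>x. (1 + x) powr (-e)) has_real_derivative (-e * (1 + x) powr (-e - 1)) * 1) (at x)"
        by (rule DERIV_chain2[OF has_real_derivative_powr]) (use that in \<open>auto intro!: derivative_eq_intros\<close>)
      from DERIV_cdivide[OF DERIV_minus[OF this], of e] have "DERIV ?F x :> (1 + x) powr (-e - 1)"
        using assms by (simp add: algebra_simps)
      moreover have "-1 - e = -e - 1" by simp
      ultimately show ?thesis by metis
    qed
  qed auto
  finally have half: "(\<integral>\<^sup>+x. ?g x \<partial>lborel) < \<infinity>" by simp
  have refl: "(\<integral>\<^sup>+x. ?g x \<partial>lborel) = (\<integral>\<^sup>+x. ?g (- x) \<partial>lborel)"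
    using nn_integral_real_affine[of ?g "-1" 0] by simp
  have "(\<integral>\<^sup>+x. ?f x \<partial>lborel) \<le> (\<integral>\<^sup>+x. ?g x + ?g (- x) \<partial>lborel)"
    by (intro nn_integral_mono) (auto split: split_indicator)
  also have "\<dots> = (\<integral>\<^sup>+x. ?g x \<partial>lborel) + (\<integral>\<^sup>+x. ?g (- x) \<partial>lborel)"
    by (intro nn_integral_add) auto
  also have "\<dots> < \<infinity>" using half refl by simp
  finally show "(\<integral>\<^sup>+x. ?f x \<partial>lborel) < \<infinity>" .
qed auto

lemma norm_Complex_ge:
  "cmod (Complex a y) \<ge> min \<bar>a\<bar> 1 / 2 * (1 + \<bar>y\<bar>)"
proof -
  have "cmod (Complex a y) \<ge> \<bar>a\<bar>" "cmod (Complex a y) \<ge> \<bar>y\<bar>"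
    using abs_Re_le_cmod[of "Complex a y"] abs_Im_le_cmod[of "Complex a y"] by auto
  moreover have "min \<bar>a\<bar> 1 * (1 + \<bar>y\<bar>) \<le> \<bar>a\<bar> + \<bar>y\<bar>"
  proof -
    have "min \<bar>a\<bar> 1 * \<bar>y\<bar> \<le> 1 * \<bar>y\<bar>" by (intro mult_right_mono) auto
    then show ?thesis
      unfolding distrib_left using min.cobounded1[of "\<bar>a\<bar>" 1] by linarith
  qed
  ultimately show ?thesis by linarith
qed

text \<open>Mean value inequality on the half-plane \<open>Re z \<le> R\<close>: it is convex,
  contains \<open>0\<close> because \<open>0 \<le> R\<close>, and \<open>exp\<close> has modulus at
  most \<open>exp R\<close> on it.\<close>

lemma norm_exp_minus_one_le:
  assumes "Re w \<le> R" "0 \<le> R"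
  shows "cmod (exp w - 1) \<le> exp R * cmod w"
proof -
  have "cmod (exp w - exp 0) \<le> exp R * cmod (w - 0)"
  proof (rule field_differentiable_bound[where S="{z. Re z \<le> R}" and f'=exp])
    show "convex {z. Re z \<le> R}" by (rule convex_halfspace_Re_le)
    show "(exp has_field_derivative exp z) (at z within {z. Re z \<le> R})" for z :: complex
      by (rule has_field_derivative_at_within[OF DERIV_exp])
  qed (use assms in \<open>auto simp: norm_exp_eq_Re\<close>)
  then show ?thesis by simp
qed

lemma Complex_measurable [measurable]: "Complex a \<in> borel_measurable borel"
proof -
  have "Complex a = (\<lambda>y. complex_of_real a + \<i> * complex_of_real y)"
    by (auto simp: complex_eq_iff)
  then show ?thesis by simp
qed

lemma tendsto_integral_symmetric_interval:
  fixes g :: "real \<Rightarrow> 'a::{banach,second_countable_topology}"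
  assumes g: "integrable lborel g"
  shows "((\<lambda>T. LINT y:{-T..T}|lborel. g y) \<longlongrightarrow> (LINT y|lborel. g y)) at_top"
  unfolding set_lebesgue_integral_def
proof (rule integral_dominated_convergence_at_top[where w="\<lambda>y. norm (g y)"])
  show "AE y in lborel. ((\<lambda>T. indicator {-T..T} y *\<^sub>R g y) \<longlongrightarrow> g y) at_top"
  proof (rule AE_I2)
    fix y :: real
    have "eventually (\<lambda>T. indicator {-T..T} y *\<^sub>R g y = g y) at_top"
      using eventually_ge_at_top[of "\<bar>y\<bar>"] by eventually_elim (auto simp: indicator_def)
    then show "((\<lambda>T. indicator {-T..T} y *\<^sub>R g y) \<longlongrightarrow> g y) at_top"
      by (rule tendsto_eventually)
  qed
  show "\<forall>\<^sub>F T in at_top. AE x in lborel. norm (indicator {- T..T} x *\<^sub>R g x) \<le> norm (g x)"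
    by (intro always_eventually allI AE_I2) (auto simp: indicator_def)
qed (use g in auto)

lemma contour_integral_vertical:
  fixes \<phi> :: "complex \<Rightarrow> complex"
  assumes "continuous_on {z. Re z = a} \<phi>" "T > 0"
  shows "contour_integral (linepath (Complex a (-T)) (Complex a T)) \<phi> =
    \<i> * (LINT y:{-T..T}|lborel. \<phi> (Complex a y))"
proof -
  have "continuous_on {-T..T} (\<lambda>y. \<phi> (Complex a y))"
    by (rule continuous_on_compose2[OF assms(1)]) (auto intro!: continuous_intros)
  from borel_integrable_atLeastAtMost'[OF this] show ?thesis
    using assms(2) by (subst contour_integral_linepath_same_Re[where c=a and a="-T" and b=T])
      (auto simp: set_borel_integral_eq_integral)
qed

lemma closed_segment_same_Im:
  assumes "a \<le> b" "z \<in> closed_segment (Complex a T) (Complex b T)"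
  shows "Im z = T" "a \<le> Re z" "Re z \<le> b"
proof -
  obtain u where u: "0 \<le> u" "u \<le> 1" "z = (1 - u) *\<^sub>R Complex a T + u *\<^sub>R Complex b T"
    using assms(2) by (auto simp: closed_segment_def)
  have "Re z = a + u * (b - a)" "Im z = T" unfolding u(3) by (simp_all add: algebra_simps)
  moreover have "u * (b - a) \<ge> 0" "u * (b - a) \<le> 1 * (b - a)"
    using u assms(1) mult_left_le_one_le[of "b - a" u] by auto
  ultimately show "Im z = T" "a \<le> Re z" "Re z \<le> b" by auto
qed

lemma closed_segment_same_Re:
  assumes "z \<in> closed_segment (Complex a c) (Complex a d)"
  shows "Re z = a"
proof -
  obtain u where u: "z = (1 - u) *\<^sub>R Complex a c + u *\<^sub>R Complex a d"
    using assms by (auto simp: closed_segment_def)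
  show ?thesis unfolding u by (simp add: algebra_simps)
qed

section \<open>Moving the line of integration\<close>

text \<open>The two horizontal sides of the rectangle contribute at most
  \<open>C / T^2 * (b - a)\<close> each and disappear as \<open>T\<close> grows. Regularity between
  the lines is asked only off the real axis, and \<open>c\<close> may be nonzero, so that the same
  statement covers crossing the double pole at \<open>0\<close>.\<close>

lemma vertical_line_shift:
  fixes \<phi> :: "complex \<Rightarrow> complex"
  assumes ab: "a < b"
    and cont: "continuous_on {z. Re z = a} \<phi>" "continuous_on {z. Re z = b} \<phi>"
      "continuous_on {z. a \<le> Re z \<and> Re z \<le> b \<and> Im z \<noteq> 0} \<phi>"
    and int: "integrable lborel (\<lambda>y. \<phi> (Complex a y))" "integrable lborel (\<lambda>y. \<phi> (Complex b y))"
    and bound: "\<And>z. a \<le> Re z \<Longrightarrow> Re z \<le> b \<Longrightarrow> Im z \<noteq> 0 \<Longrightarrow> cmod (\<phi> z) \<le> C / (Im z)^2"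
    and rect: "\<And>T. T > 0 \<Longrightarrow> contour_integral (rectpath (Complex a (-T)) (Complex b T)) \<phi> = c"
  shows "\<i> * ((LINT y|lborel. \<phi> (Complex b y)) - (LINT y|lborel. \<phi> (Complex a y))) = c"
proof -
  define E where "E T = contour_integral (linepath (Complex a (-T)) (Complex b (-T))) \<phi>
    - contour_integral (linepath (Complex a T) (Complex b T)) \<phi>" for T
  have C0: "C \<ge> 0"
    using order_trans[OF norm_ge_zero bound[of "Complex a 1"]] ab by simp
  have hor: "\<phi> contour_integrable_on linepath (Complex a T) (Complex b T)"
    "cmod (contour_integral (linepath (Complex a T) (Complex b T)) \<phi>) \<le> C / T^2 * (b - a)"
    if "T \<noteq> 0" for T
  proof -
    show 1: "\<phi> contour_integrable_on linepath (Complex a T) (Complex b T)"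
      by (rule contour_integrable_continuous_linepath, rule continuous_on_subset[OF cont(3)])
        (use closed_segment_same_Im[of a b] ab that in auto)
    have "cmod (contour_integral (linepath (Complex a T) (Complex b T)) \<phi>)
        \<le> C / T^2 * cmod (Complex b T - Complex a T)"
    proof (rule contour_integral_bound_linepath[OF 1])
      fix z assume "z \<in> closed_segment (Complex a T) (Complex b T)"
      then show "cmod (\<phi> z) \<le> C / T^2"
        using closed_segment_same_Im[of a b z T] bound[of z] ab that by auto
    qed (use C0 in auto)
    moreover have "Complex b T - Complex a T = of_real (b - a)" by (auto simp: complex_eq_iff)
    ultimately show "cmod (contour_integral (linepath (Complex a T) (Complex b T)) \<phi>) \<le> C / T^2 * (b - a)"
      using ab by (metis abs_of_pos diff_gt_0_iff_gt norm_of_real)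
  qed
  have ver: "\<phi> contour_integrable_on linepath (Complex a c) (Complex a d)"
    "\<phi> contour_integrable_on linepath (Complex b c) (Complex b d)" for c d
    by (rule contour_integrable_continuous_linepath, rule continuous_on_subset[OF cont(1)];
        use closed_segment_same_Re in auto)
       (rule contour_integrable_continuous_linepath, rule continuous_on_subset[OF cont(2)];
        use closed_segment_same_Re in auto)
  have eq: "\<i> * ((LINT y:{-T..T}|lborel. \<phi> (Complex b y)) - (LINT y:{-T..T}|lborel. \<phi> (Complex a y))) + E T = c"
    if T: "T > 0" for T
  proof -
    have "c = contour_integral (rectpath (Complex a (-T)) (Complex b T)) \<phi>"
      using rect[OF T] by simp
    also have "\<dots> = contour_integral (linepath (Complex a (-T)) (Complex b (-T))) \<phi>
       + (contour_integral (linepath (Complex b (-T)) (Complex b T)) \<phi>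
       + (contour_integral (linepath (Complex b T) (Complex a T)) \<phi>
       + contour_integral (linepath (Complex a T) (Complex a (-T))) \<phi>))"
      unfolding rectpath_def Let_def
      using T hor(1)[of T] hor(1)[of "-T"] ver
      by (simp add: contour_integrable_reversepath_eq[of "linepath (Complex b T) (Complex a T)", symmetric])
    also have "contour_integral (linepath (Complex b T) (Complex a T)) \<phi> =
       - contour_integral (linepath (Complex a T) (Complex b T)) \<phi>"
      using contour_integral_reversepath[of "linepath (Complex a T) (Complex b T)" \<phi>] by simp
    also have "contour_integral (linepath (Complex a T) (Complex a (-T))) \<phi> =
       - contour_integral (linepath (Complex a (-T)) (Complex a T)) \<phi>"
      using contour_integral_reversepath[of "linepath (Complex a (-T)) (Complex a T)" \<phi>] by simp
    finally show ?thesis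
      unfolding E_def contour_integral_vertical[OF cont(1) T] contour_integral_vertical[OF cont(2) T]
      by (simp add: algebra_simps)
  qed
  have E0: "(E \<longlongrightarrow> 0) at_top"
  proof (rule Lim_null_comparison)
    show "eventually (\<lambda>T. norm (E T) \<le> 2 * C * (b - a) / T^2) at_top"
      using eventually_gt_at_top[of 0]
    proof eventually_elim
      case (elim T)
      have "norm (E T) \<le> C / (-T)^2 * (b - a) + C / T^2 * (b - a)"
        unfolding E_def by (rule order_trans[OF norm_triangle_ineq4 add_mono]) (use hor(2)[of T] hor(2)[of "-T"] elim in auto)
      then show ?case by (simp add: field_simps)
    qed
    show "((\<lambda>T. 2 * C * (b - a) / T^2) \<longlongrightarrow> 0) at_top" by real_asymp
  qed
  have "((\<lambda>T. \<i> * ((LINT y:{-T..T}|lborel. \<phi> (Complex b y)) - (LINT y:{-T..T}|lborel. \<phi> (Complex a y))) + E T)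
     \<longlongrightarrow> \<i> * ((LINT y|lborel. \<phi> (Complex b y)) - (LINT y|lborel. \<phi> (Complex a y))) + 0) at_top"
    by (intro tendsto_intros tendsto_integral_symmetric_interval int E0)
  moreover have "((\<lambda>T. \<i> * ((LINT y:{-T..T}|lborel. \<phi> (Complex b y)) - (LINT y:{-T..T}|lborel. \<phi> (Complex a y))) + E T)
     \<longlongrightarrow> c) at_top"
    by (rule tendsto_eventually) (auto intro!: eventually_mono[OF eventually_gt_at_top[of 0]] eq)
  ultimately show ?thesis
    using tendsto_unique[OF trivial_limit_at_top_linorder] by fastforce
qed

lemma integrable_vertical_inverse_square:
  fixes \<psi> :: "complex \<Rightarrow> complex"
  assumes a: "a \<noteq> 0" and cont: "continuous_on {z. Re z = a} \<psi>"
    and bd: "\<And>y. cmod (\<psi> (Complex a y)) \<le> K"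
  shows "integrable lborel (\<lambda>y. \<psi> (Complex a y) / (Complex a y)^2)"
    and "integrable lborel (\<lambda>y. 1 / cmod (Complex a y)^2)"
proof -
  define m where "m = min \<bar>a\<bar> 1 / 2"
  have m: "m > 0" using a by (simp add: m_def)
  have le: "1 / cmod (Complex a y)^2 \<le> 1 / m^2 * (1 + \<bar>y\<bar>) powr (-1 - 1)" for y
  proof -
    have "(m * (1 + \<bar>y\<bar>))^2 \<le> cmod (Complex a y)^2"
      using norm_Complex_ge[of a y] m by (intro power_mono) (auto simp: m_def)
    moreover have "(m * (1 + \<bar>y\<bar>))^2 > 0" using m by (intro zero_less_power mult_pos_pos) auto
    ultimately have "1 / cmod (Complex a y)^2 \<le> 1 / (m * (1 + \<bar>y\<bar>))^2"
      by (intro divide_left_mono) (auto intro!: mult_pos_pos)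
    also have "\<dots> = 1 / m^2 * (1 + \<bar>y\<bar>) powr (-1 - 1)"
      by (simp add: powr_minus_divide powr_numeral power_mult_distrib)
    finally show ?thesis .
  qed
  have int: "integrable lborel (\<lambda>y. 1 / m^2 * (1 + \<bar>y\<bar>) powr (-1 - 1))"
    using integrable_one_plus_abs_powr[of 1] by (intro integrable_mult_right) auto
  show 2: "integrable lborel (\<lambda>y. 1 / cmod (Complex a y)^2)"
    by (rule Bochner_Integration.integrable_bound[OF int]) (use le in auto)
  have "continuous_on UNIV (\<lambda>y. \<psi> (Complex a y))"
    by (rule continuous_on_compose2[OF cont]) (auto intro!: continuous_intros)
  then have [measurable]: "(\<lambda>y. \<psi> (Complex a y)) \<in> borel_measurable borel"
    by (rule borel_measurable_continuous_onI)
  have K: "K \<ge> 0" using bd[of 0] norm_ge_zero[of "\<psi> (Complex a 0)"] by linarith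
  show "integrable lborel (\<lambda>y. \<psi> (Complex a y) / (Complex a y)^2)"
    by (rule Bochner_Integration.integrable_bound[OF integrable_mult_right[OF 2, of K]])
      (use K in \<open>auto simp: norm_divide norm_power intro!: divide_right_mono bd\<close>)
qed

lemma vertical_line_shift_holomorphic:
  assumes ab: "0 < a" "a < b" "S < a" and hol: "H holomorphic_on {z. Re z > S}"
    and bd: "\<And>z. a \<le> Re z \<Longrightarrow> Re z \<le> b \<Longrightarrow> cmod (H z) \<le> K"
  shows "(LINT y|lborel. exp (Complex b y * of_real t) * H (Complex b y) / (Complex b y)^2) =
     (LINT y|lborel. exp (Complex a y * of_real t) * H (Complex a y) / (Complex a y)^2)"
proof -
  define \<phi> where "\<phi> z = exp (z * of_real t) * H z / z^2" for z
  \<comment> \<open>The half-plane of holomorphy has to avoid the pole of \<open>1 / z^2\<close> at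
    \<open>0\<close> as well as the boundary of the domain of \<open>H\<close>.\<close>
  define S' where "S' = max 0 S"
  have hol': "\<phi> holomorphic_on {z. Re z > S'}"
    unfolding \<phi>_def by (intro holomorphic_intros holomorphic_on_subset[OF hol]) (auto simp: S'_def)
  have cont: "continuous_on A \<phi>" if "A \<subseteq> {z. Re z > S'}" for A
    using holomorphic_on_imp_continuous_on[OF hol'] that continuous_on_subset by blast
  have contH: "continuous_on A H" if "A \<subseteq> {z. Re z > S}" for A
    using holomorphic_on_imp_continuous_on[OF hol] that continuous_on_subset by blast
  have K0: "K \<ge> 0" using bd[of "of_real a"] ab norm_ge_zero[of "H (of_real a)"]
    by (metis Re_complex_of_real less_eq_real_def order_trans)
  have num: "cmod (exp (z * of_real t) * H z) \<le> exp (b * \<bar>t\<bar>) * K" if "a \<le> Re z" "Re z \<le> b" for z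
  proof -
    have "Re z * t \<le> b * \<bar>t\<bar>"
      using that ab by (metis abs_ge_self abs_ge_zero abs_mult abs_of_pos less_le_trans mult_right_mono order_trans)
    then have "cmod (exp (z * of_real t)) \<le> exp (b * \<bar>t\<bar>)" by (simp add: norm_exp_eq_Re)
    then show ?thesis using bd[OF that] by (auto simp: norm_mult intro!: mult_mono)
  qed
  have int: "integrable lborel (\<lambda>y. \<phi> (Complex x y))" if "a \<le> x" "x \<le> b" for x
    unfolding \<phi>_def
    by (rule integrable_vertical_inverse_square[where K="exp (b * \<bar>t\<bar>) * K" and \<psi>="\<lambda>z. exp (z * of_real t) * H z"])
      (use that ab num in \<open>auto intro!: continuous_intros contH\<close>)
  have "\<i> * ((LINT y|lborel. \<phi> (Complex b y)) - (LINT y|lborel. \<phi> (Complex a y))) = 0"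
  proof (rule vertical_line_shift[OF ab(2), where C="exp (b * \<bar>t\<bar>) * K"])
    show "cmod (\<phi> z) \<le> exp (b * \<bar>t\<bar>) * K / (Im z)\<^sup>2" if "a \<le> Re z" "Re z \<le> b" "Im z \<noteq> 0" for z
    proof -
      have "(Im z)^2 \<le> cmod z^2" by (simp add: cmod_def)
      then have "cmod (exp (z * of_real t) * H z) / cmod z^2 \<le> exp (b * \<bar>t\<bar>) * K / (Im z)^2"
        using num[OF that(1,2)] that K0 by (intro frac_le) auto
      then show ?thesis by (simp add: \<phi>_def norm_divide norm_power)
    qed
    show "contour_integral (rectpath (Complex a (-T)) (Complex b T)) \<phi> = 0" if "T > 0" for T
    proof (rule contour_integral_unique, rule Cauchy_theorem_convex_simple[OF hol'])
      show "path_image (rectpath (Complex a (- T)) (Complex b T)) \<subseteq> {z. S' < Re z}"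
        using path_image_rectpath_subset_cbox[of "Complex a (-T)" "Complex b T"] ab that
        by (auto simp: in_cbox_complex_iff S'_def)
    qed (auto simp: convex_halfspace_Re_gt)
  qed (use ab int in \<open>auto intro!: cont simp: S'_def\<close>)
  then show ?thesis by (simp add: \<phi>_def)
qed

section \<open>Inversion with the kernel \<open>1 / z^2\<close>\<close>

text \<open>Provides a majorant independent of the abscissa, as dominated convergence along a moving
  line requires.\<close>

lemma one_plus_square_le_norm_Complex:
  assumes "\<bar>b\<bar> \<ge> 1"
  shows "1 / cmod (Complex b y)^2 \<le> 1 / cmod (Complex 1 y)^2"
proof -
  have "1 \<le> b^2" using assms abs_le_square_iff[of 1 b] by simp
  then show ?thesis unfolding cmod_power2 by (intro divide_left_mono) (auto intro!: mult_pos_pos add_pos_nonneg)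
qed

text \<open>The sign condition keeps the modulus of the exponential at most \<open>1\<close>, so
  only the growth of the denominator matters. The filter \<open>F\<close> lets the line escape to
  the right or to the left, according to the sign of \<open>s\<close>.\<close>

lemma vertical_integral_exp_tendsto_0:
  assumes "filterlim b F sequentially" "F = at_top \<or> F = at_bot"
    and "\<And>n. b n * s \<le> (0::real)" "\<And>n. \<bar>b n\<bar> \<ge> 1"
  shows "(\<lambda>n. LINT y|lborel. exp (Complex (b n) y * of_real s) / (Complex (b n) y)^2) \<longlonglongrightarrow> 0"
proof -
  have "(\<lambda>n. LINT y|lborel. exp (Complex (b n) y * of_real s) / (Complex (b n) y)^2) \<longlonglongrightarrow> integral\<^sup>L lborel (\<lambda>y::real. (0::complex))"
  proof (rule integral_dominated_convergence[where f="\<lambda>_. 0"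
      and s="\<lambda>n y. exp (Complex (b n) y * of_real s) / (Complex (b n) y)^2" and w="\<lambda>y. 1 / cmod (Complex 1 y)^2"])
    show "integrable lborel (\<lambda>y. 1 / cmod (Complex 1 y)^2)"
      by (rule integrable_vertical_inverse_square(2)[where \<psi>="\<lambda>_. 0" and K=0]) auto
    have le: "cmod (exp (Complex (b n) y * of_real s) / (Complex (b n) y)^2) \<le> 1 / cmod (Complex (b n) y)^2" for n y
      using assms(3)[of n] by (auto simp: norm_divide norm_power norm_exp_eq_Re intro!: divide_right_mono)
    show "AE y in lborel. norm (exp (Complex (b n) y * of_real s) / (Complex (b n) y)^2) \<le> 1 / cmod (Complex 1 y)^2" for n
      using order_trans[OF le one_plus_square_le_norm_Complex] assms(4) by auto
    have "filterlim b at_infinity sequentially"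
      using assms(1,2) filterlim_at_top_imp_at_infinity filterlim_at_bot_imp_at_infinity by blast
    then have "filterlim (\<lambda>n. \<bar>b n\<bar>) at_top sequentially"
      using filterlim_at_infinity_imp_norm_at_top[of b] by simp
    then have ab: "(\<lambda>n. 1 / \<bar>b n\<bar>^2) \<longlonglongrightarrow> 0"
      by (intro tendsto_divide_0[OF tendsto_const] filterlim_at_top_imp_at_infinity filterlim_pow_at_top) auto
    show "AE y in lborel. (\<lambda>n. exp (Complex (b n) y * of_real s) / (Complex (b n) y)^2) \<longlonglongrightarrow> 0"
    proof (rule AE_I2, rule Lim_null_comparison[OF _ ab], rule always_eventually, rule allI)
      fix y n
      have "cmod (exp (Complex (b n) y * of_real s) / (Complex (b n) y)^2) \<le> 1 / cmod (Complex (b n) y)^2" by (rule le)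
      also have "\<dots> \<le> 1 / \<bar>b n\<bar>^2"
        using assms(4)[of n] unfolding cmod_power2
        by (intro divide_left_mono) (auto intro!: mult_pos_pos add_pos_nonneg)
      finally show "norm (exp (Complex (b n) y * of_real s) / (Complex (b n) y)^2) \<le> 1 / \<bar>b n\<bar>^2" .
    qed
  qed auto
  then show ?thesis by simp
qed

lemma contour_integral_rectpath_exp_over_square:
  assumes "a < 0" "0 < b" "0 < T"
  shows "contour_integral (rectpath (Complex a (-T)) (Complex b T)) (\<lambda>z. exp (z * of_real s) / z^2) = 2 * pi * \<i> * s"
proof -
  let ?g = "rectpath (Complex a (-T)) (Complex b T)"
  have "contour_integral ?g (\<lambda>z. exp (z * of_real s) / z^2) =
     of_real (2 * pi) * \<i> * (\<Sum>p\<in>{0}. winding_number ?g p * residue (\<lambda>z. exp (z * of_real s) / z^2) p)"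
    by (rule Residue_theorem[where S=UNIV])
      (use assms in \<open>auto simp: path_image_rectpath intro!: holomorphic_intros\<close>)
  also have "\<dots> = of_real (2 * pi) * \<i> * (winding_number ?g 0 * residue (\<lambda>z. exp (z * of_real s) / z^2) 0)"
    by simp
  also have "winding_number ?g 0 = 1"
    by (rule winding_number_rectpath) (use assms in \<open>auto simp: in_box_complex_iff\<close>)
  also have "residue (\<lambda>z. exp (z * of_real s) / z^2) 0 = of_real s"
  proof -
    have "residue (\<lambda>z. exp (z * of_real s) / (z - 0) ^ Suc 1) 0 = (deriv ^^ 1) (\<lambda>z. exp (z * of_real s)) 0 / fact 1"
      by (rule residue_holomorphic_over_power[of UNIV]) (auto intro!: holomorphic_intros)
    moreover have "deriv (\<lambda>z. exp (z * of_real s)) 0 = complex_of_real s"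
      by (rule DERIV_imp_deriv) (auto intro!: derivative_eq_intros)
    ultimately show ?thesis unfolding power2_eq_square by (simp add: power2_eq_square)
  qed
  finally show ?thesis by simp
qed

text \<open>For \<open>s \<le> 0\<close> the line escapes to the right and crosses nothing. For
  \<open>s > 0\<close> it escapes to the left and crosses the double pole at \<open>0\<close>, where
  the residue of \<open>exp (z * s) / z^2\<close> is \<open>s\<close>. Hence the ramp, whose
  inversion integral converges absolutely.\<close>

lemma perron_integral:
  assumes "\<sigma> > 0"
  shows "(LINT y|lborel. exp (Complex \<sigma> y * of_real s) / (Complex \<sigma> y)^2) = of_real (2 * pi * max 0 s)"
proof (cases "s \<le> 0")
  case True
  have "(\<lambda>n. LINT y|lborel. exp (Complex (\<sigma> + 1 + real n) y * of_real s) / (Complex (\<sigma> + 1 + real n) y)^2) \<longlonglongrightarrow> 0"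
    by (rule vertical_integral_exp_tendsto_0[where F=at_top])
      (use assms True in \<open>auto intro!: mult_nonneg_nonpos filterlim_tendsto_add_at_top[OF tendsto_const] filterlim_real_sequentially\<close>)
  moreover have "(LINT y|lborel. exp (Complex (\<sigma> + 1 + real n) y * of_real s) / (Complex (\<sigma> + 1 + real n) y)^2)
     = (LINT y|lborel. exp (Complex \<sigma> y * of_real s) / (Complex \<sigma> y)^2)" for n
    using vertical_line_shift_holomorphic[of \<sigma> "\<sigma> + 1 + real n" 0 "\<lambda>_. 1" 1 s] assms by auto
  ultimately have "(LINT y|lborel. exp (Complex \<sigma> y * of_real s) / (Complex \<sigma> y)^2) = 0"
    by (simp add: LIMSEQ_const_iff)
  then show ?thesis using True by simp
next
  case False
  have "(\<lambda>n. LINT y|lborel. exp (Complex (-(1 + real n)) y * of_real s) / (Complex (-(1 + real n)) y)^2) \<longlonglongrightarrow> 0"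
    by (rule vertical_integral_exp_tendsto_0[where F=at_bot], unfold filterlim_uminus_at_top[symmetric])
      (use False in \<open>auto intro!: mult_nonpos_nonneg filterlim_tendsto_add_at_top[OF tendsto_const] filterlim_real_sequentially\<close>)
  moreover have line: "\<i> * ((LINT y|lborel. exp (Complex \<sigma> y * of_real s) / (Complex \<sigma> y)^2) -
     (LINT y|lborel. exp (Complex a y * of_real s) / (Complex a y)^2)) = 2 * pi * \<i> * s" if a: "a < 0" for a
  proof (rule vertical_line_shift[where C="exp (\<sigma> * s)"])
    have "integrable lborel (\<lambda>y. exp (Complex x y * of_real s) / (Complex x y)^2)" if "x \<noteq> 0" for x :: real
      by (rule integrable_vertical_inverse_square(1)[OF that, where K="exp (x * s)" and \<psi>="\<lambda>z. exp (z * of_real s)"])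
        (auto intro!: continuous_intros simp: norm_exp_eq_Re)
    then show "integrable lborel (\<lambda>y. exp (Complex a y * of_real s) / (Complex a y)^2)"
      "integrable lborel (\<lambda>y. exp (Complex \<sigma> y * of_real s) / (Complex \<sigma> y)^2)" using a assms by auto
    show "cmod (exp (z * of_real s) / z\<^sup>2) \<le> exp (\<sigma> * s) / (Im z)\<^sup>2"
      if "a \<le> Re z" "Re z \<le> \<sigma>" "Im z \<noteq> 0" for z
    proof -
      have "(Im z)^2 \<le> cmod z^2" by (simp add: cmod_def)
      moreover have "cmod (exp (z * of_real s)) \<le> exp (\<sigma> * s)"
        using that False by (auto simp: norm_exp_eq_Re intro!: mult_right_mono)
      ultimately show ?thesis using that by (auto simp: norm_divide norm_power intro!: frac_le)
    qed
    show "contour_integral (rectpath (Complex a (-T)) (Complex \<sigma> T)) (\<lambda>z. exp (z * of_real s) / z^2) = 2 * pi * \<i> * s"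
      if "T > 0" for T
      using contour_integral_rectpath_exp_over_square[OF a assms that] .
  qed (use a assms in \<open>auto intro!: continuous_intros\<close>)
  then have "(LINT y|lborel. exp (Complex a y * of_real s) / (Complex a y)^2) =
      (LINT y|lborel. exp (Complex \<sigma> y * of_real s) / (Complex \<sigma> y)^2) - 2 * pi * s" if "a < 0" for a
  proof -
    have "\<i> * ((LINT y|lborel. exp (Complex \<sigma> y * of_real s) / (Complex \<sigma> y)^2) -
     (LINT y|lborel. exp (Complex a y * of_real s) / (Complex a y)^2)) = \<i> * (2 * pi * s)"
      unfolding line[OF that] by simp
    then have "(LINT y|lborel. exp (Complex \<sigma> y * of_real s) / (Complex \<sigma> y)^2) -
     (LINT y|lborel. exp (Complex a y * of_real s) / (Complex a y)^2) = 2 * pi * s"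
      unfolding mult_cancel_left by simp
    then show ?thesis by (simp add: algebra_simps)
  qed
  ultimately have "(\<lambda>n::nat. (LINT y|lborel. exp (Complex \<sigma> y * of_real s) / (Complex \<sigma> y)^2) - complex_of_real (2 * pi * s)) \<longlonglongrightarrow> 0"
    by simp
  then show ?thesis using False by (simp add: LIMSEQ_const_iff)
qed

text \<open>The inversion formula is integrated against \<open>q x\<close> with respect to
  \<open>M\<close>. Fubini applies because the modulus of the integrand is a product of an
  integrable function of \<open>y\<close> and one of \<open>x\<close>.\<close>

lemma exp_integral_representation:
  fixes M :: "real measure" and q :: "real \<Rightarrow> complex"
  assumes sM[measurable_cong]: "sets M = sets borel" and sf: "sigma_finite_measure M" and q[measurable]: "q \<in> borel_measurable borel"
    and \<sigma>: "\<sigma> > 0" and int: "integrable M (\<lambda>x. exp (- \<sigma> * x) * cmod (q x))"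
  shows "(LINT x|M. of_real (max 0 (t - x)) * q x) = 1 / (2 * pi) *
    (LINT y|lborel. exp (Complex \<sigma> y * of_real t) * (LINT x|M. exp (- Complex \<sigma> y * of_real x) * q x) / (Complex \<sigma> y)^2)"
proof -
  interpret sigma_finite_measure M by (rule sf)
  interpret P: pair_sigma_finite lborel M ..
  define f where "f y x = exp (Complex \<sigma> y * of_real (t - x)) / (Complex \<sigma> y)^2 * q x" for y x
  have nf: "cmod (f y x) = exp (\<sigma> * t) * (1 / cmod (Complex \<sigma> y)^2) * (exp (- \<sigma> * x) * cmod (q x))" for y x
    by (simp add: f_def norm_mult norm_divide norm_power norm_exp_eq_Re right_diff_distrib exp_diff exp_minus field_simps)
  have fm[measurable]: "case_prod f \<in> borel_measurable (lborel \<Otimes>\<^sub>M M)"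
    unfolding f_def by measurable
  have fint: "integrable (lborel \<Otimes>\<^sub>M M) (case_prod f)"
  proof (rule P.Fubini_integrable[OF fm])
    show "AE y in lborel. integrable M (\<lambda>x. case_prod f (y, x))"
    proof (rule AE_I2)
      fix y :: real
      have "integrable M (\<lambda>x. exp (\<sigma> * t) * (1 / cmod (Complex \<sigma> y)^2) * (exp (- \<sigma> * x) * cmod (q x)))"
        by (intro integrable_mult_right int)
      moreover have "(\<lambda>x. f y x) \<in> borel_measurable M" unfolding f_def by measurable
      ultimately show "integrable M (\<lambda>x. case_prod f (y, x))"
        unfolding nf[symmetric] by (simp add: integrable_norm_iff)
    qed
    have "integrable lborel (\<lambda>y. exp (\<sigma> * t) * (1 / cmod (Complex \<sigma> y)^2) * (LINT x|M. exp (- \<sigma> * x) * cmod (q x)))"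
      by (intro integrable_mult_left integrable_mult_right integrable_vertical_inverse_square(2)[where \<psi>="\<lambda>_. 0" and K=0])
        (use \<sigma> in auto)
    then show "integrable lborel (\<lambda>y. LINT x|M. norm (case_prod f (y, x)))"
      by (simp add: nf)
  qed
  have "(LINT y|lborel. LINT x|M. f y x) = (LINT x|M. LINT y|lborel. f y x)"
    using P.Fubini_integral[OF fint] by simp
  also have "(\<lambda>x. LINT y|lborel. f y x) = (\<lambda>x. of_real (2 * pi) * (of_real (max 0 (t - x)) * q x))"
    unfolding f_def by (simp add: perron_integral[OF \<sigma>] mult.assoc times_divide_eq_left[symmetric] del: of_real_diff times_divide_eq_left)
  also have "(\<lambda>y. LINT x|M. f y x) = (\<lambda>y. exp (Complex \<sigma> y * of_real t) * (LINT x|M. exp (- Complex \<sigma> y * of_real x) * q x) / (Complex \<sigma> y)^2)"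
  proof
    fix y
    have "f y x = exp (Complex \<sigma> y * of_real t) / (Complex \<sigma> y)^2 * (exp (- Complex \<sigma> y * of_real x) * q x)" for x
      by (simp add: f_def right_diff_distrib exp_diff exp_minus field_simps)
    then show "(LINT x|M. f y x) = exp (Complex \<sigma> y * of_real t) * (LINT x|M. exp (- Complex \<sigma> y * of_real x) * q x) / (Complex \<sigma> y)^2"
      by simp
  qed
  finally show ?thesis by simp
qed

text \<open>Differencing inserts the factor \<open>exp (z * h) - 1\<close>. A full power
  \<open>h * cmod z\<close> would leave a kernel of order \<open>1 / cmod z\<close>, which is not
  integrable; the power \<open>1 - e\<close> leaves \<open>cmod z powr (-1 - e)\<close>, which
  is.\<close>

lemma vertical_integral_difference_bound:
  assumes a: "a > 0" and e: "0 < e" "e < 1" and cont: "continuous_on {z. Re z = a} H"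
    and bd: "\<And>y. cmod (H (Complex a y)) \<le> K"
  obtains C where "C \<ge> 0" "\<And>t h. 0 < h \<Longrightarrow> h \<le> 1 \<Longrightarrow>
     cmod ((LINT y|lborel. exp (Complex a y * of_real (t + h)) * H (Complex a y) / (Complex a y)^2) -
           (LINT y|lborel. exp (Complex a y * of_real t) * H (Complex a y) / (Complex a y)^2)) \<le>
     C * exp (a * t) * h powr (1 - e)"
proof -
  define m where "m = min \<bar>a\<bar> 1 / 2"
  have m: "m > 0" using a by (simp add: m_def)
  have K0: "K \<ge> 0" using bd[of 0] norm_ge_zero order_trans by blast
  define w where "w y = K * ((exp a + 1) * m powr (-1 - e) * (1 + \<bar>y\<bar>) powr (-1 - e))" for y :: real
  have wint: "integrable lborel w"
    unfolding w_def using e by (intro integrable_mult_right integrable_one_plus_abs_powr)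
  have w0: "w y \<ge> 0" for y unfolding w_def using K0 by (intro mult_nonneg_nonneg) (auto simp: add_nonneg_nonneg)
  let ?I = "\<lambda>t y. exp (Complex a y * of_real t) * H (Complex a y) / (Complex a y)^2"
  have int: "integrable lborel (?I t)" for t
    by (rule integrable_vertical_inverse_square[where K="exp (a * t) * K" and \<psi>="\<lambda>z. exp (z * of_real t) * H z"])
      (use a in \<open>auto intro!: continuous_intros cont mult_mono bd simp: norm_mult norm_exp_eq_Re\<close>)
  show ?thesis
  proof (rule that)
    show "(LINT y|lborel. w y) \<ge> 0" using w0 by simp
    fix t h :: real assume h: "0 < h" "h \<le> 1"
    have pt: "cmod (?I (t + h) y - ?I t y) \<le> exp (a * t) * h powr (1 - e) * w y" for y
    proof -
      define z where "z = Complex a y"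
      have z0: "cmod z > 0" using a by (auto simp: z_def complex_eq_iff)
      have zm: "m * (1 + \<bar>y\<bar>) \<le> cmod z" using norm_Complex_ge[of a y] by (simp add: m_def z_def)
      \<comment> \<open>Interpolation between the two obvious bounds: below \<open>1\<close>
        lowering the exponent from \<open>1\<close> to \<open>1 - e\<close> enlarges the power of
        \<open>h * cmod z\<close>, above \<open>1\<close> that power is at least \<open>1\<close>
        and a constant bound suffices.\<close>
      have eh: "cmod (exp (z * of_real h) - 1) \<le> (exp a + 1) * (h * cmod z) powr (1 - e)"
      proof (cases "h * cmod z \<le> 1")
        case True
        have "cmod (exp (z * of_real h) - 1) \<le> exp a * cmod (z * of_real h)"
          by (rule norm_exp_minus_one_le) (use a h in \<open>auto simp: z_def mult_left_le\<close>)
        also have "\<dots> = exp a * (h * cmod z) powr 1" using h z0 by (simp add: norm_mult)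
        also have "\<dots> \<le> (exp a + 1) * (h * cmod z) powr (1 - e)"
          using True h e z0 by (intro mult_mono powr_mono') auto
        finally show ?thesis .
      next
        case False
        have "cmod (exp (z * of_real h) - 1) \<le> cmod (exp (z * of_real h)) + 1"
          using norm_triangle_ineq4[of "exp (z * of_real h)" 1] by simp
        also have "\<dots> \<le> (exp a + 1) * 1" using a h by (auto simp: norm_exp_eq_Re z_def mult_left_le)
        also have "\<dots> \<le> (exp a + 1) * (h * cmod z) powr (1 - e)"
          using False e by (intro mult_left_mono ge_one_powr_ge_zero) auto
        finally show ?thesis .
      qed
      have "?I (t + h) y - ?I t y = exp (z * of_real t) * (exp (z * of_real h) - 1) * H z / z^2"
        by (simp add: z_def distrib_left exp_add algebra_simps diff_divide_distrib)
      then have "cmod (?I (t + h) y - ?I t y) = exp (a * t) * cmod (exp (z * of_real h) - 1) * cmod (H z) / cmod z^2"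
        by (simp add: norm_mult norm_divide norm_power norm_exp_eq_Re z_def)
      also have "\<dots> \<le> exp (a * t) * ((exp a + 1) * (h * cmod z) powr (1 - e)) * K / cmod z^2"
        using eh bd[of y] K0 by (intro divide_right_mono mult_mono) (auto simp: z_def add_nonneg_nonneg)
      also have "\<dots> = exp (a * t) * h powr (1 - e) * (K * ((exp a + 1) * cmod z powr (-1 - e)))"
      proof -
        have "cmod z powr (1 - e) / cmod z^2 = cmod z powr (1 - e - 2)"
          by (subst powr_diff) (use z0 in \<open>simp add: powr_numeral\<close>)
        then show ?thesis using h z0 by (simp add: powr_mult field_simps)
      qed
      also have "\<dots> \<le> exp (a * t) * h powr (1 - e) * w y"
      proof -
        have "cmod z powr (-1 - e) \<le> (m * (1 + \<bar>y\<bar>)) powr (-1 - e)"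
          using zm m e by (intro powr_mono2') (auto intro!: mult_pos_pos)
        also have "\<dots> = m powr (-1 - e) * (1 + \<bar>y\<bar>) powr (-1 - e)" by (rule powr_mult)
        finally show ?thesis unfolding w_def using K0 by (auto intro!: mult_left_mono simp: mult.assoc add_nonneg_nonneg)
      qed
      finally show ?thesis .
    qed
    have "cmod ((LINT y|lborel. ?I (t + h) y) - (LINT y|lborel. ?I t y)) = cmod (LINT y|lborel. ?I (t + h) y - ?I t y)"
      by (simp only: Bochner_Integration.integral_diff[OF int int])
    also have "\<dots> \<le> (LINT y|lborel. exp (a * t) * h powr (1 - e) * w y)"
    proof (rule Bochner_Integration.integral_norm_bound_integral)
      show "integrable lborel (\<lambda>y. ?I (t + h) y - ?I t y)"
        by (rule Bochner_Integration.integrable_diff[OF int int])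
      show "integrable lborel (\<lambda>y. exp (a * t) * h powr (1 - e) * w y)"
        by (rule integrable_mult_right) (rule wint)
    qed (rule pt)
    finally show "cmod ((LINT y|lborel. ?I (t + h) y) - (LINT y|lborel. ?I t y)) \<le> (LINT y|lborel. w y) * exp (a * t) * h powr (1 - e)"
      by (simp add: mult_ac)
  qed
qed

section \<open>From Laplace transforms to cumulative asymptotics\<close>

lemma integrable_vertical_inverse_square_measurable:
  fixes \<psi> :: "real \<Rightarrow> complex"
  assumes a: "a \<noteq> 0" and [measurable]: "\<psi> \<in> borel_measurable borel" and bd: "\<And>y. cmod (\<psi> y) \<le> K"
  shows "integrable lborel (\<lambda>y. \<psi> y / (Complex a y)^2)"
proof -
  have K: "K \<ge> 0" using bd[of 0] norm_ge_zero[of "\<psi> 0"] by linarith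
  have 2: "integrable lborel (\<lambda>y. 1 / cmod (Complex a y)^2)"
    by (rule integrable_vertical_inverse_square(2)[OF a, where \<psi>="\<lambda>_. 0" and K=0]) auto
  show ?thesis
    by (rule Bochner_Integration.integrable_bound[OF integrable_mult_right[OF 2, of K]])
      (use K in \<open>auto simp: norm_divide norm_power intro!: divide_right_mono bd\<close>)
qed

text \<open>The right-hand side contains one term of the exponential series. Every polynomial factor
  in the expansion is traded in this way for an arbitrarily small exponential rate.\<close>

lemma power_le_exp:
  fixes x c :: real
  assumes "x \<ge> 0" "c > 0"
  shows "x ^ k \<le> fact k / c ^ k * exp (c * x)"
proof -
  have "(\<Sum>n\<in>{k}. (c * x) ^ n /\<^sub>R fact n) \<le> (\<Sum>n. (c * x) ^ n /\<^sub>R fact n)"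
    using assms by (intro sum_le_suminf summable_exp_generic) auto
  then have "(c * x) ^ k / fact k \<le> exp (c * x)" by (simp add: exp_def divide_inverse mult.commute)
  then show ?thesis using assms by (simp add: power_mult_distrib field_simps)
qed

lemma integrable_power_times_exp:
  fixes w :: complex
  assumes w: "Re w > 0"
  shows "set_integrable lborel {0..} (\<lambda>x. of_real x ^ k * exp (- w * of_real x))"
proof -
  \<comment> \<open>Half of the decay rate absorbs \<open>x ^ k\<close>, the other half keeps the
    integral finite.\<close>
  define c where "c = Re w / 2"
  have c: "c > 0" "Re w = 2 * c" using w by (auto simp: c_def)
  have e: "integrable lborel (\<lambda>x::real. indicator {0..} x * exp (- c * x))"
  proof (rule integrableI_nonneg)
    have "(\<integral>\<^sup>+x. ennreal (exp (- c * x)) * indicator {0..} x \<partial>lborel) = ennreal (0 - (- exp (- c * 0) / c))"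
    proof (rule nn_integral_FTC_atLeast)
      show "((\<lambda>x. - exp (- c * x) / c) \<longlongrightarrow> 0) at_top" using c(1) by real_asymp
      show "DERIV (\<lambda>x. - exp (- c * x) / c) x :> exp (- c * x)" for x
        using c by (auto intro!: derivative_eq_intros)
    qed auto
    then have "(\<integral>\<^sup>+x. ennreal (exp (- c * x)) * indicator {0..} x \<partial>lborel) < \<infinity>" by simp
    also have "(\<integral>\<^sup>+x. ennreal (exp (- c * x)) * indicator {0..} x \<partial>lborel) = (\<integral>\<^sup>+x. ennreal (indicator {0..} x * exp (- c * x)) \<partial>lborel)"
      by (intro nn_integral_cong) (auto split: split_indicator)
    finally show "(\<integral>\<^sup>+x. ennreal (indicator {0..} x * exp (- c * x)) \<partial>lborel) < \<infinity>" .
  qed auto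
  have bd: "x ^ k * exp (- (2 * c) * x) \<le> fact k / c ^ k * exp (- c * x)" if "x \<ge> 0" for x
  proof -
    have "x ^ k \<le> fact k / c ^ k * exp (c * x)" by (rule power_le_exp[OF that c(1)])
    then have "x ^ k * exp (- (2 * c) * x) \<le> fact k / c ^ k * exp (c * x) * exp (- (2 * c) * x)"
      by (intro mult_right_mono) auto
    also have "\<dots> = fact k / c ^ k * exp (- c * x)" by (simp add: mult.assoc exp_add[symmetric])
    finally show ?thesis .
  qed
  show ?thesis unfolding set_integrable_def
    by (rule Bochner_Integration.integrable_bound[OF integrable_mult_right[OF e, of "fact k / c ^ k"]])
      (use bd c in \<open>auto simp: norm_mult norm_power norm_exp_eq_Re mult.assoc split: split_indicator\<close>)
qed

text \<open>With \<open>w = z - l\<close> this identifies the pole term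
  \<open>fact m / (z - l) ^ (m + 1)\<close> as the transform of \<open>x ^ m * exp (l * x)\<close>,
  which fixes the normalisation of the coefficient matrices.\<close>

lemma integral_power_times_exp:
  fixes w :: complex
  assumes w: "Re w > 0"
  shows "(LINT x:{0..}|lborel. of_real x ^ k * exp (- w * of_real x)) = fact k / w ^ (k + 1)"
proof -
  have w0: "w \<noteq> 0" using w by auto
  have FTC: "(LINT x:{0..}|lborel. f x) = B - F 0"
    if "set_integrable lborel {0..} f" "\<And>x. x \<ge> 0 \<Longrightarrow> (F has_vector_derivative f x) (at x)"
      "continuous_on UNIV f" "(F \<longlongrightarrow> B) at_top" for f F :: "real \<Rightarrow> complex" and B
  proof -
    have "((\<lambda>b. LINT x:{0..b}|lborel. f x) \<longlongrightarrow> (LINT x:{0..}|lborel. f x)) at_top"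
      by (rule tendsto_set_lebesgue_integral_at_top) (use that in auto)
    moreover have "((\<lambda>b. LINT x:{0..b}|lborel. f x) \<longlongrightarrow> B - F 0) at_top"
    proof (rule Lim_transform_eventually)
      show "((\<lambda>b. F b - F 0) \<longlongrightarrow> B - F 0) at_top" using that by (intro tendsto_intros)
      show "\<forall>\<^sub>F b in at_top. F b - F 0 = (LINT x:{0..b}|lborel. f x)"
        using eventually_ge_at_top[of 0]
      proof eventually_elim
        case (elim b)
        then show ?case unfolding set_lebesgue_integral_def
          by (subst integral_FTC_atLeastAtMost[where F=F])
            (use that in \<open>auto intro: has_vector_derivative_at_within continuous_on_subset\<close>)
      qed
    qed
    ultimately show ?thesis by (rule tendsto_unique[OF trivial_limit_at_top_linorder])
  qed
  have lim: "((\<lambda>x::real. of_real x ^ n * exp (- w * of_real x) * c) \<longlongrightarrow> 0) at_top" for n and c :: complex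
  proof (rule Lim_null_comparison)
    show "((\<lambda>x. x ^ n * exp (- Re w * x) * cmod c) \<longlongrightarrow> 0) at_top" using w by real_asymp
    show "\<forall>\<^sub>F x in at_top. norm (of_real x ^ n * exp (- w * of_real x) * c) \<le> x ^ n * exp (- Re w * x) * cmod c"
      using eventually_ge_at_top[of 0] by eventually_elim (auto simp: norm_mult norm_power norm_exp_eq_Re)
  qed
  have der: "((\<lambda>x. g (complex_of_real x)) has_vector_derivative g') (at x)"
    if "(g has_field_derivative g') (at (of_real x))" for g g' and x :: real
    using that by (rule has_vector_derivative_real_field)
  show ?thesis
  proof (induction k)
    case 0
    have "(LINT x:{0..}|lborel. of_real x ^ 0 * exp (- w * of_real x)) = 0 - (of_real 0 ^ 0 * exp (- w * of_real 0) * (- 1 / w))"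
    proof (rule FTC[OF integrable_power_times_exp[OF w]])
      show "((\<lambda>x. of_real x ^ 0 * exp (- w * of_real x) * (- 1 / w)) has_vector_derivative of_real x ^ 0 * exp (- w * of_real x)) (at x)" for x
        by (rule der) (use w0 in \<open>auto intro!: derivative_eq_intros\<close>)
    next
      show "continuous_on UNIV (\<lambda>x. of_real x ^ 0 * exp (- w * of_real x))"
        by (intro continuous_intros)
    qed (rule lim)
    then show ?case by simp
  next
    case (Suc k)
    let ?f = "\<lambda>k x. of_real x ^ k * exp (- w * of_real x) :: complex"
    have int: "set_integrable lborel {0..} (\<lambda>x. ?f (Suc k) x - of_nat (Suc k) / w * ?f k x)"
      by (intro set_integral_diff integrable_power_times_exp w set_integrable_mult_right)
    \<comment> \<open>Integration by parts: the integrand is the derivative of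
      \<open>- ?f (Suc k) x / w\<close>, which vanishes at \<open>0\<close> and at infinity.\<close>
    have "(LINT x:{0..}|lborel. ?f (Suc k) x - of_nat (Suc k) / w * ?f k x) = 0 - (?f (Suc k) 0 * (- 1 / w))"
    proof (rule FTC[OF int])
      show "((\<lambda>x. ?f (Suc k) x * (- 1 / w)) has_vector_derivative ?f (Suc k) x - of_nat (Suc k) / w * ?f k x) (at x)" for x
      proof (rule der)
        let ?z = "complex_of_real x"
        have "((\<lambda>z. z ^ Suc k) has_field_derivative (1 + of_nat k) * (1 * ?z ^ k)) (at ?z)"
          by (rule DERIV_power_Suc[OF DERIV_ident])
        moreover have "((\<lambda>z. exp (- w * z)) has_field_derivative exp (- w * ?z) * - w) (at ?z)"
          by (auto intro!: derivative_eq_intros)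
        ultimately have "((\<lambda>z. z ^ Suc k * exp (- w * z) * (- 1 / w)) has_field_derivative
          ((1 + of_nat k) * (1 * ?z ^ k) * exp (- w * ?z) + exp (- w * ?z) * - w * ?z ^ Suc k) * (- 1 / w)) (at ?z)"
          by (intro DERIV_cmult_right DERIV_mult)
        moreover have "((1 + of_nat k) * (1 * ?z ^ k) * exp (- w * ?z) + exp (- w * ?z) * - w * ?z ^ Suc k) * (- 1 / w)
          = ?f (Suc k) x - of_nat (Suc k) / w * ?f k x" using w0 by (simp add: field_simps)
        ultimately show "((\<lambda>z. z ^ Suc k * exp (- w * z) * (- 1 / w)) has_field_derivative ?f (Suc k) x - of_nat (Suc k) / w * ?f k x) (at ?z)"
          by simp
      qed
    next
      show "continuous_on UNIV (\<lambda>x. ?f (Suc k) x - of_nat (Suc k) / w * ?f k x)"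
        by (intro continuous_intros)
    qed (rule lim)
    then have "(LINT x:{0..}|lborel. ?f (Suc k) x) - of_nat (Suc k) / w * (LINT x:{0..}|lborel. ?f k x) = 0"
      by (subst (asm) set_integral_diff(2)[OF integrable_power_times_exp[OF w] set_integrable_mult_right[OF integrable_power_times_exp[OF w]]])
        (simp only: set_integral_mult_right power_0_Suc mult_zero_left diff_zero of_real_0)
    then show ?case using w0 unfolding Suc.IH by (simp add: field_simps)
  qed
qed

section \<open>From the integrated function back to the cumulative mass\<close>

lemma le_exp_div:
  fixes \<sigma> u :: real
  assumes "\<sigma> > 0" shows "max 0 u \<le> exp (\<sigma> * u) / \<sigma>"
proof -
  have "\<sigma> * u \<le> exp (\<sigma> * u)" using exp_ge_add_one_self[of "\<sigma> * u"] by linarith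
  then show ?thesis using assms by (simp add: pos_le_divide_eq mult.commute)
qed

text \<open>Both ends are within \<open>d\<close> of \<open>p\<close>, so they are at most
  \<open>2 * d\<close> apart; the third \<open>d\<close> is the distance from \<open>a\<close> to
  \<open>p\<close>. This converts a real order enclosure into a complex error bound.\<close>

lemma norm_sandwich:
  fixes a b n :: real and p :: complex
  assumes "a \<le> n" "n \<le> b" "cmod (of_real a - p) \<le> d" "cmod (of_real b - p) \<le> d"
  shows "cmod (of_real n - p) \<le> 3 * d"
proof -
  have "b - a = Re ((of_real b - p) - (of_real a - p))" by simp
  also have "\<dots> \<le> cmod ((of_real b - p) - (of_real a - p))" by (rule complex_Re_le_cmod)
  also have "\<dots> \<le> d + d" using assms by (intro order_trans[OF norm_triangle_ineq4 add_mono])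
  finally have "\<bar>n - a\<bar> \<le> 2 * d" using assms by simp
  then have "cmod (of_real n - of_real a) \<le> 2 * d"
    by (metis norm_of_real of_real_diff)
  moreover have "cmod (of_real n - p) \<le> cmod (of_real n - of_real a) + cmod (of_real a - p)"
    using norm_triangle_ineq[of "of_real n - of_real a" "of_real a - p"] by simp
  ultimately show ?thesis using assms by linarith
qed

text \<open>Only values on \<open>Re z = \<sigma>\<close> enter, where both transforms converge
  absolutely; the continuation of \<open>H\<close> to the left is used later to move the
  line.\<close>

lemma exp_integral_representation_difference:
  fixes U :: "real measure" and Q :: "real \<Rightarrow> complex"
  assumes sU[measurable_cong]: "sets U = sets borel" and sf: "sigma_finite_measure U"
    and intU: "integrable U (\<lambda>x. exp (- \<sigma> * x))"
    and [measurable]: "Q \<in> borel_measurable borel" and intQ: "integrable lborel (\<lambda>x. exp (- \<sigma> * x) * cmod (Q x))"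
    and \<sigma>: "\<sigma> > 0"
    and eq: "\<And>y. H (Complex \<sigma> y) = (LINT x|U. exp (- Complex \<sigma> y * of_real x)) - (LINT x|lborel. exp (- Complex \<sigma> y * of_real x) * Q x)"
  shows "of_real (LINT x|U. max 0 (t - x)) - (LINT x|lborel. of_real (max 0 (t - x)) * Q x) =
    1 / (2 * pi) * (LINT y|lborel. exp (Complex \<sigma> y * of_real t) * H (Complex \<sigma> y) / (Complex \<sigma> y)^2)"
proof -
  have L: "integrable lborel (\<lambda>y. exp (Complex \<sigma> y * of_real t) * (LINT x|M. exp (- Complex \<sigma> y * of_real x) * q x) / (Complex \<sigma> y)^2)"
    if sM[measurable_cong]: "sets M = sets borel" and sf: "sigma_finite_measure M" and q[measurable]: "q \<in> borel_measurable borel"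
      and int: "integrable M (\<lambda>x. exp (- \<sigma> * x) * cmod (q x))" for M q
  proof (rule integrable_vertical_inverse_square_measurable[where K="exp (\<sigma> * t) * (LINT x|M. exp (- \<sigma> * x) * cmod (q x))"])
    interpret sigma_finite_measure M by (rule sf)
    show "(\<lambda>y. exp (Complex \<sigma> y * of_real t) * (LINT x|M. exp (- Complex \<sigma> y * of_real x) * q x)) \<in> borel_measurable borel"
      by measurable
    fix y
    have "cmod (LINT x|M. exp (- Complex \<sigma> y * of_real x) * q x) \<le> (LINT x|M. exp (- \<sigma> * x) * cmod (q x))"
      by (rule order_trans[OF integral_norm_bound]) (simp add: norm_mult norm_exp_eq_Re)
    then show "cmod (exp (Complex \<sigma> y * of_real t) * (LINT x|M. exp (- Complex \<sigma> y * of_real x) * q x)) \<le> exp (\<sigma> * t) * (LINT x|M. exp (- \<sigma> * x) * cmod (q x))"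
      by (simp add: norm_mult norm_exp_eq_Re)
  qed (use \<sigma> in auto)
  have U1: "integrable U (\<lambda>x. exp (- \<sigma> * x) * cmod 1)" using intU by simp
  have "of_real (LINT x|U. max 0 (t - x)) = (LINT x|U. complex_of_real (max 0 (t - x)) * 1)"
    by (simp only: mult_1_right integral_complex_of_real)
  also have "\<dots> = 1 / (2 * pi) * (LINT y|lborel. exp (Complex \<sigma> y * of_real t) * (LINT x|U. exp (- Complex \<sigma> y * of_real x) * 1) / (Complex \<sigma> y)^2)"
    by (rule exp_integral_representation[OF sU sf _ \<sigma> U1]) auto
  finally have eU: "of_real (LINT x|U. max 0 (t - x)) = \<dots>" .
  have eQ: "(LINT x|lborel. of_real (max 0 (t - x)) * Q x) = 1 / (2 * pi) * (LINT y|lborel. exp (Complex \<sigma> y * of_real t) * (LINT x|lborel. exp (- Complex \<sigma> y * of_real x) * Q x) / (Complex \<sigma> y)^2)"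
    by (rule exp_integral_representation[OF _ _ _ \<sigma> intQ]) (auto intro: lborel.sigma_finite_measure_axioms)
  have "1 / (2 * pi) * (LINT y|lborel. exp (Complex \<sigma> y * of_real t) * H (Complex \<sigma> y) / (Complex \<sigma> y)^2) =
     1 / (2 * pi) * (LINT y|lborel. exp (Complex \<sigma> y * of_real t) * (LINT x|U. exp (- Complex \<sigma> y * of_real x) * 1) / (Complex \<sigma> y)^2
       - exp (Complex \<sigma> y * of_real t) * (LINT x|lborel. exp (- Complex \<sigma> y * of_real x) * Q x) / (Complex \<sigma> y)^2)"
    by (simp add: eq right_diff_distrib diff_divide_distrib)
  also have "\<dots> = of_real (LINT x|U. max 0 (t - x)) - (LINT x|lborel. of_real (max 0 (t - x)) * Q x)"
    unfolding eU eQ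
    by (subst Bochner_Integration.integral_diff[OF L[OF sU sf _ U1] L[OF _ _ _ intQ]])
      (auto simp: right_diff_distrib intro: lborel.sigma_finite_measure_axioms)
  finally show ?thesis by simp
qed

text \<open>\<open>W\<close> and \<open>WQ\<close> are the integrals of the two cumulative
  functions, and \<open>W - WQ\<close> is given by a vertical integral over \<open>Re z = a\<close>.
  Monotonicity of the cumulative mass encloses it between a backward and a forward difference
  quotient of \<open>W\<close>, and each quotient is compared with \<open>PQ\<close> at
  \<open>t\<close>.\<close>

lemma cumulative_asymptotics:
  fixes U :: "real measure" and Q H :: "_ \<Rightarrow> complex"
  assumes sU[measurable_cong]: "sets U = sets borel" and sf: "sigma_finite_measure U"
    and intU: "integrable U (\<lambda>x. exp (- \<sigma> * x))"
    and [measurable]: "Q \<in> borel_measurable borel" and Q0: "\<And>x. x < 0 \<Longrightarrow> Q x = 0"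
    and QB: "\<And>x. x \<ge> 0 \<Longrightarrow> cmod (Q x) \<le> CQ * exp (\<beta> * x)"
    and ord: "0 < a" "S < a" "a < \<theta>" "\<theta> < \<beta>" "\<beta> < \<sigma>"
    and hol: "H holomorphic_on {z. Re z > S}"
    and bd: "\<And>z. a \<le> Re z \<Longrightarrow> Re z \<le> \<sigma> \<Longrightarrow> cmod (H z) \<le> K"
    and eq: "\<And>y. H (Complex \<sigma> y) = (LINT x|U. exp (- Complex \<sigma> y * of_real x)) - (LINT x|lborel. exp (- Complex \<sigma> y * of_real x) * Q x)"
  obtains C where "\<And>t. t \<ge> 0 \<Longrightarrow> cmod (of_real (measure U {..t}) - (LINT x|lborel. indicator {..t} x *\<^sub>R Q x)) \<le> C * exp (\<theta> * t)"
proof -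
  have \<sigma>: "\<sigma> > 0" using ord by simp
  have CQ: "CQ \<ge> 0" using order_trans[OF norm_ge_zero QB[of 0]] by simp
  have intQ: "integrable lborel (\<lambda>x. exp (- \<sigma> * x) * cmod (Q x))"
  proof (rule Bochner_Integration.integrable_bound)
    have "set_integrable lborel {0..} (\<lambda>x. of_real x ^ 0 * exp (- complex_of_real (\<sigma> - \<beta>) * of_real x))"
      by (rule integrable_power_times_exp) (use ord in auto)
    then have "integrable lborel (\<lambda>x. norm (indicator {0..} x *\<^sub>R (of_real x ^ 0 * exp (- complex_of_real (\<sigma> - \<beta>) * of_real x))))"
      unfolding set_integrable_def by (rule integrable_norm)
    then show "integrable lborel (\<lambda>x. CQ * norm (indicator {0..} x *\<^sub>R (of_real x ^ 0 * exp (- complex_of_real (\<sigma> - \<beta>) * of_real x))))"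
      by (rule integrable_mult_right)
    have "exp (- \<sigma> * x) * cmod (Q x) \<le> CQ * (indicator {0..} x * exp (- (\<sigma> - \<beta>) * x))" for x
    proof (cases "x < 0")
      case False
      then have "exp (- \<sigma> * x) * cmod (Q x) \<le> exp (- \<sigma> * x) * (CQ * exp (\<beta> * x))" by (intro mult_left_mono QB) auto
      also have "\<dots> = CQ * exp (- (\<sigma> - \<beta>) * x)" by (simp add: algebra_simps exp_add[symmetric])
      finally show ?thesis using False by simp
    qed (simp add: Q0)
    then show "AE x in lborel. norm (exp (- \<sigma> * x) * cmod (Q x)) \<le> norm (CQ * norm (indicator {0..} x *\<^sub>R (of_real x ^ 0 * exp (- complex_of_real (\<sigma> - \<beta>) * of_real x))))"
      using CQ by (intro AE_I2) (auto simp: norm_exp_eq_Re)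
  qed auto
  define W where "W t = (LINT x|U. max 0 (t - x))" for t
  define WQ where "WQ t = (LINT x|lborel. complex_of_real (max 0 (t - x)) * Q x)" for t
  define PQ where "PQ t = (LINT x|lborel. indicator {..t} x *\<^sub>R Q x)" for t
  define I where "I t = (LINT y|lborel. exp (Complex a y * of_real t) * H (Complex a y) / (Complex a y)^2)" for t
  have ramp: "max 0 (t - x) \<le> exp (\<sigma> * t) / \<sigma> * exp (- \<sigma> * x)" for t x
  proof -
    have "max 0 (t - x) \<le> exp (\<sigma> * (t - x)) / \<sigma>" by (rule le_exp_div[OF \<sigma>])
    also have "\<dots> = exp (\<sigma> * t) / \<sigma> * exp (- \<sigma> * x)" by (simp add: right_diff_distrib exp_diff exp_minus divide_inverse)
    finally show ?thesis .
  qed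
  have step: "indicator {..t} x \<le> exp (\<sigma> * t) * exp (- \<sigma> * x)" for t x :: real
    using \<sigma> by (auto simp: exp_add[symmetric] split: split_indicator)
  have iW: "integrable U (\<lambda>x. max 0 (t - x))" for t
    by (rule Bochner_Integration.integrable_bound[OF integrable_mult_right[OF intU, of "exp (\<sigma> * t) / \<sigma>"]])
      (use ramp[of t] \<sigma> in \<open>auto intro!: AE_I2\<close>)
  have iN: "integrable U (indicator {..t} :: real \<Rightarrow> real)" for t
    by (rule Bochner_Integration.integrable_bound[OF integrable_mult_right[OF intU, of "exp (\<sigma> * t)"]])
      (use step[of t] in \<open>auto intro!: AE_I2\<close>)
  have iWQ: "integrable lborel (\<lambda>x. complex_of_real (max 0 (t - x)) * Q x)" for t
  proof (rule Bochner_Integration.integrable_bound[OF integrable_mult_right[OF intQ]])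
    show "AE x in lborel. norm (complex_of_real (max 0 (t - x)) * Q x) \<le> norm (exp (\<sigma> * t) / \<sigma> * (exp (- \<sigma> * x) * cmod (Q x)))"
      using mult_right_mono[OF ramp norm_ge_zero] \<sigma> by (auto simp: norm_mult abs_mult mult.assoc)
  qed simp
  have iPQ: "integrable lborel (\<lambda>x. indicator {..t} x *\<^sub>R Q x)" for t
  proof (rule Bochner_Integration.integrable_bound[OF integrable_mult_right[OF intQ]])
    show "AE x in lborel. norm (indicator {..t} x *\<^sub>R Q x) \<le> norm (exp (\<sigma> * t) * (exp (- \<sigma> * x) * cmod (Q x)))"
      using mult_right_mono[OF step norm_ge_zero] \<sigma> by (auto simp: norm_mult abs_mult mult.assoc)
  qed simp
  have N: "measure U {..t} = (LINT x|U. indicator {..t} x)" for t by simp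
  have WI: "complex_of_real (W t) - WQ t = 1 / (2 * pi) * I t" for t
    unfolding W_def WQ_def I_def
    by (subst exp_integral_representation_difference[OF sU sf intU _ intQ \<sigma> eq])
      (use vertical_line_shift_holomorphic[of a \<sigma> S H K t] ord hol bd in auto)
  \<comment> \<open>With \<open>h = exp (- (\<beta> - \<theta>) * t)\<close> the loss
    \<open>h powr (-e)\<close> is \<open>exp (e * (\<beta> - \<theta>) * t)\<close>, which this
    choice keeps below \<open>exp ((\<theta> - a) * t)\<close>. The bound \<open>1/2\<close> ensures
    \<open>e < 1\<close>.\<close>
  define e where "e = min (1/2) ((\<theta> - a) / (\<beta> - \<theta>))"
  have e: "0 < e" "e < 1" "e * (\<beta> - \<theta>) \<le> \<theta> - a"
    using ord by (auto simp: e_def min_def field_simps)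
  obtain C where C: "C \<ge> 0" "\<And>t h. 0 < h \<Longrightarrow> h \<le> 1 \<Longrightarrow> cmod (I (t + h) - I t) \<le> C * exp (a * t) * h powr (1 - e)"
  proof (rule vertical_integral_difference_bound[OF ord(1) e(1,2)])
    show "continuous_on {z. Re z = a} H"
      by (rule continuous_on_subset[OF holomorphic_on_imp_continuous_on[OF hol]]) (use ord in auto)
    show "cmod (H (Complex a y)) \<le> K" for y using bd[of "Complex a y"] ord by simp
  qed (use that in \<open>auto simp: I_def\<close>)
  \<comment> \<open>The difference of the two ramps equals \<open>h\<close> up to \<open>u\<close>
    and \<open>0\<close> beyond \<open>u + h\<close>, so it differs from \<open>h\<close> times the
    indicator of \<open>{..c}\<close> only on \<open>{u<..u + h}\<close>. The free point
    \<open>c\<close> in this window serves the forward step, \<open>u = t\<close>, and the backward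
    step, \<open>u = t - h\<close>, at once.\<close>
  have diffQ: "cmod (WQ (u + h) - WQ u - of_real h * PQ c) \<le> h * (h * (CQ * exp (\<beta> * (u + h))))"
    if uc: "u \<le> c" "c \<le> u + h" "u + h \<ge> 0" for u h c
  proof -
    let ?g = "\<lambda>x. complex_of_real (max 0 (u + h - x)) * Q x - complex_of_real (max 0 (u - x)) * Q x - of_real h * (indicator {..c} x *\<^sub>R Q x)"
    have ig: "integrable lborel ?g" by (intro Bochner_Integration.integrable_diff iWQ integrable_mult_right iPQ)
    have eq: "WQ (u + h) - WQ u - of_real h * PQ c = (LINT x|lborel. ?g x)"
      unfolding WQ_def PQ_def
      by (simp only: Bochner_Integration.integral_diff[OF Bochner_Integration.integrable_diff[OF iWQ iWQ] integrable_mult_right[OF iPQ]]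
        Bochner_Integration.integral_diff[OF iWQ iWQ] Bochner_Integration.integral_mult_right_zero)
    have "cmod (LINT x|lborel. ?g x) \<le> (LINT x|lborel. h * (CQ * exp (\<beta> * (u + h))) * indicator {u<..u+h} x)"
    proof (rule Bochner_Integration.integral_norm_bound_integral[OF ig])
      show "integrable lborel (\<lambda>x. h * (CQ * exp (\<beta> * (u + h))) * indicator {u<..u + h} x)"
        using uc by (intro integrable_mult_right integrable_real_indicator) (auto simp: emeasure_lborel_Ioc)
      fix x :: real
      let ?r = "max 0 (u + h - x) - max 0 (u - x) - h * indicator {..c} x"
      have "?g x = of_real ?r * Q x"
        by (auto simp: algebra_simps split: split_indicator)
      then have n: "cmod (?g x) = \<bar>?r\<bar> * cmod (Q x)" by (simp only: norm_mult norm_of_real)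
      show "cmod (?g x) \<le> h * (CQ * exp (\<beta> * (u + h))) * indicator {u<..u + h} x"
      proof (cases "x \<in> {u<..u + h} \<and> x \<ge> 0")
        case True
        have r: "\<bar>?r\<bar> \<le> h" using True uc by (auto split: split_indicator)
        have "cmod (Q x) \<le> CQ * exp (\<beta> * (u + h))"
          using True ord CQ by (intro order_trans[OF QB]) (auto intro!: mult_left_mono)
        then have "\<bar>?r\<bar> * cmod (Q x) \<le> h * (CQ * exp (\<beta> * (u + h)))"
          using r uc by (intro mult_mono) auto
        then show ?thesis unfolding n using True by simp
      next
        case False
        then consider "x < 0" | "x \<le> u" | "x > u + h" by force
        then have "cmod (?g x) = 0" unfolding n using uc by cases (auto simp: Q0)
        moreover have "0 \<le> h * (CQ * exp (\<beta> * (u + h))) * indicator {u<..u + h} x"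
          using uc CQ by (auto intro!: mult_nonneg_nonneg)
        ultimately show ?thesis by linarith
      qed
    qed
    also have "\<dots> = h * (CQ * exp (\<beta> * (u + h))) * measure lborel {u<..u+h}"
      unfolding Bochner_Integration.integral_mult_right_zero by simp
    also have "measure lborel {u<..u+h} = h" using uc by simp
    also have "h * (CQ * exp (\<beta> * (u + h))) * h = h * (h * (CQ * exp (\<beta> * (u + h))))" by (rule mult.commute)
    finally show ?thesis unfolding eq .
  qed
  have main: "cmod (of_real (measure U {..t}) - PQ t) \<le> 3 * (CQ * exp \<beta> + C) * exp (\<theta> * t)" if t: "t \<ge> 0" for t
  proof -
    \<comment> \<open>Chosen so that \<open>h * exp (\<beta> * t) = exp (\<theta> * t)\<close>; it
      is at most \<open>1\<close> because \<open>\<theta> < \<beta>\<close> and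
      \<open>t \<ge> 0\<close>.\<close>
    define h where "h = exp (- (\<beta> - \<theta>) * t)"
    have h: "0 < h" "h \<le> 1" using t ord by (auto simp: h_def mult_nonpos_nonneg)
    \<comment> \<open>Error for one step before division by \<open>h\<close>. It is stated at
      \<open>t + 1\<close>, which dominates \<open>u + h\<close> for both steps; this shift is the
      source of \<open>exp \<beta>\<close> in the constant.\<close>
    define d where "d = h * (h * (CQ * exp (\<beta> * (t + 1)))) + C * exp (a * t) * h powr (1 - e)"
    have near: "cmod (of_real (W (u + h) - W u) - of_real h * PQ t) \<le> d" if u: "u \<le> t" "t \<le> u + h" for u
    proof -
      have "complex_of_real (W (u + h) - W u) = WQ (u + h) - WQ u + 1 / (2 * pi) * (I (u + h) - I u)"
        using WI[of u] WI[of "u + h"] by (simp add: algebra_simps diff_divide_distrib)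
      then have "of_real (W (u + h) - W u) - of_real h * PQ t =
          (WQ (u + h) - WQ u - of_real h * PQ t) + of_real (1 / (2 * pi)) * (I (u + h) - I u)"
        by (simp add: algebra_simps)
      also have "cmod \<dots> \<le> h * (h * (CQ * exp (\<beta> * (u + h)))) + 1 * (C * exp (a * u) * h powr (1 - e))"
      proof (rule order_trans[OF norm_triangle_ineq add_mono])
        show "cmod (WQ (u + h) - WQ u - of_real h * PQ t) \<le> h * (h * (CQ * exp (\<beta> * (u + h))))"
          by (rule diffQ) (use u h t in auto)
        have "1 / (2 * pi) \<le> 1" using pi_gt3 by simp
        then show "cmod (of_real (1 / (2 * pi)) * (I (u + h) - I u)) \<le> 1 * (C * exp (a * u) * h powr (1 - e))"
          unfolding norm_mult norm_of_real using C(2)[OF h, of u] by (intro mult_mono) auto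
      qed
      also have "\<dots> \<le> d"
        unfolding d_def using u h ord C(1) CQ
        by (auto intro!: add_mono mult_left_mono mult_right_mono)
      finally show ?thesis .
    qed
    \<comment> \<open>The forward ramp difference lies above \<open>h\<close> times the indicator of
      \<open>{..t}\<close>, the backward one below it; integrating against the positive measure
      \<open>U\<close> preserves this order.\<close>
    have up: "h * measure U {..t} \<le> W (t + h) - W t"
    proof -
      have "h * measure U {..t} = (LINT x|U. h * indicator {..t} x)" unfolding N by simp
      also have "\<dots> \<le> (LINT x|U. max 0 (t + h - x) - max 0 (t - x))"
        by (intro integral_mono integrable_mult_right iN Bochner_Integration.integrable_diff iW)
          (use h in \<open>auto split: split_indicator\<close>)
      also have "\<dots> = W (t + h) - W t" unfolding W_def by (intro Bochner_Integration.integral_diff iW)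
      finally show ?thesis .
    qed
    have lo: "W (t - h + h) - W (t - h) \<le> h * measure U {..t}"
    proof -
      have "W t - W (t - h) = (LINT x|U. max 0 (t - x) - max 0 (t - h - x))"
        unfolding W_def by (intro Bochner_Integration.integral_diff[symmetric] iW)
      also have "\<dots> \<le> (LINT x|U. h * indicator {..t} x)"
        by (intro integral_mono integrable_mult_right iN Bochner_Integration.integrable_diff iW)
          (use h in \<open>auto split: split_indicator\<close>)
      also have "\<dots> = h * measure U {..t}" unfolding N by simp
      finally show ?thesis by simp
    qed
    have "cmod (of_real (h * measure U {..t}) - of_real h * PQ t) \<le> 3 * d"
      by (rule norm_sandwich[OF lo up near near]) (use h in auto)
    also have "of_real (h * measure U {..t}) - of_real h * PQ t = of_real h * (of_real (measure U {..t}) - PQ t)"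
      by (simp add: algebra_simps)
    also have "cmod \<dots> = h * cmod (of_real (measure U {..t}) - PQ t)" using h by (simp add: norm_mult)
    also have "3 * d \<le> h * (3 * (CQ * exp \<beta> + C) * exp (\<theta> * t))"
    proof -
      have 1: "h * exp (\<beta> * (t + 1)) = exp \<beta> * exp (\<theta> * t)"
        unfolding h_def exp_add[symmetric] by (simp add: algebra_simps)
      have "h powr (1 - e) = h * exp (e * (\<beta> - \<theta>) * t)"
        unfolding h_def by (simp add: powr_def exp_add[symmetric] algebra_simps)
      then have "exp (a * t) * h powr (1 - e) = h * exp ((a + e * (\<beta> - \<theta>)) * t)"
        by (simp add: distrib_right exp_add)
      also have "\<dots> \<le> h * exp (\<theta> * t)"
        using h e t by (intro mult_left_mono) (auto intro!: mult_right_mono)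
      finally have "C * (exp (a * t) * h powr (1 - e)) \<le> C * (h * exp (\<theta> * t))"
        using C(1) by (rule mult_left_mono)
      moreover have "h * (h * (CQ * exp (\<beta> * (t + 1)))) = h * (CQ * (exp \<beta> * exp (\<theta> * t)))"
        using 1 by (metis mult.left_commute)
      ultimately have "d \<le> h * (CQ * (exp \<beta> * exp (\<theta> * t))) + C * (h * exp (\<theta> * t))"
        unfolding d_def by (simp only: mult.assoc)
      also have "3 * \<dots> = h * (3 * (CQ * exp \<beta> + C) * exp (\<theta> * t))" by (simp add: algebra_simps)
      finally show ?thesis by simp
    qed
    finally show ?thesis using h by simp
  qed
  show ?thesis by (rule that[of "3 * (CQ * exp \<beta> + C)"]) (use main in \<open>simp add: PQ_def\<close>)
qed

section \<open>Matrices\<close>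

text \<open>Cramer's rule for the system whose right-hand side is the \<open>j\<close>-th unit
  vector. As quotients of determinants, the entries of the inverse are holomorphic off the zeros of
  the determinant and can be bounded through a lower bound for it.\<close>

lemma matrix_inv_nth:
  fixes A :: "'a::field^'n^'n"
  assumes "det A \<noteq> 0"
  shows "matrix_inv A $ k $ j = det (\<chi> i l. if l = k then (if i = j then 1 else 0) else A $ i $ l) / det A"
proof -
  have inv: "invertible A" using assms invertible_det_nz by blast
  have AA: "A ** matrix_inv A = mat 1" using inv someI_ex[of "\<lambda>B. A ** B = mat 1 \<and> B ** A = mat 1"]
    by (simp add: matrix_inv_def invertible_def)
  then have "A *v (matrix_inv A *v axis j 1) = axis j 1"
    by (simp add: matrix_vector_mul_assoc AA)
  then have "matrix_inv A *v axis j 1 = (\<chi> k. det (\<chi> i l. if l = k then axis j 1 $ i else A $ i $ l) / det A)"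
    by (subst (asm) cramer[OF assms]) simp
  moreover have "(matrix_inv A *v axis j 1) $ k = matrix_inv A $ k $ j"
    by (simp add: matrix_vector_mult_def axis_def if_distrib[of "\<lambda>x. _ * x"] sum.If_cases cong: if_cong)
  ultimately show ?thesis by (simp add: axis_def eq_commute cong: if_cong)
qed

lemma matrix_inv_unique:
  fixes A :: "'a::field^'n^'n"
  assumes "A ** B = mat 1"
  shows "invertible A" "matrix_inv A = B"
proof -
  show inv: "invertible A" using assms invertible_right_inverse by blast
  have "matrix_inv A = matrix_inv A ** (A ** B)" by (simp add: assms)
  also have "\<dots> = B" using inv someI_ex[of "\<lambda>B. A ** B = mat 1 \<and> B ** A = mat 1"]
    by (simp add: matrix_mul_assoc matrix_inv_def invertible_def)
  finally show "matrix_inv A = B" .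
qed

lemma holomorphic_on_det:
  fixes A :: "complex \<Rightarrow> complex^'n^'n"
  assumes "\<And>i j. (\<lambda>z. A z $ i $ j) holomorphic_on S"
  shows "(\<lambda>z. det (A z)) holomorphic_on S"
  unfolding det_def by (intro holomorphic_intros assms)

lemma norm_det_le:
  fixes A :: "complex^'n^'n"
  assumes "\<And>i j. cmod (A $ i $ j) \<le> K" 
  shows "cmod (det A) \<le> fact CARD('n) * K ^ CARD('n)"
proof -
  have "cmod (det A) \<le> (\<Sum>p | p permutes (UNIV :: 'n set). K ^ CARD('n))"
    unfolding det_def
  proof (rule sum_norm_le)
    fix p
    have "cmod (\<Prod>i\<in>UNIV. A $ i $ p i) \<le> (\<Prod>i\<in>(UNIV::'n set). K)"
      unfolding prod_norm[symmetric] by (intro prod_mono) (auto simp: assms)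
    then show "cmod (of_int (sign p) * (\<Prod>i\<in>UNIV. A $ i $ p i)) \<le> K ^ CARD('n)"
      by (auto simp: norm_mult sign_def)
  qed
  also have "\<dots> = fact CARD('n) * K ^ CARD('n)"
    by (simp add: card_permutations)
  finally show ?thesis .
qed

section \<open>Eigenvalues and a positive vector\<close>

text \<open>\<open>spectral_radius\<close> is a \<open>Max\<close> and says something about
  eigenvalues only for a finite set. Eigenvalues are zeros of an entire function in a bounded disc;
  if that function were constant, its value at \<open>R\<close> would show that it has no
  zeros.\<close>

lemma finite_eigenvalues:
  fixes A :: "complex^'n^'n"
  shows "finite {l. \<exists>v. v \<noteq> 0 \<and> A *v v = l *s v}"
proof -
  \<comment> \<open>Exceeds every row sum of moduli. Comparing the coordinate of largest modulus of
    an eigenvector on both sides of the eigenvalue equation bounds the eigenvalue by such a row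
    sum.\<close>
  define R where "R = (\<Sum>i\<in>UNIV. \<Sum>j\<in>UNIV. cmod (A $ i $ j)) + 1"
  have bd: "cmod l < R" if "v \<noteq> 0" "A *v v = l *s v" for l v
  proof -
    have "Max (range (\<lambda>j. cmod (v $ j))) \<in> range (\<lambda>j. cmod (v $ j))" by (intro Max_in) auto
    then obtain i where "Max (range (\<lambda>j. cmod (v $ j))) = cmod (v $ i)" by (rule imageE)
    then have i: "cmod (v $ j) \<le> cmod (v $ i)" for j
      using Max_ge[of "range (\<lambda>j. cmod (v $ j))" "cmod (v $ j)"] by auto
    have vi: "cmod (v $ i) > 0"
    proof (rule ccontr)
      assume "\<not> cmod (v $ i) > 0"
      then have "v $ j = 0" for j using i[of j] by simp
      then show False using that(1) by (simp add: vec_eq_iff)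
    qed
    have "cmod l * cmod (v $ i) = cmod ((A *v v) $ i)"
      by (simp add: that(2) norm_mult)
    also have "\<dots> \<le> (\<Sum>j\<in>UNIV. cmod (A $ i $ j) * cmod (v $ i))"
      unfolding matrix_vector_mult_def
      by (auto intro!: sum_norm_le mult_left_mono i simp: norm_mult)
    also have "\<dots> = (\<Sum>j\<in>UNIV. cmod (A $ i $ j)) * cmod (v $ i)" by (simp add: sum_distrib_right)
    also have "\<dots> \<le> (R - 1) * cmod (v $ i)"
    proof (rule mult_right_mono)
      show "(\<Sum>j\<in>UNIV. cmod (A $ i $ j)) \<le> R - 1"
        unfolding R_def using member_le_sum[of i UNIV "\<lambda>i. \<Sum>j\<in>UNIV. cmod (A $ i $ j)"]
        by (simp add: sum_nonneg)
    qed auto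
    finally show ?thesis using vi by simp
  qed
  have eig: "det (mat l - A) = 0 \<longleftrightarrow> (\<exists>v. v \<noteq> 0 \<and> A *v v = l *s v)" for l
  proof -
    have "(mat l - A) *v v = l *s v - A *v v" for v
      by (simp add: matrix_vector_mult_def mat_def vec_eq_iff left_diff_distrib sum_subtractf
          if_distrib[of "\<lambda>x. x * _"] sum.If_cases cong: if_cong)
    then have "(\<exists>v. v \<noteq> 0 \<and> (mat l - A) *v v = 0) \<longleftrightarrow> (\<exists>v. v \<noteq> 0 \<and> A *v v = l *s v)"
      by (metis right_minus_eq)
    then show ?thesis
      by (metis invertible_det_nz invertible_left_inverse matrix_left_invertible_ker)
  qed
  have hol: "(\<lambda>l. det (mat l - A)) holomorphic_on UNIV"
  proof (rule holomorphic_on_det)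
    show "(\<lambda>l. (mat l - A) $ i $ j) holomorphic_on UNIV" for i j
      by (cases "i = j") (auto simp: mat_def intro!: holomorphic_intros)
  qed
  have "finite {l \<in> cball 0 R. det (mat l - A) = 0}"
  proof (cases "(\<lambda>l. det (mat l - A)) constant_on UNIV")
    case False
    then show ?thesis
      by (intro holomorphic_compact_finite_zeros[OF hol]) auto
  next
    case True
    then obtain c where c: "\<And>l. det (mat l - A) = c" by (auto simp: constant_on_def)
    have "R \<ge> 0" by (auto simp: R_def intro!: sum_nonneg add_nonneg_nonneg)
    then have "det (mat (of_real R) - A) \<noteq> 0" using eig bd[of _ "of_real R"] by fastforce
    then show ?thesis using c by simp
  qed
  then show ?thesis
    by (rule rev_finite_subset) (use eig bd in \<open>auto simp: less_imp_le\<close>)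
qed

lemma spectral_radius_ge:
  assumes "v \<noteq> 0" "A *v v = l *s v"
  shows "cmod l \<le> spectral_radius A"
  unfolding spectral_radius_def
  by (rule Max_ge) (use assms in \<open>auto intro!: finite_imageI finite_eigenvalues\<close>)

text \<open>Following the solution of \<open>v = 1 + x A v\<close> from \<open>x = 0\<close> to \<open>x = 1\<close>, positivity cannot be lost:
  as long as \<open>v \<ge> 0\<close>, the equation gives \<open>v \<ge> 1\<close>.\<close>
lemma nonneg_matrix_subinvariant_vector:
  fixes A :: "'n::finite \<Rightarrow> 'n \<Rightarrow> real"
  assumes A: "\<And>i j. A i j \<ge> 0" and rad: "spectral_radius (\<chi> i j. complex_of_real (A i j)) < 1"
  obtains v :: "'n \<Rightarrow> real" where "\<And>i. v i \<ge> 1" "\<And>i. (\<Sum>j\<in>UNIV. A i j * v j) = v i - 1"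
proof -
  define M :: "real \<Rightarrow> real^'n^'n" where "M x = (\<chi> i j. (if i = j then 1 else 0) - x * A i j)" for x
  \<comment> \<open>A kernel vector of \<open>M x\<close> would be an eigenvector of
    \<open>A\<close> for \<open>1 / x\<close>, of modulus at least \<open>1\<close>.\<close>
  have det: "det (M x) \<noteq> 0" if x: "0 \<le> x" "x \<le> 1" for x
  proof
    assume "det (M x) = 0"
    then obtain w where w: "w \<noteq> 0" "M x *v w = 0"
      by (metis invertible_det_nz invertible_left_inverse matrix_left_invertible_ker)
    have eq: "w $ i = x * (\<Sum>j\<in>UNIV. A i j * w $ j)" for i
    proof -
      have "0 = (M x *v w) $ i" by (simp add: w)
      also have "\<dots> = w $ i - x * (\<Sum>j\<in>UNIV. A i j * w $ j)"
        by (simp add: M_def matrix_vector_mult_def left_diff_distrib sum_subtractf sum_distrib_left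
          if_distrib[of "\<lambda>x. x * _"] sum.If_cases mult.assoc cong: if_cong)
      finally show ?thesis by simp
    qed
    have x0: "x \<noteq> 0"
    proof
      assume "x = 0"
      then have "w $ i = 0" for i using eq[of i] by simp
      then show False using w(1) by (simp add: vec_eq_iff)
    qed
    let ?w = "(\<chi> i. complex_of_real (w $ i)) :: complex^'n"
    have "(\<chi> i j. complex_of_real (A i j)) *v ?w = complex_of_real (1/x) *s ?w"
    proof (simp add: vec_eq_iff matrix_vector_mult_def, rule allI)
      fix i
      have "complex_of_real (w $ i) = of_real x * (\<Sum>j\<in>UNIV. complex_of_real (A i j) * complex_of_real (w $ j))"
        by (subst eq) simp
      then show "(\<Sum>j\<in>UNIV. complex_of_real (A i j) * complex_of_real (w $ j)) = complex_of_real (w $ i) / complex_of_real x"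
        using x0 by (simp add: field_simps)
    qed
    moreover have "?w \<noteq> 0" using w(1) by (auto simp: vec_eq_iff)
    ultimately have "cmod (complex_of_real (1/x)) < 1"
      using spectral_radius_ge rad by (meson le_less_trans)
    then show False using x x0 by (simp add: norm_divide)
  qed
  \<comment> \<open>Cramer's formula for the solution of \<open>v = 1 + x A v\<close>, from which
    continuity in \<open>x\<close> is visible.\<close>
  define V where "V x i = det (\<chi> k l. if l = i then 1 else M x $ k $ l) / det (M x)" for x i
  have V: "V x i = 1 + x * (\<Sum>j\<in>UNIV. A i j * V x j)" if x: "0 \<le> x" "x \<le> 1" for x i
  proof -
    have "M x *v (\<chi> i. V x i) = (\<chi> k. 1)"
      by (subst cramer[OF det[OF x]]) (simp add: V_def fun_eq_iff cong: if_cong)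
    then have "1 = (M x *v (\<chi> i. V x i)) $ i" by simp
    also have "\<dots> = V x i - x * (\<Sum>j\<in>UNIV. A i j * V x j)"
      by (simp add: M_def matrix_vector_mult_def left_diff_distrib sum_subtractf sum_distrib_left
          if_distrib[of "\<lambda>x. x * _"] sum.If_cases mult.assoc cong: if_cong)
    finally show ?thesis by simp
  qed
  have contdet: "continuous_on S (\<lambda>x. det (\<chi> k l. (B k l x :: real)))"
    if "\<And>k l. continuous_on S (B k l)" for S and B :: "'n \<Rightarrow> 'n \<Rightarrow> real \<Rightarrow> real"
    unfolding det_def by (simp, intro continuous_intros that)
  have cont: "continuous_on {0..1} (\<lambda>x. V x i)" for i
  proof -
    have "continuous_on {0..1} (\<lambda>x. det (M x))"
      unfolding M_def by (rule contdet) (intro continuous_intros)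
    moreover have "continuous_on {0..1} (\<lambda>x. det (\<chi> k l. if l = i then 1 else M x $ k $ l))"
    proof (rule contdet)
      show "continuous_on {0..1} (\<lambda>x. if l = i then 1 else M x $ k $ l)" for k l
        by (cases "l = i") (auto simp: M_def intro!: continuous_intros)
    qed
    ultimately show ?thesis unfolding V_def by (intro continuous_intros) (use det in auto)
  qed
  have ge1: "V x i \<ge> 1" if x: "0 \<le> x" "x \<le> 1" and nn: "\<And>j. V x j \<ge> 0" for x i
    using V[OF x, of i] x A nn by (simp add: sum_nonneg)
  define P where "P = {x \<in> {0..1}. \<forall>i. V x i \<ge> 0}"
  \<comment> \<open>Since \<open>V \<ge> 0\<close> already forces \<open>V \<ge> 1\<close>, the same
    set is cut out by weak and by strict inequalities. It is therefore closed and relatively open in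
    \<open>{0..1}\<close>.\<close>
  have P': "P = {x \<in> {0..1}. \<forall>i. V x i > 1/2}"
  proof -
    have "(\<forall>i. V x i > 1/2) \<longleftrightarrow> (\<forall>i. V x i \<ge> 0)" if "0 \<le> x" "x \<le> 1" for x
      using ge1[OF that] by (smt (verit) half_gt_zero_iff zero_less_one field_sum_of_halves)
    then show ?thesis by (auto simp: P_def)
  qed
  have "closedin (top_of_set {0..1}) P"
  proof -
    have "P = (\<Inter>i. {0..1} \<inter> (\<lambda>x. V x i) -` {0..})" by (auto simp: P_def)
    also have "closedin (top_of_set {0..1}) \<dots>"
      by (intro closedin_INT continuous_closedin_preimage cont) auto
    finally show ?thesis .
  qed
  moreover have "openin (top_of_set {0..1}) P"
  proof -
    have "P = (\<Inter>i. {0..1} \<inter> (\<lambda>x. V x i) -` {1/2<..})" by (auto simp: P')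
    also have "openin (top_of_set {0..1}) \<dots>"
      by (intro openin_INT2 continuous_openin_preimage_gen cont) auto
    finally show ?thesis .
  qed
  moreover have "0 \<in> P" using V[of 0] by (auto simp: P_def)
  ultimately have "P = {0..1}"
    using connected_clopen[of "{0..1::real}"] by auto
  then have "1 \<in> P" by simp
  then have "V 1 i \<ge> 1" for i using ge1[of 1] by (auto simp: P_def)
  moreover have "(\<Sum>j\<in>UNIV. A i j * V 1 j) = V 1 i - 1" for i using V[of 1 i] by simp
  ultimately show ?thesis using that[of "V 1"] by blast
qed

section \<open>The renewal measure\<close>

declare sets_conv_power [measurable_cong] sets_renewal_measure [measurable_cong] sets_mat_convolution [measurable_cong]

section \<open>Integration with respect to sums and convolutions of measures\<close>

text \<open>Writing the sum as an integral over a counting measure treats the finite sums in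
  \<open>mat_convolution\<close> and the series in \<open>renewal_measure\<close> alike, and turns
  the supremum step of the induction into monotone convergence on both sides.\<close>

lemma nn_integral_measure_sum:
  fixes K :: "'i \<Rightarrow> 'a measure"
  assumes sets[measurable_cong]: "\<And>i. sets (K i) = sets M"
    and em: "\<And>A. A \<in> sets M \<Longrightarrow> emeasure M A = (\<integral>\<^sup>+i. emeasure (K i) A \<partial>count_space I)"
    and f: "f \<in> borel_measurable M"
  shows "integral\<^sup>N M f = (\<integral>\<^sup>+i. integral\<^sup>N (K i) f \<partial>count_space I)"
  using f
proof (induction rule: borel_measurable_induct)
  case (cong f g)
  have sp: "space (K i) = space M" for i using sets_eq_imp_space_eq[OF sets] .
  have "integral\<^sup>N M f = integral\<^sup>N M g" using cong by (intro nn_integral_cong) auto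
  moreover have "integral\<^sup>N (K i) f = integral\<^sup>N (K i) g" for i using cong sp by (intro nn_integral_cong) auto
  ultimately show ?case using cong by simp
next
  case (set A)
  then show ?case using em by simp
next
  case (mult u c)
  then show ?case by (simp add: nn_integral_cmult)
next
  case (add u v)
  then show ?case by (simp add: nn_integral_add)
next
  case (seq U)
  have [measurable]: "U n \<in> borel_measurable M" for n using seq by auto
  have "integral\<^sup>N M (SUP i. U i) = integral\<^sup>N M (\<lambda>x. SUP i. U i x)" by (simp add: image_comp SUP_apply[abs_def])
  also have "\<dots> = (SUP n. integral\<^sup>N M (U n))"
    by (rule nn_integral_monotone_convergence_SUP) (use seq in auto)
  also have "\<dots> = (SUP n. \<integral>\<^sup>+i. integral\<^sup>N (K i) (U n) \<partial>count_space I)" using seq by simp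
  also have "\<dots> = (\<integral>\<^sup>+i. (SUP n. integral\<^sup>N (K i) (U n)) \<partial>count_space I)"
    by (rule nn_integral_monotone_convergence_SUP[symmetric])
      (use seq in \<open>auto simp: incseq_def le_fun_def intro!: nn_integral_mono\<close>)
  also have "(\<lambda>i. SUP n. integral\<^sup>N (K i) (U n)) = (\<lambda>i. integral\<^sup>N (K i) (\<lambda>x. SUP n. U n x))"
    by (intro ext nn_integral_monotone_convergence_SUP[symmetric]) (use seq in auto)
  finally show ?case by (simp add: image_comp SUP_apply[abs_def])
qed

lemma nn_integral_convolution_sigma_finite:
  fixes M N :: "real measure"
  assumes [measurable_cong]: "sets M = sets borel" "sets N = sets borel" and "sigma_finite_measure N"
    and [measurable]: "f \<in> borel_measurable borel"
  shows "integral\<^sup>N (convolution M N) f = (\<integral>\<^sup>+x. \<integral>\<^sup>+y. f (x + y) \<partial>N \<partial>M)"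
proof -
  interpret sigma_finite_measure N by fact
  have "integral\<^sup>N (convolution M N) f = (\<integral>\<^sup>+p. f (fst p + snd p) \<partial>(M \<Otimes>\<^sub>M N))"
    unfolding convolution_def by (subst nn_integral_distr) (auto simp: split_beta')
  also have "\<dots> = (\<integral>\<^sup>+x. \<integral>\<^sup>+y. f (x + y) \<partial>N \<partial>M)"
    by (subst nn_integral_fst[symmetric]) auto
  finally show ?thesis .
qed

lemma nn_integral_mat_convolution:
  fixes M N :: "'n::finite \<Rightarrow> 'n \<Rightarrow> real measure"
  assumes "\<And>i j. sets (M i j) = sets borel" "\<And>i j. sets (N i j) = sets borel"
    and "\<And>i j. sigma_finite_measure (N i j)" and f: "f \<in> borel_measurable borel"
  shows "integral\<^sup>N (mat_convolution M N i j) f = (\<Sum>k\<in>UNIV. \<integral>\<^sup>+x. \<integral>\<^sup>+y. f (x + y) \<partial>N k j \<partial>M i k)"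
proof -
  have "f \<in> borel_measurable (mat_convolution M N i j)" using f by (simp add: measurable_def sets_eq_imp_space_eq[OF sets_mat_convolution])
  then have "integral\<^sup>N (mat_convolution M N i j) f = (\<integral>\<^sup>+k. integral\<^sup>N (convolution (M i k) (N k j)) f \<partial>count_space UNIV)"
    by (intro nn_integral_measure_sum) (auto simp: emeasure_mat_convolution nn_integral_count_space_finite)
  then show ?thesis
    using assms by (simp add: nn_integral_count_space_finite nn_integral_convolution_sigma_finite)
qed

text \<open>The exponential weight is bounded below on each \<open>{- real n..real n}\<close>, so
  its finite integral bounds the mass there. This opens Fubini's theorem for \<open>\<mu>\<close>,
  its convolution powers and \<open>U\<close>.\<close>

lemma sigma_finite_measure_exp:
  fixes M :: "real measure"
  assumes sM[measurable_cong]: "sets M = sets borel" and fin: "(\<integral>\<^sup>+x. ennreal (exp (- s * x)) \<partial>M) < \<infinity>"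
  shows "sigma_finite_measure M"
proof
  have sp: "space M = UNIV" using sets_eq_imp_space_eq[OF sM] by simp
  have "emeasure M {- real n..real n} \<noteq> \<infinity>" for n
  proof -
    have "emeasure M {- real n..real n} = (\<integral>\<^sup>+x. indicator {- real n..real n} x \<partial>M)" by simp
    also have "\<dots> \<le> (\<integral>\<^sup>+x. ennreal (exp (\<bar>s\<bar> * n)) * ennreal (exp (- s * x)) \<partial>M)"
    proof (rule nn_integral_mono)
      fix x
      have "1 \<le> exp (\<bar>s\<bar> * n) * exp (- s * x)" if "x \<in> {- real n..real n}"
      proof -
        have "\<bar>s * x\<bar> \<le> \<bar>s\<bar> * n" using that unfolding abs_mult by (intro mult_left_mono) auto
        then show ?thesis by (auto simp: exp_add[symmetric])
      qed
      then show "indicator {- real n..real n} x \<le> ennreal (exp (\<bar>s\<bar> * n)) * ennreal (exp (- s * x))"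
        by (auto simp: ennreal_mult[symmetric] split: split_indicator)
    qed
    also have "\<dots> = ennreal (exp (\<bar>s\<bar> * n)) * (\<integral>\<^sup>+x. ennreal (exp (- s * x)) \<partial>M)" by (rule nn_integral_cmult) auto
    also have "\<dots> < \<infinity>" using fin by (simp add: ennreal_mult_less_top)
    finally show ?thesis by simp
  qed
  moreover have "(\<Union>n. {- real n..real n}) = UNIV"
  proof safe
    fix x :: real
    obtain n where "\<bar>x\<bar> \<le> real n" using real_arch_simple by blast
    then show "x \<in> (\<Union>n. {- real n..real n})" by (intro UN_I[of n]) auto
  qed simp
  ultimately show "\<exists>A. countable A \<and> A \<subseteq> sets M \<and> \<Union> A = space M \<and> (\<forall>a\<in>A. emeasure M a \<noteq> \<infinity>)"
    by (intro exI[of _ "range (\<lambda>n. {- real n..real n})"]) (auto simp: sp sM)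
qed

lemma integral_measure_sum_real:
  fixes K :: "'i \<Rightarrow> 'a measure" and \<phi> :: "'a \<Rightarrow> real"
  assumes fin: "finite I" and sets[measurable_cong]: "\<And>i. i \<in> I \<Longrightarrow> sets (K i) = sets M"
    and nn: "\<And>f. f \<in> borel_measurable M \<Longrightarrow> integral\<^sup>N M f = (\<Sum>i\<in>I. integral\<^sup>N (K i) f)"
    and int: "integrable M \<phi>"
  shows "i \<in> I \<Longrightarrow> integrable (K i) \<phi>" and "integral\<^sup>L M \<phi> = (\<Sum>i\<in>I. integral\<^sup>L (K i) \<phi>)"
proof -
  have \<phi>[measurable]: "\<phi> \<in> borel_measurable M" using int by auto
  have le: "integral\<^sup>N (K i) f \<le> integral\<^sup>N M f" if "f \<in> borel_measurable M" "i \<in> I" for f i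
    unfolding nn[OF that(1)] using fin that(2) by (intro member_le_sum) auto
  show *: "integrable (K i) \<phi>" if "i \<in> I" for i
  proof (rule integrableI_bounded)
    show "\<phi> \<in> borel_measurable (K i)" using \<phi> measurable_cong_sets[OF sets[OF that] refl] by blast
    have "(\<integral>\<^sup>+x. norm (\<phi> x) \<partial>K i) \<le> (\<integral>\<^sup>+x. norm (\<phi> x) \<partial>M)" using that by (intro le) auto
    also have "\<dots> < \<infinity>" using int by (simp add: integrable_iff_bounded)
    finally show "(\<integral>\<^sup>+x. norm (\<phi> x) \<partial>K i) < \<infinity>" .
  qed
  have pos: "enn2real (\<integral>\<^sup>+x. ennreal (\<psi> x) \<partial>M) = (\<Sum>i\<in>I. enn2real (\<integral>\<^sup>+x. ennreal (\<psi> x) \<partial>K i))"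
    if [measurable]: "\<psi> \<in> borel_measurable M" and b: "\<And>x. \<psi> x \<le> norm (\<phi> x)" for \<psi>
  proof -
    have "(\<integral>\<^sup>+x. ennreal (\<psi> x) \<partial>K i) < \<infinity>" if "i \<in> I" for i
    proof -
      have "(\<integral>\<^sup>+x. ennreal (\<psi> x) \<partial>K i) \<le> (\<integral>\<^sup>+x. norm (\<phi> x) \<partial>K i)" using b by (intro nn_integral_mono ennreal_leI) auto
      also have "\<dots> < \<infinity>" using *[OF that] by (simp add: integrable_iff_bounded)
      finally show ?thesis .
    qed
    then show ?thesis by (subst nn, measurable) (subst enn2real_sum, auto simp: o_def)
  qed
  show "integral\<^sup>L M \<phi> = (\<Sum>i\<in>I. integral\<^sup>L (K i) \<phi>)"
    using pos[of \<phi>] pos[of "\<lambda>x. - \<phi> x"] *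
    by (simp add: real_lebesgue_integral_def[OF int] real_lebesgue_integral_def sum_subtractf)
qed

lemma integral_measure_sum_complex:
  fixes K :: "'i \<Rightarrow> 'a measure" and \<phi> :: "'a \<Rightarrow> complex"
  assumes fin: "finite I" and sets: "\<And>i. i \<in> I \<Longrightarrow> sets (K i) = sets M"
    and nn: "\<And>f. f \<in> borel_measurable M \<Longrightarrow> integral\<^sup>N M f = (\<Sum>i\<in>I. integral\<^sup>N (K i) f)"
    and int: "integrable M \<phi>"
  shows "i \<in> I \<Longrightarrow> integrable (K i) \<phi>" and "integral\<^sup>L M \<phi> = (\<Sum>i\<in>I. integral\<^sup>L (K i) \<phi>)"
proof -
  have ri: "integrable M (\<lambda>x. Re (\<phi> x))" "integrable M (\<lambda>x. Im (\<phi> x))" using int by auto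
  note R = integral_measure_sum_real[OF fin sets nn ri(1), simplified] and I = integral_measure_sum_real[OF fin sets nn ri(2), simplified]
  show *: "integrable (K i) \<phi>" if "i \<in> I" for i
  proof -
    have "integrable (K i) (\<lambda>x. complex_of_real (Re (\<phi> x)) + \<i> * complex_of_real (Im (\<phi> x)))"
      using R(1)[OF that] I(1)[OF that] by (intro Bochner_Integration.integrable_add integrable_mult_right integrable_of_real)
    then show ?thesis by (simp add: complex_eq[symmetric])
  qed
  show "integral\<^sup>L M \<phi> = (\<Sum>i\<in>I. integral\<^sup>L (K i) \<phi>)"
    using R(2) I(2) int * by (intro complex_eqI) simp_all
qed

section \<open>A kernel that contracts a weighted norm\<close>

text \<open>At the abscissa \<open>\<sigma>\<close> the matrix of transforms contracts the norm
  \<open>max \<bar>x i\<bar> / v i\<close> by the factor \<open>\<rho>\<close>. In contrast to a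
  spectral radius, such a bound simply multiplies along convolution powers.\<close>

locale renewal_kernel =
  fixes \<mu> :: "'n::finite \<Rightarrow> 'n \<Rightarrow> real measure" and \<sigma> \<rho> :: real and v :: "'n \<Rightarrow> real"
  assumes lf: "\<And>i j. locally_finite_nonneg (\<mu> i j)"
    and v1: "\<And>i. v i \<ge> 1" and \<rho>: "0 \<le> \<rho>" "\<rho> < 1"
    and contraction: "\<And>i. (\<Sum>j\<in>UNIV. (\<integral>\<^sup>+x. ennreal (exp (- \<sigma> * x)) \<partial>\<mu> i j) * ennreal (v j)) \<le> ennreal (\<rho> * v i)"
begin

abbreviation "U \<equiv> renewal_measure \<mu>"

lemma sets_\<mu>[simp, measurable_cong]: "sets (\<mu> i j) = sets borel"
  using lf by (simp add: locally_finite_nonneg_def)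

lemma nn_\<mu>_finite: "(\<integral>\<^sup>+x. ennreal (exp (- \<sigma> * x)) \<partial>\<mu> i j) < \<infinity>"
proof -
  have "(\<integral>\<^sup>+x. ennreal (exp (- \<sigma> * x)) \<partial>\<mu> i j) \<le> (\<integral>\<^sup>+x. ennreal (exp (- \<sigma> * x)) \<partial>\<mu> i j) * ennreal (v j)"
    using mult_left_mono[of 1 "ennreal (v j)"] v1[of j] by (metis ennreal_1 ennreal_leI mult.right_neutral zero_le)
  also have "\<dots> \<le> (\<Sum>j\<in>UNIV. (\<integral>\<^sup>+x. ennreal (exp (- \<sigma> * x)) \<partial>\<mu> i j) * ennreal (v j))"
    by (intro member_le_sum) auto
  also have "\<dots> < \<infinity>" using contraction[of i] le_less_trans by (metis ennreal_less_top infinity_ennreal_def)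
  finally show ?thesis .
qed

lemma sigma_finite_\<mu>: "sigma_finite_measure (\<mu> i j)"
  by (rule sigma_finite_measure_exp[OF sets_\<mu> nn_\<mu>_finite])

lemma \<mu>_nonneg: "AE x in \<mu> i j. x \<ge> 0"
  using lf[of i j] by (intro AE_I[where N="{..<0}"]) (auto simp: locally_finite_nonneg_def)

text \<open>Convolution becomes a matrix product under the transform, so each factor contributes one
  \<open>\<rho>\<close>. Bounding all entries of row \<open>i\<close> by the same \<open>v i\<close>
  keeps the induction closed, and \<open>v i \<ge> 1\<close> starts it.\<close>

lemma conv_power_bound: "(\<integral>\<^sup>+x. ennreal (exp (- \<sigma> * x)) \<partial>conv_power \<mu> n i j) \<le> ennreal (\<rho> ^ n * v i)"
proof (induction n arbitrary: i j)
  case 0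
  have "(\<integral>\<^sup>+x. ennreal (exp (- \<sigma> * x)) \<partial>conv_power \<mu> 0 i j) \<le> ennreal 1"
    by (auto simp: nn_integral_return nn_integral_null_measure)
  also have "\<dots> \<le> ennreal (\<rho> ^ 0 * v i)" using v1 by (intro ennreal_leI) simp
  finally show ?case .
next
  case (Suc n)
  have sf: "sigma_finite_measure (conv_power \<mu> n i j)" for i j
    by (rule sigma_finite_measure_exp[OF sets_conv_power le_less_trans[OF Suc.IH]]) simp
  have "(\<integral>\<^sup>+x. ennreal (exp (- \<sigma> * x)) \<partial>conv_power \<mu> (Suc n) i j) =
     (\<Sum>k\<in>UNIV. \<integral>\<^sup>+x. \<integral>\<^sup>+y. ennreal (exp (- \<sigma> * (x + y))) \<partial>conv_power \<mu> n k j \<partial>\<mu> i k)"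
    unfolding conv_power.simps by (rule nn_integral_mat_convolution) (auto intro: sf)
  also have "\<dots> = (\<Sum>k\<in>UNIV. (\<integral>\<^sup>+x. ennreal (exp (- \<sigma> * x)) \<partial>\<mu> i k) * (\<integral>\<^sup>+y. ennreal (exp (- \<sigma> * y)) \<partial>conv_power \<mu> n k j))"
    by (intro sum.cong refl) (simp add: distrib_left exp_diff exp_minus divide_inverse exp_add ennreal_mult nn_integral_cmult nn_integral_multc)
  also have "\<dots> \<le> (\<Sum>k\<in>UNIV. (\<integral>\<^sup>+x. ennreal (exp (- \<sigma> * x)) \<partial>\<mu> i k) * (ennreal (\<rho> ^ n) * ennreal (v k)))"
    using Suc.IH \<rho> v1 by (intro sum_mono mult_left_mono) (auto simp: ennreal_mult[symmetric] order_trans[OF zero_le_one])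
  also have "\<dots> = ennreal (\<rho> ^ n) * (\<Sum>k\<in>UNIV. (\<integral>\<^sup>+x. ennreal (exp (- \<sigma> * x)) \<partial>\<mu> i k) * ennreal (v k))"
    by (simp add: sum_distrib_left mult_ac)
  also have "\<dots> \<le> ennreal (\<rho> ^ n) * ennreal (\<rho> * v i)" by (intro mult_left_mono contraction) auto
  also have "\<dots> = ennreal (\<rho> ^ Suc n * v i)" using \<rho> by (simp add: ennreal_mult'[symmetric] mult_ac)
  finally show ?case .
qed

lemma sigma_finite_conv_power: "sigma_finite_measure (conv_power \<mu> n i j)"
  by (rule sigma_finite_measure_exp[OF sets_conv_power le_less_trans[OF conv_power_bound]]) simp

lemma nn_integral_U:
  assumes "f \<in> borel_measurable borel"
  shows "integral\<^sup>N (U i j) f = (\<Sum>n. integral\<^sup>N (conv_power \<mu> n i j) f)"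
proof -
  have "f \<in> borel_measurable (U i j)" using assms by (simp add: measurable_def sets_eq_imp_space_eq[OF sets_renewal_measure])
  then have "integral\<^sup>N (U i j) f = (\<integral>\<^sup>+n. integral\<^sup>N (conv_power \<mu> n i j) f \<partial>count_space UNIV)"
    by (intro nn_integral_measure_sum) (auto simp: emeasure_renewal_measure nn_integral_count_space_nat)
  then show ?thesis by (simp add: nn_integral_count_space_nat)
qed

lemma U_bound: "(\<integral>\<^sup>+x. ennreal (exp (- \<sigma> * x)) \<partial>U i j) \<le> ennreal (v i / (1 - \<rho>))"
proof -
  have "(\<integral>\<^sup>+x. ennreal (exp (- \<sigma> * x)) \<partial>U i j) \<le> (\<Sum>n. ennreal (\<rho> ^ n * v i))"
    by (subst nn_integral_U, measurable) (intro suminf_le conv_power_bound summableI)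
  also have "\<dots> = ennreal (\<Sum>n. \<rho> ^ n * v i)"
    using \<rho> v1[of i] by (intro suminf_ennreal2 summable_mult2 summable_geometric) auto
  also have "(\<Sum>n. \<rho> ^ n * v i) = v i / (1 - \<rho>)"
    using \<rho> by (subst suminf_mult2[symmetric]) (auto simp: suminf_geometric summable_geometric)
  finally show ?thesis .
qed

lemma U_exp_integrable: "integrable (U i j) (\<lambda>x. exp (- \<sigma> * x))"
  using U_bound[of i j] by (intro integrableI_bounded) (auto simp: le_less_trans[OF _ ennreal_less_top])

lemma sigma_finite_U: "sigma_finite_measure (U i j)"
  by (rule sigma_finite_measure_exp[OF sets_renewal_measure le_less_trans[OF U_bound]]) simp

text \<open>The identity \<open>U = I + \<mu> * U\<close>: the term \<open>n = 0\<close> is split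
  off and the left factor \<open>\<mu>\<close> is pulled out of the remaining series by
  Tonelli.\<close>

lemma U_renewal_nn:
  assumes f[measurable]: "f \<in> borel_measurable borel"
  shows "integral\<^sup>N (U i j) f = integral\<^sup>N (conv_power \<mu> 0 i j) f + (\<Sum>k\<in>UNIV. \<integral>\<^sup>+x. \<integral>\<^sup>+y. f (x + y) \<partial>U k j \<partial>\<mu> i k)"
proof -
  have inner: "(\<lambda>x. \<integral>\<^sup>+y. f (x + y) \<partial>conv_power \<mu> n k j) \<in> borel_measurable borel" for n k
  proof -
    interpret sigma_finite_measure "conv_power \<mu> n k j" by (rule sigma_finite_conv_power)
    show ?thesis by measurable
  qed
  have "(\<Sum>n. integral\<^sup>N (conv_power \<mu> (Suc n) i j) f) =
    (\<Sum>n. \<Sum>k\<in>UNIV. \<integral>\<^sup>+x. \<integral>\<^sup>+y. f (x + y) \<partial>conv_power \<mu> n k j \<partial>\<mu> i k)"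
    unfolding conv_power.simps
    by (intro suminf_cong nn_integral_mat_convolution) (auto intro: sigma_finite_conv_power)
  also have "\<dots> = (\<Sum>k\<in>UNIV. \<Sum>n. \<integral>\<^sup>+x. \<integral>\<^sup>+y. f (x + y) \<partial>conv_power \<mu> n k j \<partial>\<mu> i k)"
    by (intro suminf_sum) auto
  also have "\<dots> = (\<Sum>k\<in>UNIV. \<integral>\<^sup>+x. (\<Sum>n. \<integral>\<^sup>+y. f (x + y) \<partial>conv_power \<mu> n k j) \<partial>\<mu> i k)"
    by (intro sum.cong refl nn_integral_suminf[symmetric]) (use inner in auto)
  also have "\<dots> = (\<Sum>k\<in>UNIV. \<integral>\<^sup>+x. \<integral>\<^sup>+y. f (x + y) \<partial>U k j \<partial>\<mu> i k)"
    by (simp add: nn_integral_U)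
  finally have "(\<lambda>n. integral\<^sup>N (conv_power \<mu> (Suc n) i j) f) sums (\<Sum>k\<in>UNIV. \<integral>\<^sup>+x. \<integral>\<^sup>+y. f (x + y) \<partial>U k j \<partial>\<mu> i k)"
    using summable_sums[OF summableI, of "\<lambda>n. integral\<^sup>N (conv_power \<mu> (Suc n) i j) f"] by simp
  from sums_Suc[OF this] show ?thesis
    unfolding nn_integral_U[OF f] by (simp add: sums_iff add.commute del: conv_power.simps)
qed

lemma U_nonneg: "AE x in U i j. x \<ge> 0"
proof -
  have "emeasure (conv_power \<mu> n i j) {..<0} = 0" for n i j
  proof (induction n arbitrary: i j)
    case 0
    then show ?case by (auto simp: emeasure_return)
  next
    case (Suc n)
    have AEn: "AE y in conv_power \<mu> n k j. y \<ge> 0" for k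
      using Suc.IH[of k j] by (intro AE_I[where N="{..<0}"]) auto
    have "emeasure (conv_power \<mu> (Suc n) i j) {..<0} = (\<integral>\<^sup>+x. indicator {..<0} x \<partial>conv_power \<mu> (Suc n) i j)" by simp
    also have "\<dots> = (\<Sum>k\<in>UNIV. \<integral>\<^sup>+x. \<integral>\<^sup>+y. indicator {..<0} (x + y) \<partial>conv_power \<mu> n k j \<partial>\<mu> i k)"
      unfolding conv_power.simps by (rule nn_integral_mat_convolution) (auto intro: sigma_finite_conv_power)
    also have "\<dots> = (\<Sum>k\<in>(UNIV :: 'n set). 0)"
    proof (rule sum.cong[OF refl])
      fix k
      have "(\<integral>\<^sup>+x. \<integral>\<^sup>+y. indicator {..<0} (x + y) \<partial>conv_power \<mu> n k j \<partial>\<mu> i k) = (\<integral>\<^sup>+x. 0 \<partial>\<mu> i k)"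
      proof (rule nn_integral_cong_AE)
        show "AE x in \<mu> i k. (\<integral>\<^sup>+y. indicator {..<0} (x + y) \<partial>conv_power \<mu> n k j) = 0"
          using \<mu>_nonneg
        proof eventually_elim
          case (elim x)
          have "(\<integral>\<^sup>+y. indicator {..<0} (x + y) \<partial>conv_power \<mu> n k j) = (\<integral>\<^sup>+y. 0 \<partial>conv_power \<mu> n k j)"
          proof (rule nn_integral_cong_AE)
            show "AE y in conv_power \<mu> n k j. indicator {..<0} (x + y) = (0::ennreal)"
              using AEn[of k] by eventually_elim (use elim in auto)
          qed
          then show ?case by simp
        qed
      qed
      then show "(\<integral>\<^sup>+x. \<integral>\<^sup>+y. indicator {..<0} (x + y) \<partial>conv_power \<mu> n k j \<partial>\<mu> i k) = 0" by simp
    qed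
    finally show ?case by simp
  qed
  then have "emeasure (U i j) {..<0} = 0" by (simp add: emeasure_renewal_measure)
  then show ?thesis by (intro AE_I[where N="{..<0}"]) auto
qed

lemma U_renewal:
  fixes \<phi> :: "real \<Rightarrow> complex"
  assumes int: "integrable (U i j) \<phi>"
  shows "integral\<^sup>L (U i j) \<phi> = (if i = j then \<phi> 0 else 0) + (\<Sum>k\<in>UNIV. LINT x|\<mu> i k. LINT y|U k j. \<phi> (x + y))"
    and "integrable (\<mu> i k) (\<lambda>x. LINT y|U k j. \<phi> (x + y))"
proof -
  have [measurable]: "\<phi> \<in> borel_measurable borel"
    using int by (metis borel_measurable_integrable measurable_cong_sets sets_renewal_measure)
  \<comment> \<open>The renewal identity is recast as a finite sum of measures indexed by
    \<open>'n option\<close>: \<open>None\<close> carries the Dirac term and \<open>Some k\<close>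
    the convolution through the intermediate state \<open>k\<close>.\<close>
  define K where "K o' = (case o' of None \<Rightarrow> conv_power \<mu> 0 i j | Some k \<Rightarrow> convolution (\<mu> i k) (U k j))" for o'
  have nn: "integral\<^sup>N (U i j) f = (\<Sum>o'\<in>UNIV. integral\<^sup>N (K o') f)" if "f \<in> borel_measurable (U i j)" for f
  proof -
    have f: "f \<in> borel_measurable borel" using that by (metis measurable_cong_sets sets_renewal_measure)
    have "(\<Sum>o'\<in>UNIV. integral\<^sup>N (K o') f) = integral\<^sup>N (K None) f + (\<Sum>k\<in>UNIV. integral\<^sup>N (K (Some k)) f)"
      by (simp add: UNIV_option_conv sum.reindex)
    then show ?thesis
      using f sigma_finite_U by (simp add: U_renewal_nn[OF f] K_def nn_integral_convolution_sigma_finite del: conv_power.simps)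
  qed
  have sK: "sets (K o') = sets (U i j)" for o'
    by (cases o') (auto simp: K_def simp del: conv_power.simps)
  note K = integral_measure_sum_complex[of UNIV K "U i j" \<phi>, OF finite sK nn int]
  have conv: "integral\<^sup>L (K (Some k)) \<phi> = (LINT x|\<mu> i k. LINT y|U k j. \<phi> (x + y))"
    "integrable (\<mu> i k) (\<lambda>x. LINT y|U k j. \<phi> (x + y))" for k
  proof -
    interpret P: pair_sigma_finite "\<mu> i k" "U k j"
      by (simp add: pair_sigma_finite_def sigma_finite_\<mu> sigma_finite_U)
    have [measurable]: "(\<lambda>(x, y). x + y) \<in> borel_measurable (\<mu> i k \<Otimes>\<^sub>M U k j)"
      by measurable
    have "integrable (K (Some k)) \<phi>" by (rule K(1)) simp_all
    then have pint: "integrable (\<mu> i k \<Otimes>\<^sub>M U k j) (\<lambda>(x, y). \<phi> (x + y))"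
      unfolding K_def convolution_def by (simp add: integrable_distr_eq split_beta')
    show "integrable (\<mu> i k) (\<lambda>x. LINT y|U k j. \<phi> (x + y))"
      using P.integrable_fst'[OF pint] by simp
    have "integral\<^sup>L (K (Some k)) \<phi> = (LINT p|(\<mu> i k \<Otimes>\<^sub>M U k j). \<phi> (fst p + snd p))"
      unfolding K_def convolution_def by (simp add: integral_distr split_beta')
    also have "\<dots> = (LINT x|\<mu> i k. LINT y|U k j. \<phi> (x + y))"
      using P.integral_fst'[OF pint] by (simp add: split_beta')
    finally show "integral\<^sup>L (K (Some k)) \<phi> = (LINT x|\<mu> i k. LINT y|U k j. \<phi> (x + y))" .
  qed
  show "integrable (\<mu> i k) (\<lambda>x. LINT y|U k j. \<phi> (x + y))" by (rule conv(2))
  have "integral\<^sup>L (U i j) \<phi> = integral\<^sup>L (K None) \<phi> + (\<Sum>k\<in>UNIV. integral\<^sup>L (K (Some k)) \<phi>)"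
    by (subst K(2)) (simp_all add: UNIV_option_conv sum.reindex)
  also have "integral\<^sup>L (K None) \<phi> = (if i = j then \<phi> 0 else 0)"
    by (simp add: K_def integral_return)
  finally show "integral\<^sup>L (U i j) \<phi> = (if i = j then \<phi> 0 else 0) + (\<Sum>k\<in>UNIV. LINT x|\<mu> i k. LINT y|U k j. \<phi> (x + y))"
    by (simp add: conv(1))
qed

end

lemma exp_integrable_mono:
  fixes M :: "real measure"
  assumes sM[measurable_cong]: "sets M = sets borel" and nn: "AE x in M. x \<ge> 0"
    and int: "integrable M (\<lambda>x. exp (- \<sigma> * x))" and z: "Re z \<ge> \<sigma>"
  shows "integrable M (\<lambda>x. exp (- z * complex_of_real x))"
    and "cmod (LINT x|M. exp (- z * complex_of_real x)) \<le> (LINT x|M. exp (- \<sigma> * x))"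
proof -
  have ae: "AE x in M. cmod (exp (- z * complex_of_real x)) \<le> exp (- \<sigma> * x)"
    using nn by eventually_elim (use z in \<open>auto simp: norm_exp_eq_Re intro!: mult_right_mono\<close>)
  show 1: "integrable M (\<lambda>x. exp (- z * complex_of_real x))"
    by (rule Bochner_Integration.integrable_bound[OF int]) (use ae in auto)
  show "cmod (LINT x|M. exp (- z * complex_of_real x)) \<le> (LINT x|M. exp (- \<sigma> * x))"
    by (rule order_trans[OF integral_norm_bound]) (intro integral_mono_AE integrable_norm 1 int ae)
qed

text \<open>Since \<open>exp (\<sigma> * (t - x)) = exp (\<sigma> * t) * exp (- \<sigma> *
  x)\<close>, convolution sends an envelope \<open>b * exp (\<sigma> * s)\<close> to an envelope of
  the same shape, with \<open>b\<close> multiplied by the transform at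
  \<open>\<sigma>\<close>.\<close>

lemma reflected_shift_integrable:
  fixes M :: "real measure" and g :: "real \<Rightarrow> real"
  assumes sM[measurable_cong]: "sets M = sets borel" and nn: "AE x in M. x \<ge> 0"
    and int: "integrable M (\<lambda>x. exp (- \<sigma> * x))" and [measurable]: "g \<in> borel_measurable borel"
    and b: "\<And>s. s \<le> t \<Longrightarrow> \<bar>g s\<bar> \<le> b * exp (\<sigma> * s)"
  shows "integrable M (\<lambda>x. g (t - x))"
    and "\<bar>LINT x|M. g (t - x)\<bar> \<le> b * exp (\<sigma> * t) * (LINT x|M. exp (- \<sigma> * x))"
proof -
  have ae: "AE x in M. norm (g (t - x)) \<le> b * exp (\<sigma> * t) * exp (- \<sigma> * x)"
    using nn
  proof eventually_elim
    case (elim x)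
    then show ?case using b[of "t - x"] by (simp add: exp_add[symmetric] algebra_simps)
  qed
  have int': "integrable M (\<lambda>x. b * exp (\<sigma> * t) * exp (- \<sigma> * x))" by (rule integrable_mult_right) (rule int)
  show 1: "integrable M (\<lambda>x. g (t - x))"
    by (rule Bochner_Integration.integrable_bound[OF int']) (use ae in \<open>auto elim!: eventually_mono\<close>)
  have "\<bar>LINT x|M. g (t - x)\<bar> \<le> (LINT x|M. norm (g (t - x)))" using integral_norm_bound[of M "\<lambda>x. g (t - x)"] by simp
  also have "\<dots> \<le> (LINT x|M. b * exp (\<sigma> * t) * exp (- \<sigma> * x))" by (intro integral_mono_AE integrable_norm 1 int' ae)
  finally show "\<bar>LINT x|M. g (t - x)\<bar> \<le> b * exp (\<sigma> * t) * (LINT x|M. exp (- \<sigma> * x))"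
    unfolding Bochner_Integration.integral_mult_right_zero .
qed

section \<open>Transforms and the renewal equation\<close>

context renewal_kernel begin

lemma \<mu>_exp_integrable: "integrable (\<mu> i j) (\<lambda>x. exp (- \<sigma> * x))"
  using nn_\<mu>_finite[of i j] by (intro integrableI_bounded) auto

lemma contraction_real: "(\<Sum>j\<in>UNIV. (LINT x|\<mu> i j. exp (- \<sigma> * x)) * v j) \<le> \<rho> * v i"
proof -
  have v0: "v j \<ge> 0" for j using v1[of j] by simp
  have "ennreal (\<Sum>j\<in>UNIV. (LINT x|\<mu> i j. exp (- \<sigma> * x)) * v j) = (\<Sum>j\<in>UNIV. (\<integral>\<^sup>+x. ennreal (exp (- \<sigma> * x)) \<partial>\<mu> i j) * ennreal (v j))"
    by (subst sum_ennreal[symmetric]) (auto intro!: mult_nonneg_nonneg v0 sum.cong simp: ennreal_mult' v0 nn_integral_eq_integral[OF \<mu>_exp_integrable, simplified])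
  also have "\<dots> \<le> ennreal (\<rho> * v i)" by (rule contraction)
  finally show ?thesis using \<rho> v0[of i] by (simp add: ennreal_le_iff)
qed

lemma laplace_nth: "laplace \<mu> z $ i $ j = (LINT x|\<mu> i j. exp (- z * complex_of_real x))"
  unfolding laplace_def set_lebesgue_integral_def vec_lambda_beta
  by (rule integral_cong_AE) (use \<mu>_nonneg[of i j] in \<open>auto elim!: eventually_mono\<close>)

definition laplace_U :: "complex \<Rightarrow> complex^'n^'n" where
  "laplace_U z = (\<chi> i j. LINT x|U i j. exp (- z * complex_of_real x))"

text \<open>Transform of the renewal identity: the exponential is multiplicative, so each double
  integral factorises. From \<open>Re z \<ge> \<sigma>\<close> on, all integrals converge
  absolutely.\<close>

lemma laplace_U_inverse:
  assumes z: "Re z \<ge> \<sigma>"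
  shows "(mat 1 - laplace \<mu> z) ** laplace_U z = mat 1"
proof -
  have ren: "laplace_U z $ i $ j = mat 1 $ i $ j + (\<Sum>k\<in>UNIV. laplace \<mu> z $ i $ k * laplace_U z $ k $ j)" for i j
  proof -
    have "laplace_U z $ i $ j = (if i = j then exp (- z * complex_of_real 0) else 0) +
      (\<Sum>k\<in>UNIV. LINT x|\<mu> i k. LINT y|U k j. exp (- z * complex_of_real (x + y)))"
      unfolding laplace_U_def vec_lambda_beta
      by (rule U_renewal(1)) (rule exp_integrable_mono[OF sets_renewal_measure U_nonneg U_exp_integrable z])
    moreover have "(LINT x|\<mu> i k. LINT y|U k j. exp (- z * complex_of_real (x + y))) = laplace \<mu> z $ i $ k * laplace_U z $ k $ j" for k
    proof -
      have "exp (- z * complex_of_real (x + y)) = exp (- z * complex_of_real x) * exp (- z * complex_of_real y)" for x y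
        unfolding exp_add[symmetric] by (simp add: algebra_simps)
      then show ?thesis
        unfolding laplace_nth laplace_U_def vec_lambda_beta
        by (simp only: Bochner_Integration.integral_mult_right_zero Bochner_Integration.integral_mult_left_zero)
    qed
    ultimately show ?thesis by (simp add: mat_def)
  qed
  have "((mat 1 - laplace \<mu> z) ** laplace_U z) $ i $ j = mat 1 $ i $ j" for i j
  proof -
    have "((mat 1 - laplace \<mu> z) ** laplace_U z) $ i $ j = laplace_U z $ i $ j - (\<Sum>k\<in>UNIV. laplace \<mu> z $ i $ k * laplace_U z $ k $ j)"
      by (simp add: matrix_matrix_mult_def left_diff_distrib sum_subtractf mat_def
        if_distrib[of "\<lambda>x. x * _"] sum.If_cases cong: if_cong)
    then show ?thesis using ren[of i j] by simp
  qed
  then show ?thesis by (simp add: vec_eq_iff)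
qed

lemma laplace_U_bound:
  assumes z: "Re z \<ge> \<sigma>"
  shows "cmod (laplace_U z $ i $ j) \<le> (LINT x|U i j. exp (- \<sigma> * x))"
  unfolding laplace_U_def vec_lambda_beta
  by (rule exp_integrable_mono[OF sets_renewal_measure U_nonneg U_exp_integrable z])

text \<open>Local boundedness controls the function on \<open>{0..T}\<close> only; vanishing for
  negative arguments extends the exponential envelope to the whole half-line
  \<open>s \<le> T\<close> seen by a convolution.\<close>

lemma bounded_exp_envelope:
  fixes g :: "real \<Rightarrow> real^'n"
  assumes bd: "\<And>K. compact K \<Longrightarrow> bounded (g ` K)" and zero: "\<And>t. t < 0 \<Longrightarrow> g t = 0"
  obtains b where "b \<ge> 0" "\<And>s j. s \<le> T \<Longrightarrow> \<bar>g s $ j\<bar> \<le> b * exp (\<sigma> * s)"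
proof -
  have "\<exists>c. \<forall>s\<in>{0..T}. norm (g s) \<le> c" using bd[of "{0..T}"] by (auto simp: bounded_iff)
  then obtain c where c: "\<And>s. s \<in> {0..T} \<Longrightarrow> norm (g s) \<le> c" by blast
  define b where "b = max 0 c * exp (\<bar>\<sigma>\<bar> * \<bar>T\<bar>)"
  have "\<bar>g s $ j\<bar> \<le> b * exp (\<sigma> * s)" if "s \<le> T" for s j
  proof (cases "s < 0")
    case False
    have "\<bar>\<sigma> * s\<bar> \<le> \<bar>\<sigma>\<bar> * \<bar>T\<bar>" using False that unfolding abs_mult by (intro mult_left_mono) auto
    then have "0 \<le> \<bar>\<sigma>\<bar> * \<bar>T\<bar> + \<sigma> * s" by linarith
    then have 1: "1 \<le> exp (\<bar>\<sigma>\<bar> * \<bar>T\<bar>) * exp (\<sigma> * s)" by (simp add: exp_add[symmetric])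
    have "\<bar>g s $ j\<bar> \<le> norm (g s)" using Finite_Cartesian_Product.norm_nth_le[of "g s" j] by simp
    also have "\<dots> \<le> max 0 c * 1" using c[of s] False that by simp
    also have "\<dots> \<le> max 0 c * (exp (\<bar>\<sigma>\<bar> * \<bar>T\<bar>) * exp (\<sigma> * s))" by (intro mult_left_mono 1) auto
    finally show ?thesis by (simp add: b_def mult.assoc)
  qed (simp add: zero b_def)
  moreover have "b \<ge> 0" by (simp add: b_def)
  ultimately show ?thesis using that by blast
qed

lemma conv_fun_renewal_solution:
  fixes f :: "real \<Rightarrow> real^'n"
  assumes f: "f \<in> borel_measurable borel" and bd: "\<And>K. compact K \<Longrightarrow> bounded (f ` K)" and zero: "\<And>t. t < 0 \<Longrightarrow> f t = 0"
  shows "locally_bounded_renewal_solution \<mu> f (conv_fun U f)"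
proof -
  let ?F = "conv_fun U f"
  have fm[measurable]: "(\<lambda>x. f x $ j) \<in> borel_measurable borel" for j
    using f by (rule measurable_compose) (intro borel_measurable_continuous_onI continuous_intros)
  have int: "integrable (U i j) (\<lambda>x. f (t - x) $ j)" for i j t
  proof -
    obtain b where "b \<ge> 0" "\<And>s j. s \<le> t \<Longrightarrow> \<bar>f s $ j\<bar> \<le> b * exp (\<sigma> * s)"
      using bounded_exp_envelope[OF bd zero, of t] by blast
    then show ?thesis by (intro reflected_shift_integrable(1)[OF sets_renewal_measure U_nonneg U_exp_integrable]) auto
  qed
  have nth: "?F t $ i = (\<Sum>j\<in>UNIV. LINT x|U i j. f (t - x) $ j)" for t i by (simp add: conv_fun_def)
  have Fm: "(\<lambda>t. ?F t $ i) \<in> borel_measurable borel" for i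
  proof -
    have "(\<lambda>t. LINT x|U i j. f (t - x) $ j) \<in> borel_measurable borel" for j
    proof -
      interpret sigma_finite_measure "U i j" by (rule sigma_finite_U)
      show ?thesis by measurable
    qed
    then show ?thesis unfolding nth by measurable
  qed
  have "?F \<in> borel_measurable borel"
    using Fm by (subst borel_measurable_euclidean_space) (auto simp: Basis_vec_def cart_eq_inner_axis[symmetric])
  moreover have "bounded (?F ` K)" if K: "compact K" for K
  proof -
    obtain T where T: "\<And>t. t \<in> K \<Longrightarrow> \<bar>t\<bar> \<le> T" using compact_imp_bounded[OF K] by (auto simp: bounded_iff)
    obtain b where b: "b \<ge> 0" "\<And>s j. s \<le> T \<Longrightarrow> \<bar>f s $ j\<bar> \<le> b * exp (\<sigma> * s)"
      using bounded_exp_envelope[OF bd zero, of T] by blast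
    define B where "B i = (\<Sum>j\<in>UNIV. b * exp (\<bar>\<sigma>\<bar> * T) * (LINT x|U i j. exp (- \<sigma> * x)))" for i
    have "\<bar>?F t $ i\<bar> \<le> B i" if t: "t \<in> K" for t i
    proof -
      have "\<bar>?F t $ i\<bar> \<le> (\<Sum>j\<in>UNIV. b * exp (\<sigma> * t) * (LINT x|U i j. exp (- \<sigma> * x)))"
        unfolding nth
        by (intro order_trans[OF sum_abs] sum_mono reflected_shift_integrable(2)[OF sets_renewal_measure U_nonneg U_exp_integrable])
          (use b T[OF t] in auto)
      also have "\<dots> \<le> B i"
      proof -
        have "\<sigma> * t \<le> \<bar>\<sigma> * t\<bar>" by simp
        also have "\<dots> \<le> \<bar>\<sigma>\<bar> * T" unfolding abs_mult using T[OF t] by (intro mult_left_mono) auto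
        finally show ?thesis unfolding B_def using b by (intro sum_mono mult_right_mono mult_left_mono) auto
      qed
      finally show ?thesis .
    qed
    then have "norm (?F t) \<le> (\<Sum>i\<in>UNIV. B i)" if "t \<in> K" for t
      using that by (intro order_trans[OF norm_le_l1_cart] sum_mono) auto
    then show ?thesis by (auto simp: bounded_iff)
  qed
  moreover have "?F t = 0" if "t < 0" for t
  proof -
    have "(LINT x|U i j. f (t - x) $ j) = (LINT x|U i j. 0)" for i j
      by (rule integral_cong_AE) (use U_nonneg[of i j] that zero in \<open>auto elim!: eventually_mono\<close>)
    then show ?thesis by (simp add: vec_eq_iff nth)
  qed
  \<comment> \<open>The renewal identity for \<open>U\<close> is applied to the reflected functions
    \<open>x \<mapsto> f (t - x) $ j\<close>, read as complex-valued.\<close>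
  moreover have "?F t = f t + conv_fun \<mu> ?F t" for t
  proof -
    have ren: "(LINT x|U i j. f (t - x) $ j) = (if i = j then f t $ j else 0) + (\<Sum>k\<in>UNIV. LINT x|\<mu> i k. LINT y|U k j. f (t - x - y) $ j)"
      and renint: "integrable (\<mu> i k) (\<lambda>x. LINT y|U k j. f (t - x - y) $ j)" for i j k
    proof -
      have i: "integrable (U i j) (\<lambda>x. complex_of_real (f (t - x) $ j))" using int by simp
      have "complex_of_real (LINT x|U i j. f (t - x) $ j) = (if i = j then complex_of_real (f (t - 0) $ j) else 0)
        + (\<Sum>k\<in>UNIV. LINT x|\<mu> i k. LINT y|U k j. complex_of_real (f (t - (x + y)) $ j))"
        unfolding integral_complex_of_real[symmetric] by (rule U_renewal(1)[OF i])
      also have "\<dots> = complex_of_real ((if i = j then f t $ j else 0) + (\<Sum>k\<in>UNIV. LINT x|\<mu> i k. LINT y|U k j. f (t - x - y) $ j))"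
        by (simp add: integral_complex_of_real diff_diff_eq)
      finally show "(LINT x|U i j. f (t - x) $ j) = (if i = j then f t $ j else 0) + (\<Sum>k\<in>UNIV. LINT x|\<mu> i k. LINT y|U k j. f (t - x - y) $ j)"
        unfolding of_real_eq_iff .
      have "integrable (\<mu> i k) (\<lambda>x. Re (LINT y|U k j. complex_of_real (f (t - (x + y)) $ j)))"
        by (intro integrable_Re U_renewal(2)[OF i])
      then show "integrable (\<mu> i k) (\<lambda>x. LINT y|U k j. f (t - x - y) $ j)"
        by (simp add: integral_complex_of_real diff_diff_eq)
    qed
    have "?F t $ i = f t $ i + conv_fun \<mu> ?F t $ i" for i
    proof -
      have "?F t $ i = (\<Sum>j\<in>UNIV. (if i = j then f t $ j else 0)) + (\<Sum>j\<in>UNIV. \<Sum>k\<in>UNIV. LINT x|\<mu> i k. LINT y|U k j. f (t - x - y) $ j)"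
        unfolding nth ren sum.distrib ..
      also have "(\<Sum>j\<in>UNIV. \<Sum>k\<in>UNIV. LINT x|\<mu> i k. LINT y|U k j. f (t - x - y) $ j) = (\<Sum>k\<in>UNIV. LINT x|\<mu> i k. ?F (t - x) $ k)"
        unfolding nth by (subst sum.swap) (intro sum.cong refl Bochner_Integration.integral_sum[symmetric] renint)
      finally show ?thesis by (simp add: conv_fun_def[of \<mu>])
    qed
    then show ?thesis by (simp add: vec_eq_iff)
  qed
  ultimately show ?thesis unfolding locally_bounded_renewal_solution_def by blast
qed

text \<open>The difference of two solutions satisfies the homogeneous equation. In the norm weighted
  by \<open>v j * exp (\<sigma> * s)\<close> on \<open>s \<le> T\<close>, each use of that equation
  gains a factor \<open>\<rho>\<close>, so iteration forces the difference to vanish.\<close>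

lemma renewal_solution_unique:
  assumes F: "locally_bounded_renewal_solution \<mu> f F" and G: "locally_bounded_renewal_solution \<mu> f G"
  shows "G = F"
proof
  fix T
  let ?D = "\<lambda>j t. G t $ j - F t $ j"
  have nthm: "(\<lambda>x. H x $ j) \<in> borel_measurable borel" if "H \<in> borel_measurable borel" for H :: "real \<Rightarrow> real^'n" and j
    using that by (rule measurable_compose) (intro borel_measurable_continuous_onI continuous_intros)
  have m: "(\<lambda>x. F x $ j) \<in> borel_measurable borel" "(\<lambda>x. G x $ j) \<in> borel_measurable borel" for j
    using F G unfolding locally_bounded_renewal_solution_def by (blast intro: nthm)+
  have envF: "\<exists>b\<ge>0. \<forall>s j. s \<le> T \<longrightarrow> \<bar>F s $ j\<bar> \<le> b * exp (\<sigma> * s)" for T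
    by (rule bounded_exp_envelope[of F T]) (use F in \<open>auto simp: locally_bounded_renewal_solution_def\<close>)
  have envG: "\<exists>b\<ge>0. \<forall>s j. s \<le> T \<longrightarrow> \<bar>G s $ j\<bar> \<le> b * exp (\<sigma> * s)" for T
    by (rule bounded_exp_envelope[of G T]) (use G in \<open>auto simp: locally_bounded_renewal_solution_def\<close>)
  have intF: "integrable (\<mu> i j) (\<lambda>x. F (t - x) $ j)" for i j t
  proof -
    obtain b where "\<And>s j. s \<le> t \<Longrightarrow> \<bar>F s $ j\<bar> \<le> b * exp (\<sigma> * s)" using envF[of t] by blast
    then show ?thesis by (rule reflected_shift_integrable(1)[OF sets_\<mu> \<mu>_nonneg \<mu>_exp_integrable m(1)])
  qed
  have intG: "integrable (\<mu> i j) (\<lambda>x. G (t - x) $ j)" for i j t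
  proof -
    obtain b where "\<And>s j. s \<le> t \<Longrightarrow> \<bar>G s $ j\<bar> \<le> b * exp (\<sigma> * s)" using envG[of t] by blast
    then show ?thesis by (rule reflected_shift_integrable(1)[OF sets_\<mu> \<mu>_nonneg \<mu>_exp_integrable m(2)])
  qed
  have D: "?D i t = (\<Sum>j\<in>UNIV. LINT x|\<mu> i j. ?D j (t - x))" for i t
  proof -
    have eq: "H t $ i = f t $ i + (\<Sum>j\<in>UNIV. LINT x|\<mu> i j. H (t - x) $ j)"
      if H: "locally_bounded_renewal_solution \<mu> f H" for H
    proof -
      have "H t = f t + conv_fun \<mu> H t" using H unfolding locally_bounded_renewal_solution_def by blast
      from arg_cong[OF this, of "\<lambda>u. u $ i"] show ?thesis by (simp add: conv_fun_def)
    qed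
    have "?D i t = (\<Sum>j\<in>UNIV. LINT x|\<mu> i j. G (t - x) $ j) - (\<Sum>j\<in>UNIV. LINT x|\<mu> i j. F (t - x) $ j)"
      using eq[OF F] eq[OF G] by linarith
    then show ?thesis by (simp add: Bochner_Integration.integral_diff[OF intG intF] sum_subtractf)
  qed
  have step: "\<forall>s j. s \<le> T \<longrightarrow> \<bar>?D j s\<bar> \<le> \<rho> * b * v j * exp (\<sigma> * s)"
    if b: "b \<ge> 0" and IH: "\<forall>s j. s \<le> T \<longrightarrow> \<bar>?D j s\<bar> \<le> b * v j * exp (\<sigma> * s)" for b
  proof (intro allI impI)
    fix s i assume s: "s \<le> T"
    have "\<bar>?D i s\<bar> \<le> (\<Sum>j\<in>UNIV. b * v j * exp (\<sigma> * s) * (LINT x|\<mu> i j. exp (- \<sigma> * x)))"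
      by (subst D, intro order_trans[OF sum_abs] sum_mono reflected_shift_integrable(2)[OF sets_\<mu> \<mu>_nonneg \<mu>_exp_integrable, where g="?D _"])
        (use IH s m in auto)
    also have "\<dots> = b * exp (\<sigma> * s) * (\<Sum>j\<in>UNIV. (LINT x|\<mu> i j. exp (- \<sigma> * x)) * v j)"
      by (simp add: sum_distrib_left mult_ac)
    also have "\<dots> \<le> b * exp (\<sigma> * s) * (\<rho> * v i)" using b by (intro mult_left_mono contraction_real) auto
    finally show "\<bar>?D i s\<bar> \<le> \<rho> * b * v i * exp (\<sigma> * s)" by (simp add: mult_ac)
  qed
  obtain bF where bF: "bF \<ge> 0" "\<And>s j. s \<le> T \<Longrightarrow> \<bar>F s $ j\<bar> \<le> bF * exp (\<sigma> * s)" using envF[of T] by blast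
  obtain bG where bG: "bG \<ge> 0" "\<And>s j. s \<le> T \<Longrightarrow> \<bar>G s $ j\<bar> \<le> bG * exp (\<sigma> * s)" using envG[of T] by blast
  have iter: "\<forall>s j. s \<le> T \<longrightarrow> \<bar>?D j s\<bar> \<le> \<rho> ^ n * (bF + bG) * v j * exp (\<sigma> * s)" for n
  proof (induction n)
    case 0
    show ?case
    proof (intro allI impI)
      fix s j assume s: "s \<le> T"
      have "\<bar>?D j s\<bar> \<le> (bF + bG) * 1 * exp (\<sigma> * s)" using bF(2)[OF s, of j] bG(2)[OF s, of j] by (simp add: distrib_right)
      also have "\<dots> \<le> (bF + bG) * v j * exp (\<sigma> * s)" using bF(1) bG(1) v1[of j] by (intro mult_right_mono mult_left_mono) auto
      finally show "\<bar>?D j s\<bar> \<le> \<rho> ^ 0 * (bF + bG) * v j * exp (\<sigma> * s)" by simp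
    qed
  next
    case (Suc n)
    from step[OF _ this] show ?case using \<rho> bF(1) bG(1) by (simp add: mult.assoc)
  qed
  have "?D j T = 0" for j
  proof -
    have "(\<lambda>n. \<rho> ^ n * ((bF + bG) * v j * exp (\<sigma> * T))) \<longlonglongrightarrow> 0 * ((bF + bG) * v j * exp (\<sigma> * T))"
      using \<rho> by (intro tendsto_mult_right LIMSEQ_power_zero) auto
    then have "\<bar>?D j T\<bar> \<le> 0"
      by (intro LIMSEQ_le_const[of _ 0]) (use iter[rule_format, of T j] in \<open>auto simp: mult.assoc\<close>)
    then show ?thesis by simp
  qed
  then show "G T = F T" by (simp add: vec_eq_iff)
qed

end

section \<open>The inverse of the characteristic matrix\<close>

text \<open>Differentiation under the integral sign, carried out along sequences so that dominated
  convergence applies.\<close>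

lemma laplace_integral_holomorphic:
  fixes M :: "real measure"
  assumes sM[measurable_cong]: "sets M = sets borel" and nn: "AE x in M. x \<ge> 0"
    and int: "integrable M (\<lambda>x. exp (- s * x))"
  shows "(\<lambda>z. LINT x|M. exp (- z * complex_of_real x)) holomorphic_on {z. Re z > s}"
proof (rule holomorphic_onI)
  fix z assume "z \<in> {z. Re z > s}"
  then have z: "Re z > s" by simp
  \<comment> \<open>The gap \<open>Re z - s\<close> is spent in two halves: one on the factor
    \<open>exp (d * x)\<close> from the difference quotient, one on
    \<open>x \<le> exp (d * x) / d\<close>. Together they bring the majorant back to
    \<open>exp (- s * x)\<close>.\<close>
  define d where "d = (Re z - s) / 2"
  have d: "d > 0" using z by (simp add: d_def)
  define L where "L = (\<lambda>z. LINT x|M. exp (- z * complex_of_real x))"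
  have inte: "integrable M (\<lambda>x. exp (- w * complex_of_real x))" if "Re w > s" for w
  proof (rule Bochner_Integration.integrable_bound[OF int])
    show "AE x in M. norm (exp (- w * complex_of_real x)) \<le> norm (exp (- s * x))"
      using nn by eventually_elim (use that in \<open>auto simp: norm_exp_eq_Re intro!: mult_right_mono\<close>)
  qed simp
  define q where "q w x = (exp (- w * complex_of_real x) - exp (- z * complex_of_real x)) / (w - z)" for w x
  have "((\<lambda>w. (L w - L z) / (w - z)) \<longlongrightarrow> (LINT x|M. - of_real x * exp (- z * complex_of_real x))) (at z within ball z d)"
    unfolding tendsto_at_iff_sequentially
  proof (intro allI impI)
    fix X assume X: "\<forall>i. X i \<in> ball z d - {z}" and lim: "X \<longlonglongrightarrow> z"
    have Xs: "Re (X i) > s" for i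
    proof -
      have "\<bar>Re (X i) - Re z\<bar> < d" using X abs_Re_le_cmod[of "X i - z"] by (auto simp: dist_norm norm_minus_commute intro: le_less_trans)
      then show ?thesis unfolding d_def by (simp add: abs_if field_simps split: if_splits)
    qed
    have eq: "(L (X i) - L z) / (X i - z) = (LINT x|M. q (X i) x)" for i
      unfolding L_def q_def using inte[OF Xs] inte[OF z] by simp
    have "(\<lambda>i. LINT x|M. q (X i) x) \<longlonglongrightarrow> (LINT x|M. - of_real x * exp (- z * complex_of_real x))"
    proof (rule integral_dominated_convergence[where w="\<lambda>x. 1 / d * exp (- s * x)"])
      show "integrable M (\<lambda>x. 1 / d * exp (- s * x))" by (intro integrable_mult_right int)
      show "AE x in M. norm (q (X i) x) \<le> 1 / d * exp (- s * x)" for i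
        using nn
      proof eventually_elim
        case (elim x)
        define h where "h = X i - z"
        have h: "h \<noteq> 0" "cmod h \<le> d" using X by (auto simp: h_def dist_norm norm_minus_commute less_imp_le)
        have "q (X i) x = exp (- z * complex_of_real x) * (exp (- h * of_real x) - 1) / h"
        proof -
          have "exp (- X i * complex_of_real x) = exp (- z * complex_of_real x) * exp (- h * complex_of_real x)"
            unfolding exp_add[symmetric] h_def by (simp add: algebra_simps)
          then show ?thesis unfolding q_def h_def[symmetric] by (simp add: algebra_simps)
        qed
        then have "norm (q (X i) x) = exp (- Re z * x) * cmod (exp (- h * of_real x) - 1) / cmod h"
          by (simp add: norm_mult norm_divide norm_exp_eq_Re)
        also have "\<dots> \<le> exp (- Re z * x) * (exp (d * x) * cmod (- h * of_real x)) / cmod h"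
        proof (intro divide_right_mono mult_left_mono norm_exp_minus_one_le)
          have "- Re h \<le> d" using abs_Re_le_cmod[of h] h by linarith
          then show "Re (- h * complex_of_real x) \<le> d * x" using elim mult_right_mono[of "- Re h" d x] by simp
        qed (use d elim in auto)
        also have "\<dots> = exp (- Re z * x) * exp (d * x) * x" using h elim by (simp add: norm_mult)
        also have "\<dots> \<le> exp (- Re z * x) * exp (d * x) * (exp (d * x) / d)"
          using le_exp_div[OF d, of x] by (intro mult_left_mono) auto
        also have "\<dots> = 1 / d * exp (- s * x)"
        proof -
          have "- Re z * x + d * x + d * x = - s * x" unfolding d_def by (simp add: field_simps)
          then show ?thesis by (simp add: exp_add[symmetric] del: exp_add)
        qed
        finally show ?case .
      qed
      show "AE x in M. (\<lambda>i. q (X i) x) \<longlonglongrightarrow> - of_real x * exp (- z * complex_of_real x)"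
      proof (rule AE_I2)
        fix x
        have "((\<lambda>w. exp (- w * complex_of_real x)) has_field_derivative - of_real x * exp (- z * complex_of_real x)) (at z within ball z d)"
          by (auto intro!: derivative_eq_intros)
        then show "(\<lambda>i. q (X i) x) \<longlonglongrightarrow> - of_real x * exp (- z * complex_of_real x)"
          unfolding has_field_derivative_iff tendsto_at_iff_sequentially q_def using X lim by (auto simp: o_def)
      qed
    qed (auto simp: q_def)
    then show "((\<lambda>w. (L w - L z) / (w - z)) \<circ> X) \<longlonglongrightarrow> (LINT x|M. - of_real x * exp (- z * complex_of_real x))"
      by (simp add: o_def eq)
  qed
  then have "(L has_field_derivative (LINT x|M. - of_real x * exp (- z * complex_of_real x))) (at z within ball z d)"
    by (simp add: has_field_derivative_iff)
  then have "(L has_field_derivative (LINT x|M. - of_real x * exp (- z * complex_of_real x))) (at z)"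
    using d at_within_open[of z "ball z d"] by simp
  then show "(\<lambda>z. LINT x|M. exp (- z * complex_of_real x)) field_differentiable at z within {z. Re z > s}"
    unfolding L_def by (meson field_differentiable_at_within field_differentiable_def)
qed

text \<open>A sequence along which \<open>h\<close> tends to \<open>0\<close> has imaginary parts tending to infinity; a locally uniform
  limit of the corresponding vertical translates then has a zero in the interior of the strip, and
  Hurwitz's theorem produces infinitely many zeros of \<open>h\<close>.\<close>
lemma strip_lower_bound:
  fixes h :: "complex \<Rightarrow> complex"
  assumes hol: "h holomorphic_on {z. Re z > s}" and s: "s < a" "a < b"
    and bd: "\<And>z. Re z > s \<Longrightarrow> cmod (h z) \<le> K"
    and ca: "c > 0" "\<And>y. cmod (h (Complex a y)) \<ge> c" and cb: "\<And>z. Re z \<ge> b \<Longrightarrow> cmod (h z) \<ge> c"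
    and fin: "finite {z. Re z > a \<and> h z = 0}"
  obtains e T where "e > 0" "\<And>z. a \<le> Re z \<Longrightarrow> Re z \<le> b \<Longrightarrow> \<bar>Im z\<bar> \<ge> T \<Longrightarrow> cmod (h z) \<ge> e"
proof (rule ccontr)
  assume neg: "\<not> thesis"
  note found = that
  have ex: "\<exists>z. a \<le> Re z \<and> Re z \<le> b \<and> \<bar>Im z\<bar> \<ge> T \<and> cmod (h z) < e" if e: "e > 0" for e T
  proof (rule ccontr)
    assume none: "\<not> ?thesis"
    have thesis by (rule found[OF e, of T]) (use none in \<open>auto simp: not_less\<close>)
    then show False using neg by contradiction
  qed
  then have "\<exists>z. a \<le> Re z \<and> Re z \<le> b \<and> \<bar>Im z\<bar> \<ge> real n \<and> cmod (h z) < 1 / (real n + 1)" for n by simp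
  then obtain z where z: "\<And>n. a \<le> Re (z n)" "\<And>n. Re (z n) \<le> b" "\<And>n. \<bar>Im (z n)\<bar> \<ge> real n" "\<And>n. cmod (h (z n)) < 1 / (real n + 1)"
    by metis
  \<comment> \<open>Convergence of the real parts gives a fixed point \<open>x\<close> at which the
    limit of the translates must vanish.\<close>
  have "compact {a..b}" by simp
  then obtain x r1 where x: "x \<in> {a..b}" and r1: "strict_mono r1" and xl: "((\<lambda>n. Re (z n)) \<circ> r1) \<longlonglongrightarrow> x"
    using z unfolding compact_def by (metis atLeastAtMost_iff)
  define w where "w n = z (r1 n)" for n
  have wl: "(\<lambda>n. Re (w n)) \<longlonglongrightarrow> x" using xl by (simp add: w_def o_def)
  have wn: "a \<le> Re (w n)" "Re (w n) \<le> b" "\<bar>Im (w n)\<bar> \<ge> real n" "cmod (h (w n)) < 1 / (real n + 1)" for n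
  proof -
    have "n \<le> r1 n" using seq_suble[OF r1] .
    moreover have "\<bar>Im (w n)\<bar> \<ge> real (r1 n)" "cmod (h (w n)) < 1 / (real (r1 n) + 1)" using z by (auto simp: w_def)
    moreover have "1 / (real (r1 n) + 1) \<le> 1 / (real n + 1)" using \<open>n \<le> r1 n\<close> by (intro divide_left_mono) auto
    ultimately show "\<bar>Im (w n)\<bar> \<ge> real n" "cmod (h (w n)) < 1 / (real n + 1)" by linarith+
  qed (use z in \<open>auto simp: w_def\<close>)
  \<comment> \<open>The translate moves the imaginary part of \<open>w n\<close> to
    \<open>0\<close>. All translates obey the bound \<open>K\<close>, so they form a normal
    family.\<close>
  define F where "F n u = h (u + \<i> * of_real (Im (w n)))" for n u
  let ?S = "{u. Re u > s}"
  have holF: "F n holomorphic_on ?S" for n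
    unfolding F_def by (rule holomorphic_on_compose_gen[of _ _ h ?S, unfolded o_def]) (auto intro!: holomorphic_intros hol)
  obtain g r where g: "g holomorphic_on ?S" and r: "strict_mono (r :: nat \<Rightarrow> nat)"
    and pt: "\<And>u. u \<in> ?S \<Longrightarrow> (\<lambda>n. F (r n) u) \<longlonglongrightarrow> g u"
    and unif: "\<And>C. compact C \<Longrightarrow> C \<subseteq> ?S \<Longrightarrow> uniform_limit C (F \<circ> r) g sequentially"
  proof (rule Montel[of ?S "range F" F])
    show "open ?S" by (rule open_halfspace_Re_gt)
    show "\<And>h. h \<in> range F \<Longrightarrow> h holomorphic_on ?S" using holF by auto
    show "\<exists>B. \<forall>h\<in>range F. \<forall>z\<in>C. cmod (h z) \<le> B" if "compact C" "C \<subseteq> ?S" for C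
      using that bd by (intro exI[of _ K]) (auto simp: F_def)
  qed auto
  \<comment> \<open>The points where the translates are small move with \<open>n\<close>. Uniform
    convergence on the segment \<open>{a..b}\<close> together with continuity of \<open>g\<close>
    carries the smallness over to \<open>x\<close>.\<close>
  have gx: "g (of_real x) = 0"
  proof -
    have C: "compact (of_real ` {a..b} :: complex set)" "of_real ` {a..b} \<subseteq> ?S"
      using s by (auto intro!: compact_continuous_image continuous_intros)
    define C where "C = (of_real ` {a..b} :: complex set)"
    define u where "u n = complex_of_real (Re (w (r n)))" for n
    have uC: "u n \<in> C" for n using wn by (auto simp: u_def C_def)
    have ux: "u \<longlonglongrightarrow> of_real x"
      unfolding u_def using LIMSEQ_subseq_LIMSEQ[OF wl r] by (intro tendsto_of_real) (simp add: o_def)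
    have "(\<lambda>n. F (r n) (u n) - g (u n)) \<longlonglongrightarrow> 0"
    proof (rule tendstoI)
      fix e :: real assume "e > 0"
      then have "\<forall>\<^sub>F n in sequentially. \<forall>y\<in>C. dist ((F \<circ> r) n y) (g y) < e"
        using unif[of C] C unfolding uniform_limit_iff C_def by blast
      then show "\<forall>\<^sub>F n in sequentially. dist (F (r n) (u n) - g (u n)) 0 < e"
        by eventually_elim (use uC in \<open>auto simp: dist_norm\<close>)
    qed
    moreover have "(\<lambda>n. g (u n)) \<longlonglongrightarrow> g (of_real x)"
    proof (rule continuous_on_tendsto_compose[OF _ ux])
      show "continuous_on C g" using C(2) unfolding C_def
        by (intro holomorphic_on_imp_continuous_on holomorphic_on_subset[OF g])
    qed (use x uC in \<open>auto simp: C_def\<close>)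
    ultimately have "(\<lambda>n. (F (r n) (u n) - g (u n)) + g (u n)) \<longlonglongrightarrow> 0 + g (of_real x)" by (rule tendsto_add)
    then have "(\<lambda>n. F (r n) (of_real (Re (w (r n))))) \<longlonglongrightarrow> g (of_real x)" by (simp add: u_def)
    moreover have "(\<lambda>n. F (r n) (of_real (Re (w (r n))))) \<longlonglongrightarrow> 0"
    proof (rule Lim_null_comparison)
      show "\<forall>\<^sub>F n in sequentially. norm (F (r n) (of_real (Re (w (r n))))) \<le> 1 / (real n + 1)"
      proof (rule always_eventually, rule allI)
        fix n
        have "of_real (Re (w (r n))) + \<i> * of_real (Im (w (r n))) = w (r n)" by (simp add: complex_eq_iff)
        then have "norm (F (r n) (of_real (Re (w (r n))))) < 1 / (real (r n) + 1)" using wn(4)[of "r n"] by (simp add: F_def)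
        also have "\<dots> \<le> 1 / (real n + 1)" using seq_suble[OF r, of n] by (intro divide_left_mono) auto
        finally show "norm (F (r n) (of_real (Re (w (r n))))) \<le> 1 / (real n + 1)" by simp
      qed
      show "(\<lambda>n. 1 / (real n + 1)) \<longlonglongrightarrow> 0" by real_asymp
    qed
    ultimately show ?thesis by (rule LIMSEQ_unique)
  qed
  have ga: "cmod (g (of_real a)) \<ge> c"
    by (rule LIMSEQ_le_const[OF tendsto_norm[OF pt]]) (use s ca(2) in \<open>auto simp: F_def complex_eq[symmetric] Complex_eq\<close>)
  have gb: "cmod (g (of_real b)) \<ge> c"
    by (rule LIMSEQ_le_const[OF tendsto_norm[OF pt]]) (use s cb in \<open>auto simp: F_def\<close>)
  \<comment> \<open>The lower bound on the line through \<open>a\<close> survives in the limit and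
    keeps the zero off the left edge; the one at \<open>b\<close> will show that \<open>g\<close> is
    not constant.\<close>
  have xa: "x > a" using x ga gx ca(1) by (cases "x = a") auto
  obtain N where N: "\<And>z. Re z > a \<Longrightarrow> h z = 0 \<Longrightarrow> \<bar>Im z\<bar> \<le> real N"
  proof -
    have "bdd_above ((\<lambda>z. \<bar>Im z\<bar>) ` {z. Re z > a \<and> h z = 0})" by (intro bdd_above_finite finite_imageI fin)
    then obtain Y where "\<forall>y\<in>(\<lambda>z. \<bar>Im z\<bar>) ` {z. Re z > a \<and> h z = 0}. y \<le> Y" unfolding bdd_above_def by blast
    obtain N where "Y \<le> real N" using real_arch_simple by blast
    then have "\<bar>Im z\<bar> \<le> real N" if "Re z > a" "h z = 0" for z
      using \<open>\<forall>y\<in>_. y \<le> Y\<close> that by fastforce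
    then show ?thesis by (rule that)
  qed
  \<comment> \<open>Translates with index at least \<open>N + 1\<close> shift by at least
    \<open>N + 1\<close>, so from the window \<open>\<bar>Im u\<bar> < 1\<close> they look at points
    with imaginary part beyond \<open>N\<close> in modulus, where \<open>h\<close> has no zero to
    the right of \<open>a\<close>.\<close>
  let ?S' = "{u. Re u > a} \<inter> {u. \<bar>Im u\<bar> < 1}"
  have "g (of_real x) \<noteq> 0"
  proof (rule Hurwitz_no_zeros[of ?S' "\<lambda>n. F (r (n + N + 1))" g])
    have eqS: "?S' = {u. Re u > a} \<inter> {u. Im u < 1} \<inter> {u. Im u > -1}" by auto
    show "open ?S'" unfolding eqS by (intro open_Int open_halfspace_Re_gt open_halfspace_Im_lt open_halfspace_Im_gt)
    show "connected ?S'" unfolding eqS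
      by (intro convex_connected convex_Int convex_halfspace_Re_gt convex_halfspace_Im_lt convex_halfspace_Im_gt)
    show "F (r (n + N + 1)) holomorphic_on ?S'" for n by (rule holomorphic_on_subset[OF holF]) (use s in auto)
    show "g holomorphic_on ?S'" by (rule holomorphic_on_subset[OF g]) (use s in auto)
    show "uniform_limit C (\<lambda>n. F (r (n + N + 1))) g sequentially" if "compact C" "C \<subseteq> ?S'" for C
    proof -
      have "uniform_limit C (F \<circ> r) g sequentially" by (rule unif) (use that s in auto)
      then show ?thesis
        using filterlim_compose[OF _ filterlim_add_const_nat_at_top[of "N + 1"]]
        by (fastforce simp: o_def add.assoc uniform_limit_iff eventually_sequentially intro: le_add1 trans_le_add1)
    qed
    show "\<not> g constant_on ?S'"
    proof
      assume "g constant_on ?S'"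
      moreover have "of_real x \<in> ?S'" "of_real b \<in> ?S'" using xa s by auto
      ultimately have "g (of_real x) = g (of_real b)" unfolding constant_on_def by metis
      then show False using gx gb ca(1) by simp
    qed
    show "F (r (n + N + 1)) u \<noteq> 0" if "u \<in> ?S'" for n u
    proof
      assume "F (r (n + N + 1)) u = 0"
      then have "\<bar>Im (u + \<i> * of_real (Im (w (r (n + N + 1)))))\<bar> \<le> real N"
        by (intro N) (use that in \<open>auto simp: F_def\<close>)
      moreover have "\<bar>Im (w (r (n + N + 1)))\<bar> \<ge> real (n + N + 1)"
        using wn(3)[of "r (n + N + 1)"] seq_suble[OF r, of "n + N + 1"] by linarith
      ultimately show False using that by auto
    qed
    show "of_real x \<in> ?S'" using xa by simp
  qed
  then show False using gx by simp
qed

section \<open>Splitting off poles\<close>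

text \<open>Each step divides \<open>g z - g l\<close> by \<open>z - l\<close>, a removable
  singularity. After division by \<open>(z - l) ^ k\<close>, the \<open>k\<close> separated terms
  become the principal part and the rest is holomorphic.\<close>

lemma holomorphic_ball_taylor_remainder:
  fixes G :: "complex \<Rightarrow> complex"
  assumes "G holomorphic_on ball l r" "r > 0"
  shows "\<exists>c g. g holomorphic_on ball l r \<and> (\<forall>z\<in>ball l r. G z = (\<Sum>m<k. c m * (z - l) ^ m) + (z - l) ^ k * g z)"
proof (induction k)
  case 0
  show ?case using assms by (intro exI[of _ "\<lambda>_. 0"] exI[of _ G]) auto
next
  case (Suc k)
  then obtain c g where g: "g holomorphic_on ball l r" "\<And>z. z \<in> ball l r \<Longrightarrow> G z = (\<Sum>m<k. c m * (z - l) ^ m) + (z - l) ^ k * g z"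
    by blast
  define g1 where "g1 z = (if z = l then deriv g l else (g z - g l) / (z - l))" for z
  have "g1 holomorphic_on ball l r" unfolding g1_def by (rule pole_lemma_open[OF g(1)]) auto
  moreover have "G z = (\<Sum>m<Suc k. (c(k := g l)) m * (z - l) ^ m) + (z - l) ^ Suc k * g1 z" if "z \<in> ball l r" for z
  proof -
    have "g z = g l + (z - l) * g1 z" by (simp add: g1_def)
    then show ?thesis unfolding g(2)[OF that] by (subst \<open>g z = _\<close>) (simp add: distrib_left mult_ac)
  qed
  ultimately show ?case by (intro exI[of _ "c(k := g l)"] exI[of _ g1]) auto
qed

lemma holomorphic_extension_finite:
  assumes "open S" "finite R" "R \<subseteq> S" and hol: "\<phi> holomorphic_on S - R"
    and loc: "\<And>l. l \<in> R \<Longrightarrow> \<exists>r>0. \<exists>g. g holomorphic_on ball l r \<and> (\<forall>z\<in>ball l r - {l}. \<phi> z = g z)"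
  obtains H where "H holomorphic_on S" "\<And>z. z \<in> S - R \<Longrightarrow> H z = \<phi> z"
proof -
  obtain r g where rg: "\<And>l. l \<in> R \<Longrightarrow> r l > (0::real)" "\<And>l. l \<in> R \<Longrightarrow> g l holomorphic_on ball l (r l)"
    "\<And>l z. l \<in> R \<Longrightarrow> z \<in> ball l (r l) - {l} \<Longrightarrow> \<phi> z = g l z"
    using loc by metis
  \<comment> \<open>At an exceptional point \<open>l\<close> the value is taken at the centre of its
    own local extension, hence \<open>g z z\<close>.\<close>
  define H where "H z = (if z \<in> R then g z z else \<phi> z)" for z
  have "H holomorphic_on S"
  proof (rule no_isolated_singularity'[of R])
    show "H holomorphic_on S - R"
      by (rule holomorphic_transform[OF hol]) (auto simp: H_def)
    show "(H \<longlongrightarrow> H l) (at l within S)" if l: "l \<in> R" for l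
    proof (rule Lim_at_imp_Lim_at_within, rule Lim_transform_eventually)
      have "continuous_on (ball l (r l)) (g l)" using rg(2)[OF l] by (rule holomorphic_on_imp_continuous_on)
      then have "isCont (g l) l" using rg(1)[OF l] by (simp add: continuous_on_eq_continuous_at)
      then show "(g l \<longlongrightarrow> H l) (at l)" using l by (simp add: H_def isCont_def)
      have "eventually (\<lambda>z. z \<in> ball l (r l) - {l}) (at l)"
        using rg(1)[OF l] by (auto simp: eventually_at dist_commute)
      moreover have "eventually (\<lambda>z. z \<notin> R - {l}) (at l)"
      proof -
        have "eventually (\<lambda>z. z \<in> - (R - {l})) (nhds l)" using assms(2)
          by (intro eventually_nhds_in_open open_Compl finite_imp_closed finite_Diff) auto
        then show ?thesis by (auto simp: eventually_at_filter elim: eventually_mono)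
      qed
      ultimately show "eventually (\<lambda>z. g l z = H z) (at l)"
        by eventually_elim (use rg(3)[OF l] in \<open>auto simp: H_def\<close>)
    qed
  qed (use assms in auto)
  then show ?thesis by (rule that) (auto simp: H_def)
qed

section \<open>Abscissas of convergence\<close>

lemma laplace_domain_mono:
  assumes "z \<in> laplace_domain \<mu>" "Re z \<le> Re w"
  shows "w \<in> laplace_domain \<mu>"
proof -
  have "(\<integral>\<^sup>+x\<in>{0..}. ennreal (exp (- Re w * x)) \<partial>\<mu> i j) \<le> (\<integral>\<^sup>+x\<in>{0..}. ennreal (exp (- Re z * x)) \<partial>\<mu> i j)" for i j
    using assms(2) by (intro nn_integral_mono) (auto split: split_indicator intro!: ennreal_leI mult_right_mono)
  then show ?thesis using assms(1) unfolding laplace_domain_def mem_Collect_eq by (meson le_less_trans)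
qed

lemma locally_finite_nonneg_AE:
  assumes "locally_finite_nonneg M"
  shows "AE x in M. x \<ge> 0"
  using assms by (intro AE_I[where N="{..<0}"]) (auto simp: locally_finite_nonneg_def)

lemma laplace_domain_integrable:
  assumes lf: "locally_finite_nonneg (\<mu> i j)" and s: "complex_of_real s \<in> laplace_domain \<mu>"
  shows "integrable (\<mu> i j) (\<lambda>x. exp (- s * x))" "(\<integral>\<^sup>+x. ennreal (exp (- s * x)) \<partial>\<mu> i j) < \<infinity>"
proof -
  have [measurable_cong]: "sets (\<mu> i j) = sets borel" using lf by (simp add: locally_finite_nonneg_def)
  have "(\<integral>\<^sup>+x. ennreal (exp (- s * x)) \<partial>\<mu> i j) = (\<integral>\<^sup>+x\<in>{0..}. ennreal (exp (- Re (complex_of_real s) * x)) \<partial>\<mu> i j)"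
    by (rule nn_integral_cong_AE) (use locally_finite_nonneg_AE[OF lf] in \<open>auto elim!: eventually_mono\<close>)
  also have "\<dots> < \<infinity>" using s unfolding laplace_domain_def by blast
  finally show fin: "(\<integral>\<^sup>+x. ennreal (exp (- s * x)) \<partial>\<mu> i j) < \<infinity>" .
  show "integrable (\<mu> i j) (\<lambda>x. exp (- s * x))" using fin by (intro integrableI_bounded) auto
qed

text \<open>The domain is closed under increasing the real part, so an interior point leaves room
  for an abscissa \<open>s\<close> to its left. This makes the transforms holomorphic across the
  line \<open>Re z = \<theta>\<^sub>0\<close>.\<close>

lemma interior_laplace_domain:
  assumes "complex_of_real \<theta>\<^sub>0 \<in> interior (laplace_domain \<mu>)"
  obtains s where "s < \<theta>\<^sub>0" "\<And>z. Re z \<ge> s \<Longrightarrow> z \<in> laplace_domain \<mu>"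
proof -
  obtain e where e: "e > 0" "ball (complex_of_real \<theta>\<^sub>0) e \<subseteq> laplace_domain \<mu>"
    using assms by (auto simp: mem_interior)
  have "complex_of_real (\<theta>\<^sub>0 - e / 2) \<in> ball (complex_of_real \<theta>\<^sub>0) e"
    using e(1) by (simp add: dist_norm norm_divide)
  then have "complex_of_real (\<theta>\<^sub>0 - e / 2) \<in> laplace_domain \<mu>" using e(2) by blast
  then have "z \<in> laplace_domain \<mu>" if "Re z \<ge> \<theta>\<^sub>0 - e / 2" for z
    using laplace_domain_mono that by fastforce
  then show ?thesis using that[of "\<theta>\<^sub>0 - e / 2"] e(1) by simp
qed

text \<open>As \<open>\<sigma>\<close> grows, \<open>exp (- \<sigma> * x)\<close> tends to the
  indicator of \<open>0\<close>, so the transforms tend to the atoms at \<open>0\<close>. For these,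
  \<open>v\<close> satisfies the inequality with a gap of \<open>1\<close>, half of which remains
  for large \<open>\<sigma>\<close>. The abscissa may be taken beyond any prescribed
  \<open>\<sigma>\<^sub>1\<close>.\<close>

lemma renewal_kernel_exists:
  assumes lf: "\<And>i j. locally_finite_nonneg (\<mu> i j)" and s: "complex_of_real s \<in> laplace_domain \<mu>"
    and rad: "spectral_radius (atom0 \<mu>) < 1"
  obtains \<sigma> \<rho> v where "\<sigma> \<ge> \<sigma>\<^sub>1" "renewal_kernel \<mu> \<sigma> \<rho> v"
proof -
  have sM[measurable_cong]: "sets (\<mu> i j) = sets borel" for i j using lf[of i j] by (simp add: locally_finite_nonneg_def)
  define A where "A i j = measure (\<mu> i j) {0}" for i j
  obtain v where v: "\<And>i. v i \<ge> 1" "\<And>i. (\<Sum>j\<in>UNIV. A i j * v j) = v i - 1"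
    using nonneg_matrix_subinvariant_vector[of A] rad unfolding A_def atom0_def by auto
  have v0: "v i \<ge> 0" for i using v(1)[of i] by simp
  have lim: "((\<lambda>\<sigma>. LINT x|\<mu> i j. exp (- \<sigma> * x)) \<longlongrightarrow> A i j) at_top" for i j
  proof -
    have "((\<lambda>\<sigma>. LINT x|\<mu> i j. exp (- \<sigma> * x)) \<longlongrightarrow> (LINT x|\<mu> i j. indicator {0} x)) at_top"
    proof (rule integral_dominated_convergence_at_top[where w="\<lambda>x. exp (- s * x)"])
      show "integrable (\<mu> i j) (\<lambda>x. exp (- s * x))" by (rule laplace_domain_integrable[where \<mu>=\<mu>, OF lf s])
      show "\<forall>\<^sub>F \<sigma> in at_top. AE x in \<mu> i j. norm (exp (- \<sigma> * x)) \<le> exp (- s * x)"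
        using eventually_ge_at_top[of s]
      proof eventually_elim
        case (elim \<sigma>)
        show ?case using locally_finite_nonneg_AE[OF lf[of i j]]
          by eventually_elim (use elim in \<open>auto intro!: mult_right_mono\<close>)
      qed
      show "AE x in \<mu> i j. ((\<lambda>\<sigma>. exp (- \<sigma> * x)) \<longlongrightarrow> indicator {0} x) at_top"
        using locally_finite_nonneg_AE[OF lf[of i j]]
      proof eventually_elim
        case (elim x)
        show ?case
        proof (cases "x = 0")
          case False
          then have "((\<lambda>\<sigma>. exp (- \<sigma> * x)) \<longlongrightarrow> 0) at_top" using elim by real_asymp
          then show ?thesis using False by simp
        qed simp
      qed
    qed auto
    then show ?thesis by (simp add: A_def)
  qed
  have ev: "eventually (\<lambda>\<sigma>. (\<Sum>j\<in>UNIV. (LINT x|\<mu> i j. exp (- \<sigma> * x)) * v j) < v i - 1/2) at_top" for i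
  proof (rule order_tendstoD)
    show "((\<lambda>\<sigma>. \<Sum>j\<in>UNIV. (LINT x|\<mu> i j. exp (- \<sigma> * x)) * v j) \<longlongrightarrow> v i - 1) at_top"
      unfolding v(2)[symmetric] by (intro tendsto_intros lim)
  qed simp
  have "eventually (\<lambda>\<sigma>. (\<forall>i. (\<Sum>j\<in>UNIV. (LINT x|\<mu> i j. exp (- \<sigma> * x)) * v j) < v i - 1/2) \<and> \<sigma> \<ge> max s \<sigma>\<^sub>1) at_top"
    by (intro eventually_conj eventually_all_finite ev eventually_ge_at_top)
  then obtain \<sigma> where \<sigma>: "\<And>i. (\<Sum>j\<in>UNIV. (LINT x|\<mu> i j. exp (- \<sigma> * x)) * v j) < v i - 1/2" "\<sigma> \<ge> s" "\<sigma> \<ge> \<sigma>\<^sub>1"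
    using eventually_happens[of _ "at_top :: real filter"] by force
  define V where "V = (\<Sum>i\<in>UNIV. v i)"
  have V: "v i \<le> V" for i unfolding V_def by (intro member_le_sum) (auto simp: v0)
  have V1: "V \<ge> 1" using order_trans[OF v(1) V] .
  \<comment> \<open>The additive gap \<open>1/2\<close> becomes a common factor below
    \<open>1\<close>, since \<open>v i / (2 * V)\<close> is at most \<open>1/2\<close> for every
    \<open>i\<close>.\<close>
  define \<rho> where "\<rho> = 1 - 1 / (2 * V)"
  have "renewal_kernel \<mu> \<sigma> \<rho> v"
  proof
    show "0 \<le> \<rho>" "\<rho> < 1" using V1 by (auto simp: \<rho>_def field_simps)
    fix i
    have \<sigma>d: "complex_of_real \<sigma> \<in> laplace_domain \<mu>" using laplace_domain_mono[OF s] \<sigma>(2) by simp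
    have "(\<Sum>j\<in>UNIV. (\<integral>\<^sup>+x. ennreal (exp (- \<sigma> * x)) \<partial>\<mu> i j) * ennreal (v j)) = (\<Sum>j\<in>UNIV. ennreal ((LINT x|\<mu> i j. exp (- \<sigma> * x)) * v j))"
    proof (rule sum.cong[OF refl])
      fix j
      show "(\<integral>\<^sup>+x. ennreal (exp (- \<sigma> * x)) \<partial>\<mu> i j) * ennreal (v j) = ennreal ((LINT x|\<mu> i j. exp (- \<sigma> * x)) * v j)"
        using nn_integral_eq_integral[OF laplace_domain_integrable(1)[where \<mu>=\<mu>, OF lf \<sigma>d, of i j]] v0[of j]
        by (simp add: ennreal_mult')
    qed
    also have "\<dots> = ennreal (\<Sum>j\<in>UNIV. (LINT x|\<mu> i j. exp (- \<sigma> * x)) * v j)"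
      by (rule sum_ennreal) (auto intro!: mult_nonneg_nonneg v0)
    also have "\<dots> \<le> ennreal (\<rho> * v i)"
    proof (rule ennreal_leI)
      have "v i * (1 / (2 * V)) \<le> V * (1 / (2 * V))" using V[of i] V1 by (intro mult_right_mono) auto
      also have "\<dots> = 1 / 2" using V1 by simp
      finally have "v i - 1 / 2 \<le> \<rho> * v i" by (simp add: \<rho>_def algebra_simps)
      then show "(\<Sum>j\<in>UNIV. (LINT x|\<mu> i j. exp (- \<sigma> * x)) * v j) \<le> \<rho> * v i" using \<sigma>(1)[of i] by linarith
    qed
    finally show "(\<Sum>j\<in>UNIV. (\<integral>\<^sup>+x. ennreal (exp (- \<sigma> * x)) \<partial>\<mu> i j) * ennreal (v j)) \<le> ennreal (\<rho> * v i)" .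
  qed (use lf v in auto)
  then show ?thesis using that \<sigma>(3) by blast
qed

section \<open>The characteristic matrix in the strip\<close>

text \<open>Three abscissas: from \<open>s\<close> on the transforms of \<open>\<mu>\<close>
  converge, on the line at \<open>\<theta>\<^sub>0\<close> the inverse is bounded, and from
  \<open>\<sigma>\<close> on the inverse is the transform of \<open>U\<close>.\<close>

locale renewal_strip = renewal_kernel \<mu> \<sigma> \<rho> v
  for \<mu> :: "'n::finite \<Rightarrow> 'n \<Rightarrow> real measure" and \<sigma> \<rho> :: real and v :: "'n \<Rightarrow> real" +
  fixes s \<theta>\<^sub>0 :: real
  assumes s: "s < \<theta>\<^sub>0" "\<theta>\<^sub>0 < \<sigma>" and dom: "\<And>z. Re z \<ge> s \<Longrightarrow> z \<in> laplace_domain \<mu>"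
    and inv_line: "\<And>\<eta>. invertible (mat 1 - laplace \<mu> (Complex \<theta>\<^sub>0 \<eta>))"
    and bdd_line: "bdd_above (range (\<lambda>\<eta>. norm (matrix_inv (mat 1 - laplace \<mu> (Complex \<theta>\<^sub>0 \<eta>)))))"
    and fin: "finite (roots_gt \<mu> \<theta>\<^sub>0)"
begin

abbreviation "A z \<equiv> mat 1 - laplace \<mu> z"

lemma holomorphic_A: "(\<lambda>z. A z $ i $ j) holomorphic_on {z. Re z > s}"
proof -
  have "integrable (\<mu> i j) (\<lambda>x. exp (- s * x))"
    by (rule laplace_domain_integrable[where \<mu>=\<mu>, OF lf dom]) simp
  then have "(\<lambda>z. LINT x|\<mu> i j. exp (- z * complex_of_real x)) holomorphic_on {z. Re z > s}"
    by (intro laplace_integral_holomorphic sets_\<mu> \<mu>_nonneg)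
  then show ?thesis by (simp only: vector_minus_component laplace_nth) (intro holomorphic_intros)
qed

lemma A_bounded: obtains K where "K \<ge> 1" "\<And>z i j. Re z > s \<Longrightarrow> cmod (A z $ i $ j) \<le> K"
proof -
  define K where "K = 1 + (\<Sum>i\<in>UNIV. \<Sum>j\<in>UNIV. LINT x|\<mu> i j. exp (- s * x))"
  have int: "integrable (\<mu> i j) (\<lambda>x. exp (- s * x))" for i j
    by (rule laplace_domain_integrable[where \<mu>=\<mu>, OF lf dom]) simp
  have nn: "(LINT x|\<mu> i j. exp (- s * x)) \<ge> 0" for i j by simp
  have le: "(LINT x|\<mu> i j. exp (- s * x)) \<le> K - 1" for i j
  proof -
    have "(LINT x|\<mu> i j. exp (- s * x)) \<le> (\<Sum>j\<in>UNIV. LINT x|\<mu> i j. exp (- s * x))" by (intro member_le_sum nn) auto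
    also have "\<dots> \<le> K - 1" unfolding K_def using member_le_sum[of i UNIV "\<lambda>i. \<Sum>j\<in>UNIV. LINT x|\<mu> i j. exp (- s * x)"]
      by (simp add: sum_nonneg)
    finally show ?thesis .
  qed
  have "cmod (A z $ i $ j) \<le> K" if "Re z > s" for z i j
  proof -
    have "cmod (A z $ i $ j) \<le> cmod (mat 1 $ i $ j) + cmod (laplace \<mu> z $ i $ j)"
      by (simp only: vector_minus_component norm_triangle_ineq4)
    also have "cmod (laplace \<mu> z $ i $ j) \<le> (LINT x|\<mu> i j. exp (- s * x))"
      unfolding laplace_nth by (rule exp_integrable_mono[OF sets_\<mu> \<mu>_nonneg int]) (use that in simp)
    also have "cmod (mat 1 $ i $ j) \<le> 1" by (simp add: mat_def)
    finally show ?thesis using le[of i j] by linarith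
  qed
  moreover have "K \<ge> 1" unfolding K_def by (simp add: sum_nonneg)
  ultimately show ?thesis using that by blast
qed

text \<open>\<open>det M\<close> and \<open>det N\<close> are reciprocal, so a bound on the entries
  of the inverse keeps \<open>det M\<close> away from \<open>0\<close>. It is applied on both edges
  of the strip.\<close>

lemma det_lower_bound_from_inverse:
  fixes M N :: "complex^'n^'n"
  assumes "M ** N = mat 1" "\<And>i j. cmod (N $ i $ j) \<le> K" "K > 0"
  shows "cmod (det M) \<ge> 1 / (fact CARD('n) * K ^ CARD('n))"
proof -
  have "det M * det N = 1" using assms(1) by (metis det_I det_mul)
  then have "1 = cmod (det M) * cmod (det N)" by (metis norm_mult norm_one)
  also have "\<dots> \<le> cmod (det M) * (fact CARD('n) * K ^ CARD('n))" by (intro mult_left_mono norm_det_le assms) auto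
  finally show ?thesis using assms(3) by (simp add: divide_le_eq)
qed

lemma matrix_inv_eq_laplace_U:
  assumes "Re z \<ge> \<sigma>" shows "matrix_inv (A z) = laplace_U z" "det (A z) \<noteq> 0"
  using matrix_inv_unique[OF laplace_U_inverse[OF assms]] invertible_det_nz by auto

lemma roots_gt_iff: "z \<in> roots_gt \<mu> \<theta>\<^sub>0 \<longleftrightarrow> Re z > \<theta>\<^sub>0 \<and> det (A z) = 0"
  using dom[of z] s by (auto simp: roots_gt_def roots_def)

lemma roots_gt_less: "l \<in> roots_gt \<mu> \<theta>\<^sub>0 \<Longrightarrow> Re l < \<sigma>"
  using matrix_inv_eq_laplace_U(2)[of l] roots_gt_iff[of l] by force

text \<open>Passing to the determinant gives a scalar holomorphic function with the same roots, to
  which the lower bound in a strip applies. The left edge comes from the assumed bound on the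
  inverse, the right one from the transform of \<open>U\<close>.\<close>

lemma det_strip:
  obtains e T where "e > 0" "\<And>z. \<theta>\<^sub>0 \<le> Re z \<Longrightarrow> Re z \<le> \<sigma> \<Longrightarrow> \<bar>Im z\<bar> \<ge> T \<Longrightarrow> cmod (det (A z)) \<ge> e"
proof -
  obtain K where K: "K \<ge> 1" "\<And>z i j. Re z > s \<Longrightarrow> cmod (A z $ i $ j) \<le> K" using A_bounded by metis
  obtain K1 where K1: "\<And>\<eta>. norm (matrix_inv (A (Complex \<theta>\<^sub>0 \<eta>))) \<le> K1"
    using bdd_line by (auto simp: bdd_above_def)
  define K2 where "K2 = (\<Sum>i\<in>UNIV. \<Sum>j\<in>UNIV. LINT x|U i j. exp (- \<sigma> * x))"
  have K2: "cmod (laplace_U z $ i $ j) \<le> K2" if "Re z \<ge> \<sigma>" for z i j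
  proof -
    have nn: "(LINT x|U i j. exp (- \<sigma> * x)) \<ge> 0" for i j by simp
    have "(LINT x|U i j. exp (- \<sigma> * x)) \<le> (\<Sum>j\<in>UNIV. LINT x|U i j. exp (- \<sigma> * x))" by (intro member_le_sum nn) auto
    also have "\<dots> \<le> K2" unfolding K2_def by (rule member_le_sum[of i UNIV "\<lambda>i. \<Sum>j\<in>UNIV. LINT x|U i j. exp (- \<sigma> * x)"]) (auto simp: sum_nonneg)
    finally show ?thesis using laplace_U_bound[OF that, of i j] by linarith
  qed
  define K3 where "K3 = max 1 (max K1 K2)"
  define c where "c = 1 / (fact CARD('n) * K3 ^ CARD('n))"
  have K3: "K3 > 0" by (simp add: K3_def)
  have c: "c > 0" using K3 by (simp add: c_def)
  show ?thesis
  proof (rule strip_lower_bound[of "\<lambda>z. det (A z)" s \<theta>\<^sub>0 \<sigma> "fact CARD('n) * K ^ CARD('n)" c])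
    show "(\<lambda>z. det (A z)) holomorphic_on {z. Re z > s}" by (rule holomorphic_on_det) (rule holomorphic_A)
    show "cmod (det (A z)) \<le> fact CARD('n) * K ^ CARD('n)" if "Re z > s" for z
      by (rule norm_det_le) (rule K(2)[OF that])
    show "c \<le> cmod (det (A (Complex \<theta>\<^sub>0 y)))" for y
      unfolding c_def
    proof (rule det_lower_bound_from_inverse[OF _ _ K3])
      show "A (Complex \<theta>\<^sub>0 y) ** matrix_inv (A (Complex \<theta>\<^sub>0 y)) = mat 1"
        using inv_line[of y] someI_ex[of "\<lambda>B. A (Complex \<theta>\<^sub>0 y) ** B = mat 1 \<and> B ** A (Complex \<theta>\<^sub>0 y) = mat 1"]
        by (simp add: matrix_inv_def invertible_def)
      show "cmod (matrix_inv (A (Complex \<theta>\<^sub>0 y)) $ i $ j) \<le> K3" for i j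
        using order_trans[OF Finite_Cartesian_Product.norm_nth_le order_trans[OF Finite_Cartesian_Product.norm_nth_le K1[of y]], of i j]
        by (simp add: K3_def)
    qed
    show "c \<le> cmod (det (A z))" if "Re z \<ge> \<sigma>" for z
      unfolding c_def
      by (rule det_lower_bound_from_inverse[OF laplace_U_inverse[OF that] _ K3]) (use K2[OF that] in \<open>auto simp: K3_def le_max_iff_disj\<close>)
    show "finite {z. Re z > \<theta>\<^sub>0 \<and> det (A z) = 0}" using fin by (simp add: roots_gt_iff[symmetric])
  qed (use s c that in auto)
qed

text \<open>The \<open>(i, j)\<close> entry of the adjugate of \<open>A z\<close>, in the form of
  the numerator in Cramer's rule.\<close>

definition cofactor :: "'n \<Rightarrow> 'n \<Rightarrow> complex \<Rightarrow> complex" where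
  "cofactor i j z = det (\<chi> k l. if l = i then (if k = j then 1 else 0) else A z $ k $ l)"

lemma matrix_inv_A: "det (A z) \<noteq> 0 \<Longrightarrow> matrix_inv (A z) $ i $ j = cofactor i j z / det (A z)"
  unfolding cofactor_def by (rule matrix_inv_nth)

lemma holomorphic_cofactor: "cofactor i j holomorphic_on {z. Re z > s}"
  unfolding cofactor_def
proof (rule holomorphic_on_det)
  fix k l
  show "(\<lambda>z. (\<chi> k l. if l = i then (if k = j then 1 else 0) else A z $ k $ l) $ k $ l) holomorphic_on {z. s < Re z}"
    by (cases "l = i") (use holomorphic_A[of k l] in auto)
qed

lemma holomorphic_det: "(\<lambda>z. det (A z)) holomorphic_on {z. Re z > s}"
  by (rule holomorphic_on_det) (rule holomorphic_A)

lemma inverse_bounded: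
  obtains C T where "\<And>z i j. \<theta>\<^sub>0 \<le> Re z \<Longrightarrow> Re z \<le> \<sigma> \<Longrightarrow> \<bar>Im z\<bar> \<ge> T \<Longrightarrow> cmod (matrix_inv (A z) $ i $ j) \<le> C"
proof -
  obtain e T where e: "e > 0" "\<And>z. \<theta>\<^sub>0 \<le> Re z \<Longrightarrow> Re z \<le> \<sigma> \<Longrightarrow> \<bar>Im z\<bar> \<ge> T \<Longrightarrow> cmod (det (A z)) \<ge> e" using det_strip by metis
  obtain K where K: "K \<ge> 1" "\<And>z i j. Re z > s \<Longrightarrow> cmod (A z $ i $ j) \<le> K" using A_bounded by metis
  have "cmod (matrix_inv (A z) $ i $ j) \<le> fact CARD('n) * K ^ CARD('n) / e" if z: "\<theta>\<^sub>0 \<le> Re z" "Re z \<le> \<sigma>" "\<bar>Im z\<bar> \<ge> T" for z i j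
  proof -
    have "det (A z) \<noteq> 0" using e(2)[OF z] e(1) by auto
    moreover have "cmod (cofactor i j z) \<le> fact CARD('n) * K ^ CARD('n)"
      unfolding cofactor_def by (rule norm_det_le) (use K z s in auto)
    ultimately show ?thesis using e(2)[OF z] e(1) K(1) by (auto simp: matrix_inv_A norm_divide intro!: frac_le)
  qed
  then show ?thesis using that by blast
qed

text \<open>\<open>pole_order\<close> is a \<open>LEAST\<close>, so some admissible exponent must be
  exhibited: the order of the zero of the determinant works because the adjugate is holomorphic. The
  determinant is not constant, as it vanishes at \<open>l\<close> but not at
  \<open>\<sigma>\<close>.\<close>

lemma pole_order_spec:
  assumes l: "l \<in> roots_gt \<mu> \<theta>\<^sub>0"
  shows "\<exists>r>0. \<exists>G :: 'n \<Rightarrow> 'n \<Rightarrow> complex \<Rightarrow> complex. (\<forall>i j. G i j holomorphic_on ball l r) \<and>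
        (\<forall>z\<in>ball l r - {l}. z \<in> laplace_domain \<mu> \<and> invertible (A z) \<and>
           (\<forall>i j. G i j z = (z - l) ^ pole_order \<mu> l * matrix_inv (A z) $ i $ j))"
proof -
  let ?S = "{z. Re z > s}"
  have lS: "l \<in> ?S" "det (A l) = 0" using l roots_gt_iff[of l] s by auto
  have nc: "\<not> (\<lambda>z. det (A z)) constant_on ?S"
  proof
    assume "(\<lambda>z. det (A z)) constant_on ?S"
    then have "det (A l) = det (A (of_real \<sigma>))" using lS s unfolding constant_on_def by (metis (mono_tags, lifting) Re_complex_of_real less_trans mem_Collect_eq)
    then show False using lS matrix_inv_eq_laplace_U(2)[of "of_real \<sigma>"] by simp
  qed
  obtain g r n where g: "0 < n" "0 < r" "ball l r \<subseteq> ?S" "g holomorphic_on ball l r"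
    "\<And>w. w \<in> ball l r \<Longrightarrow> det (A w) = (w - l) ^ n * g w" "\<And>w. w \<in> ball l r \<Longrightarrow> g w \<noteq> 0"
    using holomorphic_factor_zero_nonconstant[OF holomorphic_det open_halfspace_Re_gt convex_connected[OF convex_halfspace_Re_gt] lS nc] by metis
  let ?P = "\<lambda>k. 1 \<le> k \<and> (\<exists>r>0. \<exists>G :: 'n \<Rightarrow> 'n \<Rightarrow> complex \<Rightarrow> complex. (\<forall>i j. G i j holomorphic_on ball l r) \<and>
        (\<forall>z\<in>ball l r - {l}. z \<in> laplace_domain \<mu> \<and> invertible (A z) \<and>
           (\<forall>i j. G i j z = (z - l) ^ k * matrix_inv (A z) $ i $ j)))"
  have "?P n"
  proof (intro conjI exI[of _ r] exI[of _ "\<lambda>i j z. cofactor i j z / g z"] allI ballI)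
    show "(\<lambda>z. cofactor i j z / g z) holomorphic_on ball l r" for i j
      by (intro holomorphic_intros g holomorphic_on_subset[OF holomorphic_cofactor g(3)])
    fix z assume z: "z \<in> ball l r - {l}"
    then have nz: "det (A z) \<noteq> 0" using g(5,6)[of z] by auto
    then show "invertible (A z)" by (simp add: invertible_det_nz)
    show "z \<in> laplace_domain \<mu>" using z g(3) by (intro dom) auto
    show "cofactor i j z / g z = (z - l) ^ n * matrix_inv (A z) $ i $ j" for i j
      unfolding matrix_inv_A[OF nz] using g(5)[of z] z by auto
  qed (use g in auto)
  then have "?P (pole_order \<mu> l)" unfolding pole_order_def by (rule LeastI[of ?P])
  then show ?thesis by blast
qed

end

section \<open>Principal parts and their inverse transforms\<close>

text \<open>Laurent coefficients of the inverse, scaled by \<open>fact m\<close> so that they are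
  the coefficients of \<open>x ^ m * exp (l * x)\<close> after inversion. No abscissa
  \<open>\<sigma>\<close> occurs, so one choice of \<open>B\<close> serves every later
  \<open>\<sigma>\<close>.\<close>

definition principal_coefficients ::
    "('n::finite \<Rightarrow> 'n \<Rightarrow> real measure) \<Rightarrow> real \<Rightarrow> (complex \<Rightarrow> nat \<Rightarrow> complex^'n^'n) \<Rightarrow> bool" where
  "principal_coefficients \<mu> \<theta> B \<longleftrightarrow> (\<forall>l\<in>roots_gt \<mu> \<theta>. \<exists>r>0. \<exists>g. \<forall>i j. g i j holomorphic_on ball l r \<and>
     (\<forall>z\<in>ball l r - {l}. matrix_inv (mat 1 - laplace \<mu> z) $ i $ j =
        (\<Sum>m<pole_order \<mu> l. B l m $ i $ j * (fact m / (z - l) ^ (m + 1))) + g i j z))"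

text \<open>The exponential polynomial on \<open>{0..}\<close> whose Laplace transform is the sum of
  the principal parts; its integral over \<open>{..t}\<close> is the main term of
  \<open>U {..t}\<close>.\<close>

definition residue_density ::
    "('n::finite \<Rightarrow> 'n \<Rightarrow> real measure) \<Rightarrow> real \<Rightarrow> (complex \<Rightarrow> nat \<Rightarrow> complex^'n^'n) \<Rightarrow> 'n \<Rightarrow> 'n \<Rightarrow> real \<Rightarrow> complex" where
  "residue_density \<mu> \<theta> B i j x =
     (\<Sum>l\<in>roots_gt \<mu> \<theta>. \<Sum>m<pole_order \<mu> l. B l m $ i $ j * (indicator {0..} x *\<^sub>R (of_real x ^ m * exp (l * of_real x))))"

context renewal_strip begin

lemma principal_coefficients_exist: "\<exists>B. principal_coefficients \<mu> \<theta>\<^sub>0 B"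
proof -
  define P where "P l B \<longleftrightarrow> (\<exists>r>0. \<exists>g. \<forall>i j. g i j holomorphic_on ball l r \<and>
     (\<forall>z\<in>ball l r - {l}. matrix_inv (A z) $ i $ j =
        (\<Sum>m<pole_order \<mu> l. (B m :: complex^'n^'n) $ i $ j * (fact m / (z - l) ^ (m + 1))) + g i j z))" for l B
  have "\<exists>B. P l B"
    if l: "l \<in> roots_gt \<mu> \<theta>\<^sub>0" for l
  proof -
    define k where "k = pole_order \<mu> l"
    obtain r G where r: "r > 0" and G: "\<And>i j. (G i j :: complex \<Rightarrow> complex) holomorphic_on ball l r"
      "\<And>z i j. z \<in> ball l r - {l} \<Longrightarrow> G i j z = (z - l) ^ k * matrix_inv (A z) $ i $ j"
      using pole_order_spec[OF l] unfolding k_def by metis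
    have "\<forall>i j. \<exists>c g. g holomorphic_on ball l r \<and> (\<forall>z\<in>ball l r. G i j z = (\<Sum>m<k. c m * (z - l) ^ m) + (z - l) ^ k * g z)"
      using holomorphic_ball_taylor_remainder[OF G(1) r] by blast
    then obtain c g where cg: "\<And>i j. g i j holomorphic_on ball l r"
      "\<And>i j z. z \<in> ball l r \<Longrightarrow> G i j z = (\<Sum>m<k. c i j m * (z - l) ^ m) + (z - l) ^ k * g i j z"
      by metis
    \<comment> \<open>The coefficient of \<open>(z - l) ^ (-(m + 1))\<close> in the inverse is the
      Taylor coefficient of index \<open>k - 1 - m\<close> of \<open>(z - l) ^ k\<close> times the
      inverse.\<close>
    define B where "B m = (\<chi> i j. c i j (k - Suc m) / fact m)" for m
    have "matrix_inv (A z) $ i $ j = (\<Sum>m<k. B m $ i $ j * (fact m / (z - l) ^ (m + 1))) + g i j z"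
      if z: "z \<in> ball l r - {l}" for z i j
    proof -
      have z0: "z - l \<noteq> 0" using z by auto
      have "(z - l) ^ k * matrix_inv (A z) $ i $ j = (\<Sum>m<k. c i j m * (z - l) ^ m) + (z - l) ^ k * g i j z"
        using G(2)[OF z] cg(2)[of z i j] z by auto
      then have "matrix_inv (A z) $ i $ j = (\<Sum>m<k. c i j m * (z - l) ^ m) / (z - l) ^ k + g i j z"
        using z0 by (simp add: field_simps)
      also have "(\<Sum>m<k. c i j m * (z - l) ^ m) = (\<Sum>m<k. c i j (k - Suc m) * (z - l) ^ (k - Suc m))"
        by (rule sum.nat_diff_reindex[symmetric])
      also have "\<dots> / (z - l) ^ k = (\<Sum>m<k. B m $ i $ j * (fact m / (z - l) ^ (m + 1)))"
        unfolding sum_divide_distrib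
      proof (rule sum.cong[OF refl])
        fix m assume "m \<in> {..<k}"
        then have "(z - l) ^ k = (z - l) ^ (k - Suc m) * (z - l) ^ (m + 1)" by (simp add: power_add[symmetric] del: power_Suc)
        then show "c i j (k - Suc m) * (z - l) ^ (k - Suc m) / (z - l) ^ k = B m $ i $ j * (fact m / (z - l) ^ (m + 1))"
          using z0 by (simp add: B_def)
      qed
      finally show ?thesis .
    qed
    then show ?thesis using r cg(1) unfolding P_def k_def by blast
  qed
  then obtain B where "\<forall>l\<in>roots_gt \<mu> \<theta>\<^sub>0. P l (B l)" using bchoice[of "roots_gt \<mu> \<theta>\<^sub>0" P] by blast
  then show ?thesis unfolding principal_coefficients_def P_def by blast
qed

text \<open>At large height the inverse is bounded and all poles are at distance at least
  \<open>1\<close>; the remaining rectangle is compact. The strip starts at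
  \<open>a > \<theta>\<^sub>0\<close> so that this rectangle lies inside the open half-plane where
  \<open>H\<close> is holomorphic.\<close>

lemma inverse_minus_principal_part:
  assumes B: "principal_coefficients \<mu> \<theta>\<^sub>0 B" and a: "\<theta>\<^sub>0 < a"
  obtains H K where "H holomorphic_on {z. Re z > \<theta>\<^sub>0}" "\<And>z. a \<le> Re z \<Longrightarrow> Re z \<le> \<sigma> \<Longrightarrow> cmod (H z) \<le> K"
    "\<And>z. Re z \<ge> \<sigma> \<Longrightarrow> H z = matrix_inv (A z) $ i $ j -
       (\<Sum>l\<in>roots_gt \<mu> \<theta>\<^sub>0. \<Sum>m<pole_order \<mu> l. B l m $ i $ j * (fact m / (z - l) ^ (m + 1)))"
proof -
  let ?R = "roots_gt \<mu> \<theta>\<^sub>0" and ?S = "{z. Re z > \<theta>\<^sub>0}"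
  define p where "p l z = (\<Sum>m<pole_order \<mu> l. B l m $ i $ j * (fact m / (z - l) ^ (m + 1)))" for l z
  define \<phi> where "\<phi> z = matrix_inv (A z) $ i $ j - (\<Sum>l\<in>?R. p l z)" for z
  have RS: "?R \<subseteq> ?S" by (auto simp: roots_gt_def)
  have holp: "p l holomorphic_on T" if "l \<notin> T" for l T
    unfolding p_def by (intro holomorphic_intros) (use that in auto)
  have det0: "det (A z) \<noteq> 0" if "z \<in> ?S - ?R" for z using that by (auto simp: roots_gt_iff)
  have hol: "\<phi> holomorphic_on ?S - ?R"
  proof -
    have "(\<lambda>z. cofactor i j z / det (A z)) holomorphic_on ?S - ?R"
      by (intro holomorphic_intros holomorphic_on_subset[OF holomorphic_cofactor] holomorphic_on_subset[OF holomorphic_det] det0)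
        (use s in auto)
    then have "(\<lambda>z. matrix_inv (A z) $ i $ j) holomorphic_on ?S - ?R"
      by (rule holomorphic_transform) (simp add: matrix_inv_A[OF det0])
    then show ?thesis unfolding \<phi>_def by (intro holomorphic_intros holp) auto
  qed
  obtain H where H: "H holomorphic_on ?S" "\<And>z. z \<in> ?S - ?R \<Longrightarrow> H z = \<phi> z"
  proof (rule holomorphic_extension_finite[OF open_halfspace_Re_gt fin RS hol])
    fix l assume l: "l \<in> ?R"
    then obtain r g where rg: "r > 0" "g i j holomorphic_on ball l r"
      "\<And>z. z \<in> ball l r - {l} \<Longrightarrow> matrix_inv (A z) $ i $ j = p l z + g i j z"
    proof -
      obtain r g where "r > 0" "\<forall>i j. g i j holomorphic_on ball l r \<and>
        (\<forall>z\<in>ball l r - {l}. matrix_inv (A z) $ i $ j =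
          (\<Sum>m<pole_order \<mu> l. B l m $ i $ j * (fact m / (z - l) ^ (m + 1))) + g i j z)"
        using B l unfolding principal_coefficients_def by blast
      then show ?thesis using that[of r g] unfolding p_def by blast
    qed
    have "open (- (?R - {l}))" by (intro open_Compl finite_imp_closed finite_Diff fin)
    then obtain r' where r': "r' > 0" "ball l r' \<subseteq> - (?R - {l})" unfolding open_contains_ball by blast
    \<comment> \<open>At \<open>l\<close> its own principal part cancels against the inverse, and
      those of the other roots are holomorphic on a ball that avoids them.\<close>
    let ?g = "\<lambda>z. g i j z - (\<Sum>l'\<in>?R - {l}. p l' z)"
    have "?g holomorphic_on ball l (min r r')"
      by (intro holomorphic_intros holomorphic_on_subset[OF rg(2)] holp) (use r' in auto)
    moreover have "\<phi> z = ?g z" if "z \<in> ball l (min r r') - {l}" for z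
      using rg(3)[of z] that unfolding \<phi>_def by (simp add: sum.remove[OF fin l])
    ultimately show "\<exists>r>0. \<exists>g. g holomorphic_on ball l r \<and> (\<forall>z\<in>ball l r - {l}. \<phi> z = g z)"
      using rg(1) r'(1) by (intro exI[of _ "min r r'"] conjI exI[of _ ?g]) auto
  qed metis
  obtain C T where C: "\<And>z i j. \<theta>\<^sub>0 \<le> Re z \<Longrightarrow> Re z \<le> \<sigma> \<Longrightarrow> \<bar>Im z\<bar> \<ge> T \<Longrightarrow> cmod (matrix_inv (A z) $ i $ j) \<le> C"
    using inverse_bounded by metis
  \<comment> \<open>Above height \<open>Y\<close> every root is at distance at least
    \<open>1\<close>, so each pole term is bounded by its coefficient.\<close>
  define Y where "Y = (\<Sum>l\<in>?R. \<bar>Im l\<bar>) + 1"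
  have Y: "\<bar>Im l\<bar> + 1 \<le> Y" if "l \<in> ?R" for l
    using member_le_sum[OF that, of "\<lambda>l. \<bar>Im l\<bar>"] fin by (simp add: Y_def)
  define C' where "C' = (\<Sum>l\<in>?R. \<Sum>m<pole_order \<mu> l. cmod (B l m $ i $ j) * fact m)"
  define T' where "T' = max 1 (max T Y)"
  have far: "cmod (H z) \<le> C + C'" if z: "a \<le> Re z" "Re z \<le> \<sigma>" "\<bar>Im z\<bar> \<ge> T'" for z
  proof -
    have ge1: "cmod (z - l) \<ge> 1" if "l \<in> ?R" for l
    proof -
      have "\<bar>Im z - Im l\<bar> \<le> cmod (z - l)" using abs_Im_le_cmod[of "z - l"] by simp
      moreover have "\<bar>Im z\<bar> \<ge> Y" using z(3) by (simp add: T'_def)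
      ultimately show ?thesis using Y[OF that] by linarith
    qed
    then have "z \<notin> ?R" by fastforce
    then have Hz: "H z = \<phi> z" using H(2)[of z] z a by auto
    have "cmod (\<phi> z) \<le> cmod (matrix_inv (A z) $ i $ j) + cmod (\<Sum>l\<in>?R. p l z)"
      unfolding \<phi>_def by (rule norm_triangle_ineq4)
    moreover have "cmod (matrix_inv (A z) $ i $ j) \<le> C" using C[of z i j] z a by (simp add: T'_def)
    moreover have "cmod (\<Sum>l\<in>?R. p l z) \<le> C'"
      unfolding C'_def p_def
    proof (intro sum_norm_le)
      fix l m assume l: "l \<in> ?R"
      have "1 \<le> cmod (z - l) ^ (m + 1)" using ge1[OF l] by (rule one_le_power)
      then have "cmod (B l m $ i $ j) * fact m / cmod (z - l) ^ (m + 1) \<le> cmod (B l m $ i $ j) * fact m / 1"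
        by (intro divide_left_mono) auto
      then show "cmod (B l m $ i $ j * (fact m / (z - l) ^ (m + 1))) \<le> cmod (B l m $ i $ j) * fact m"
        by (simp add: norm_mult norm_divide norm_power)
    qed
    ultimately show ?thesis unfolding Hz by linarith
  qed
  let ?C = "cbox (Complex a (-T')) (Complex \<sigma> T')"
  have "?C \<subseteq> ?S" using a by (auto simp: in_cbox_complex_iff)
  then have "compact (H ` ?C)"
    by (intro compact_continuous_image compact_cbox holomorphic_on_imp_continuous_on holomorphic_on_subset[OF H(1)])
  then have "bounded (H ` ?C)" by (rule compact_imp_bounded)
  then obtain K where "\<forall>x\<in>H ` ?C. cmod x \<le> K" unfolding bounded_iff by (rule exE)
  then have K: "cmod (H z) \<le> K" if "z \<in> ?C" for z using that by (rule bspec[OF _ imageI])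
  show ?thesis
  proof (rule that[of H "max K (C + C')"])
    show "H holomorphic_on ?S" by (rule H)
    show "cmod (H z) \<le> max K (C + C')" if "a \<le> Re z" "Re z \<le> \<sigma>" for z
    proof (cases "\<bar>Im z\<bar> \<ge> T'")
      case True
      then show ?thesis using far that by fastforce
    next
      case False
      then have "z \<in> ?C" using that by (auto simp: in_cbox_complex_iff)
      from K[OF this] show ?thesis by simp
    qed
    show "H z = matrix_inv (A z) $ i $ j - (\<Sum>l\<in>?R. \<Sum>m<pole_order \<mu> l. B l m $ i $ j * (fact m / (z - l) ^ (m + 1)))"
      if "Re z \<ge> \<sigma>" for z
    proof -
      have "z \<in> ?S - ?R" using that s roots_gt_less[of z] by auto
      from H(2)[OF this] show ?thesis unfolding \<phi>_def p_def .
    qed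
  qed
qed

lemma laplace_residue_density:
  assumes z: "Re z \<ge> \<sigma>"
  shows "(LINT x|lborel. exp (- z * complex_of_real x) * residue_density \<mu> \<theta>\<^sub>0 B i j x) =
    (\<Sum>l\<in>roots_gt \<mu> \<theta>\<^sub>0. \<Sum>m<pole_order \<mu> l. B l m $ i $ j * (fact m / (z - l) ^ (m + 1)))"
proof -
  let ?h = "\<lambda>l m x. indicator {0..} x *\<^sub>R (of_real x ^ m * exp (- (z - l) * of_real x)) :: complex"
  have re: "Re (z - l) > 0" if "l \<in> roots_gt \<mu> \<theta>\<^sub>0" for l using roots_gt_less[OF that] z by simp
  have int: "integrable lborel (?h l m)" if "l \<in> roots_gt \<mu> \<theta>\<^sub>0" for l m
    using integrable_power_times_exp[OF re[OF that], of m] unfolding set_integrable_def .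
  have "exp (- z * complex_of_real x) * residue_density \<mu> \<theta>\<^sub>0 B i j x =
     (\<Sum>l\<in>roots_gt \<mu> \<theta>\<^sub>0. \<Sum>m<pole_order \<mu> l. B l m $ i $ j * ?h l m x)" for x
  proof -
    have e: "exp (- (z - l) * of_real x) = exp (- z * of_real x) * exp (l * of_real x)" for l
      unfolding exp_add[symmetric] by (simp add: algebra_simps)
    show ?thesis unfolding residue_density_def e sum_distrib_left
      by (intro sum.cong refl) (simp add: scaleR_conv_of_real mult_ac)
  qed
  then have "(LINT x|lborel. exp (- z * complex_of_real x) * residue_density \<mu> \<theta>\<^sub>0 B i j x) =
     (LINT x|lborel. (\<Sum>l\<in>roots_gt \<mu> \<theta>\<^sub>0. \<Sum>m<pole_order \<mu> l. B l m $ i $ j * ?h l m x))" by (simp only:)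
  also have "\<dots> = (\<Sum>l\<in>roots_gt \<mu> \<theta>\<^sub>0. LINT x|lborel. (\<Sum>m<pole_order \<mu> l. B l m $ i $ j * ?h l m x))"
    by (intro Bochner_Integration.integral_sum Bochner_Integration.integrable_sum integrable_mult_right int)
  also have "\<dots> = (\<Sum>l\<in>roots_gt \<mu> \<theta>\<^sub>0. \<Sum>m<pole_order \<mu> l. LINT x|lborel. B l m $ i $ j * ?h l m x)"
    by (intro sum.cong refl Bochner_Integration.integral_sum integrable_mult_right int)
  also have "\<dots> = (\<Sum>l\<in>roots_gt \<mu> \<theta>\<^sub>0. \<Sum>m<pole_order \<mu> l. B l m $ i $ j * (fact m / (z - l) ^ (m + 1)))"
    unfolding Bochner_Integration.integral_mult_right_zero
    by (intro sum.cong refl arg_cong[where f="\<lambda>w. _ * w"]) (use integral_power_times_exp[OF re] in \<open>simp add: set_lebesgue_integral_def\<close>)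
  finally show ?thesis .
qed

lemma residue_density_bound:
  assumes \<beta>: "\<And>l. l \<in> roots_gt \<mu> \<theta>\<^sub>0 \<Longrightarrow> Re l < \<beta>"
  obtains C where "\<And>x. x \<ge> 0 \<Longrightarrow> cmod (residue_density \<mu> \<theta>\<^sub>0 B i j x) \<le> C * exp (\<beta> * x)"
proof
  let ?C = "\<Sum>l\<in>roots_gt \<mu> \<theta>\<^sub>0. \<Sum>m<pole_order \<mu> l. cmod (B l m $ i $ j) * (fact m / (\<beta> - Re l) ^ m)"
  fix x :: real assume x: "x \<ge> 0"
  show "cmod (residue_density \<mu> \<theta>\<^sub>0 B i j x) \<le> ?C * exp (\<beta> * x)"
    unfolding residue_density_def sum_distrib_right
  proof (intro sum_norm_le)
    fix l m assume l: "l \<in> roots_gt \<mu> \<theta>\<^sub>0"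
    have "x ^ m * exp (Re l * x) \<le> fact m / (\<beta> - Re l) ^ m * exp ((\<beta> - Re l) * x) * exp (Re l * x)"
      using \<beta>[OF l] x by (intro mult_right_mono power_le_exp) auto
    also have "\<dots> = fact m / (\<beta> - Re l) ^ m * exp (\<beta> * x)" by (simp add: mult.assoc exp_add[symmetric] algebra_simps)
    finally have "cmod (B l m $ i $ j) * (x ^ m * exp (Re l * x)) \<le> cmod (B l m $ i $ j) * (fact m / (\<beta> - Re l) ^ m * exp (\<beta> * x))"
      by (intro mult_left_mono) auto
    then show "cmod (B l m $ i $ j * (indicator {0..} x *\<^sub>R (of_real x ^ m * exp (l * of_real x)))) \<le> cmod (B l m $ i $ j) * (fact m / (\<beta> - Re l) ^ m) * exp (\<beta> * x)"
      using x by (simp add: norm_mult norm_power norm_exp_eq_Re mult_ac)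
  qed
qed

lemma residue_density_measurable [measurable]: "residue_density \<mu> \<theta> B i j \<in> borel_measurable borel"
  unfolding residue_density_def[abs_def] by measurable

lemma renewal_function_asymptotics:
  assumes B: "principal_coefficients \<mu> \<theta>\<^sub>0 B" and \<theta>: "\<theta>\<^sub>0 < \<theta>" "0 < \<theta>" "\<theta> < \<sigma>"
  obtains C where "\<And>t. t \<ge> 0 \<Longrightarrow>
    cmod (of_real (measure (U i j) {..t}) - (LINT x|lborel. indicator {..t} x *\<^sub>R residue_density \<mu> \<theta>\<^sub>0 B i j x)) \<le> C * exp (\<theta> * t)"
proof -
  \<comment> \<open>The new line lies to the right of \<open>\<theta>\<^sub>0\<close>, where
    \<open>H\<close> is holomorphic, and to the right of \<open>0\<close>, the pole of
    \<open>1 / z^2\<close>.\<close>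
  define a where "a = (max \<theta>\<^sub>0 0 + \<theta>) / 2"
  have a: "0 < a" "\<theta>\<^sub>0 < a" "a < \<theta>" using \<theta> by (auto simp: a_def)
  \<comment> \<open>Inserting \<open>\<theta>\<close> makes the maximum meaningful when there are no
    roots and places \<open>\<beta>\<close> above \<open>\<theta>\<close> as well as above all real
    parts.\<close>
  define m where "m = Max (insert \<theta> (Re ` roots_gt \<mu> \<theta>\<^sub>0))"
  have m: "m < \<sigma>" "\<theta> \<le> m" "\<And>l. l \<in> roots_gt \<mu> \<theta>\<^sub>0 \<Longrightarrow> Re l \<le> m"
    using fin \<theta> roots_gt_less by (auto simp: m_def)
  define \<beta> where "\<beta> = (m + \<sigma>) / 2"
  have \<beta>: "\<theta> < \<beta>" "\<beta> < \<sigma>" using m(1,2) by (auto simp: \<beta>_def)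
  have \<beta>R: "Re l < \<beta>" if "l \<in> roots_gt \<mu> \<theta>\<^sub>0" for l using m(1) m(3)[OF that] by (simp add: \<beta>_def)
  obtain CQ where CQ: "\<And>x. x \<ge> 0 \<Longrightarrow> cmod (residue_density \<mu> \<theta>\<^sub>0 B i j x) \<le> CQ * exp (\<beta> * x)"
  proof (rule residue_density_bound[OF \<beta>R, of B i j])
    fix C assume "\<And>x. 0 \<le> x \<Longrightarrow> cmod (residue_density \<mu> \<theta>\<^sub>0 B i j x) \<le> C * exp (\<beta> * x)"
    then show thesis by (rule that)
  qed
  obtain H K where H: "H holomorphic_on {z. Re z > \<theta>\<^sub>0}" "\<And>z. a \<le> Re z \<Longrightarrow> Re z \<le> \<sigma> \<Longrightarrow> cmod (H z) \<le> K"
    "\<And>z. Re z \<ge> \<sigma> \<Longrightarrow> H z = matrix_inv (A z) $ i $ j -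
       (\<Sum>l\<in>roots_gt \<mu> \<theta>\<^sub>0. \<Sum>m<pole_order \<mu> l. B l m $ i $ j * (fact m / (z - l) ^ (m + 1)))"
  proof (rule inverse_minus_principal_part[OF B a(2), of i j])
    fix H K
    assume 1: "H holomorphic_on {z. Re z > \<theta>\<^sub>0}" and 2: "\<And>z. a \<le> Re z \<Longrightarrow> Re z \<le> \<sigma> \<Longrightarrow> cmod (H z) \<le> K"
      and 3: "\<And>z. Re z \<ge> \<sigma> \<Longrightarrow> H z = matrix_inv (A z) $ i $ j -
       (\<Sum>l\<in>roots_gt \<mu> \<theta>\<^sub>0. \<Sum>m<pole_order \<mu> l. B l m $ i $ j * (fact m / (z - l) ^ (m + 1)))"
    show thesis by (rule that[OF 1 2 3])
  qed
  show ?thesis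
  proof (rule cumulative_asymptotics[OF sets_renewal_measure sigma_finite_U U_exp_integrable residue_density_measurable _ CQ a \<beta> H(1,2)])
    show "residue_density \<mu> \<theta>\<^sub>0 B i j x = 0" if "x < 0" for x using that by (simp add: residue_density_def)
    show "H (Complex \<sigma> y) = (LINT x|U i j. exp (- Complex \<sigma> y * of_real x)) -
       (LINT x|lborel. exp (- Complex \<sigma> y * of_real x) * residue_density \<mu> \<theta>\<^sub>0 B i j x)" for y
      using H(3)[of "Complex \<sigma> y"] laplace_residue_density[of "Complex \<sigma> y" B i j] matrix_inv_eq_laplace_U(1)[of "Complex \<sigma> y"]
      by (simp add: laplace_U_def)
  next
    fix C
    assume "\<And>t. 0 \<le> t \<Longrightarrow> cmod (complex_of_real (measure (U i j) {..t}) -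
        (LINT x|lborel. indicat_real {..t} x *\<^sub>R residue_density \<mu> \<theta>\<^sub>0 B i j x)) \<le> C * exp (\<theta> * t)"
    then show thesis by (rule that)
  qed
qed

end

section \<open>Functions of bounded variation\<close>

text \<open>Distribution functions of measures on \<open>{0..}\<close>. For
  \<open>\<theta> > 0\<close> the integral condition amounts, by partial integration, to a finite
  exponential moment of rate \<open>\<theta>\<close> of that measure.\<close>

definition tempered_increasing :: "real \<Rightarrow> (real \<Rightarrow> real) \<Rightarrow> bool" where
  "tempered_increasing \<theta> g \<longleftrightarrow> mono g \<and> (\<forall>a. continuous (at_right a) g) \<and> (\<forall>x<0. g x = 0) \<and>
     (\<integral>\<^sup>+x\<in>{0..}. ennreal (exp (- \<theta> * x) * g x) \<partial>lborel) < \<infinity>"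

lemma tempered_increasing_measurable: "tempered_increasing \<theta> g \<Longrightarrow> g \<in> borel_measurable borel"
  by (auto simp: tempered_increasing_def intro: borel_measurable_mono)

lemma tempered_increasing_nonneg:
  assumes "tempered_increasing \<theta> g" shows "g x \<ge> 0"
proof -
  have m: "mono g" "\<forall>x<0. g x = 0" using assms by (simp_all add: tempered_increasing_def)
  have "g (min x (-1)) = 0" using m(2) by simp
  moreover have "g (min x (-1)) \<le> g x" by (rule monoD[OF m(1)]) simp
  ultimately show ?thesis by simp
qed

context
  fixes g :: "real \<Rightarrow> real" and \<theta> :: real
  assumes g: "tempered_increasing \<theta> g" and \<theta>: "\<theta> > 0"
begin

lemma tempered_increasing_monoD: "x \<le> y \<Longrightarrow> g x \<le> g y" and tempered_increasing_right_continuous: "continuous (at_right a) g" and tempered_increasing_neg: "x < 0 \<Longrightarrow> g x = 0"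
  using g by (auto simp: tempered_increasing_def mono_def)

lemma emeasure_stieltjes: "emeasure (interval_measure g) {..x} = ennreal (g x)"
proof (rule emeasure_interval_measure_Iic[OF tempered_increasing_monoD tempered_increasing_right_continuous])
  show "(g \<longlongrightarrow> 0) at_bot"
    by (rule tendsto_eventually) (auto simp: eventually_at_bot_dense tempered_increasing_neg intro!: exI[of _ 0])
qed

lemma measure_stieltjes: "measure (interval_measure g) {..x} = g x"
  by (simp add: measure_def emeasure_stieltjes tempered_increasing_nonneg[OF g])

lemma sigma_finite_stieltjes: "sigma_finite_measure (interval_measure g)"
  by (rule sigma_finite_interval_measure[OF tempered_increasing_monoD tempered_increasing_right_continuous])

text \<open>Writing \<open>exp (- \<theta> * y)\<close> as the integral of
  \<open>\<theta> * exp (- \<theta> * x)\<close> over \<open>x \<ge> y\<close> and exchanging the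
  order turns the moment into \<open>\<theta>\<close> times the integral of
  \<open>exp (- \<theta> * x) * g x\<close>.\<close>

lemma stieltjes_exp_integrable: "integrable (interval_measure g) (\<lambda>y. exp (- \<theta> * y))"
proof (rule integrableI_nonneg)
  note [measurable] = tempered_increasing_measurable[OF g]
  interpret N: sigma_finite_measure "interval_measure g" by (rule sigma_finite_stieltjes)
  interpret P: pair_sigma_finite "interval_measure g" lborel ..
  have e: "(\<integral>\<^sup>+x. ennreal (\<theta> * exp (- \<theta> * x)) * indicator {y..} x \<partial>lborel) = ennreal (exp (- \<theta> * y))" for y
  proof -
    have "(\<integral>\<^sup>+x. ennreal (\<theta> * exp (- \<theta> * x)) * indicator {y..} x \<partial>lborel) = ennreal (0 - (- exp (- \<theta> * y)))"
    proof (rule nn_integral_FTC_atLeast)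
      show "((\<lambda>x. - exp (- \<theta> * x)) \<longlongrightarrow> 0) at_top" using \<theta> by real_asymp
      show "DERIV (\<lambda>x. - exp (- \<theta> * x)) x :> \<theta> * exp (- \<theta> * x)" for x
        by (auto intro!: derivative_eq_intros)
    qed (use \<theta> in auto)
    then show ?thesis by simp
  qed
  have sw: "indicator {y..} x = (indicator {..x} y :: ennreal)" for x y :: real by (auto split: split_indicator)
  have "(\<integral>\<^sup>+y. ennreal (exp (- \<theta> * y)) \<partial>interval_measure g) =
      (\<integral>\<^sup>+y. \<integral>\<^sup>+x. ennreal (\<theta> * exp (- \<theta> * x)) * indicator {..x} y \<partial>lborel \<partial>interval_measure g)"
    unfolding e[symmetric] sw ..
  also have "\<dots> = (\<integral>\<^sup>+x. \<integral>\<^sup>+y. ennreal (\<theta> * exp (- \<theta> * x)) * indicator {..x} y \<partial>interval_measure g \<partial>lborel)"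
  proof (rule P.Fubini'[symmetric])
    have "(\<lambda>(y, x). ennreal (\<theta> * exp (- \<theta> * x)) * indicator {..x} y) = (\<lambda>p. ennreal (\<theta> * exp (- \<theta> * snd p)) * indicator {p. fst p \<le> snd p} p)"
      by (auto simp: fun_eq_iff split: split_indicator)
    then show "(\<lambda>(y, x). ennreal (\<theta> * exp (- \<theta> * x)) * indicator {..x} y) \<in> borel_measurable (interval_measure g \<Otimes>\<^sub>M lborel)"
      by simp
  qed
  also have "\<dots> = (\<integral>\<^sup>+x. ennreal (\<theta> * exp (- \<theta> * x)) * ennreal (g x) \<partial>lborel)"
    by (intro nn_integral_cong) (simp add: nn_integral_cmult emeasure_stieltjes)
  also have "\<dots> = (\<integral>\<^sup>+x. ennreal \<theta> * (ennreal (exp (- \<theta> * x) * g x) * indicator {0..} x) \<partial>lborel)"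
    by (intro nn_integral_cong) (use \<theta> tempered_increasing_nonneg[OF g] tempered_increasing_neg in \<open>auto simp: ennreal_mult'[symmetric] mult.assoc split: split_indicator\<close>)
  also have "\<dots> = ennreal \<theta> * (\<integral>\<^sup>+x\<in>{0..}. ennreal (exp (- \<theta> * x) * g x) \<partial>lborel)"
    by (rule nn_integral_cmult) simp
  also have "\<dots> < \<infinity>" using g by (simp add: tempered_increasing_def ennreal_mult_less_top)
  finally show "(\<integral>\<^sup>+y. ennreal (exp (- \<theta> * y)) \<partial>interval_measure g) < \<infinity>" .
qed auto

text \<open>Markov's inequality for the weight \<open>exp (- \<theta> * y)\<close> on
  \<open>{..x}\<close>. It extracts a pointwise growth bound from an integral condition.\<close>

lemma tempered_increasing_le: "g x \<le> (LINT y|interval_measure g. exp (- \<theta> * y)) * exp (\<theta> * x)"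
proof -
  have i: "integrable (interval_measure g) (indicator {..x} :: real \<Rightarrow> real)"
    by (rule integrable_real_indicator) (auto simp: emeasure_stieltjes)
  have "g x = (LINT y|interval_measure g. indicator {..x} y)" by (simp add: measure_stieltjes)
  also have "\<dots> \<le> (LINT y|interval_measure g. exp (- \<theta> * y) * exp (\<theta> * x))"
    using \<theta> by (intro integral_mono i integrable_mult_left stieltjes_exp_integrable)
      (auto simp: exp_add[symmetric] split: split_indicator)
  finally show ?thesis by simp
qed

text \<open>Writing \<open>g (t - x)\<close> as the mass of \<open>{..t - x}\<close>, both sides are the integral of \<open>q x\<close> over
  \<open>x + y \<le> t\<close> with respect to the product measure.\<close>
lemma stieltjes_convolution:
  fixes M :: "real measure" and q :: "real \<Rightarrow> complex"
  assumes sM[measurable_cong]: "sets M = sets borel" and sf: "sigma_finite_measure M" and [measurable]: "q \<in> borel_measurable borel"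
    and supp: "AE x in M. x < 0 \<longrightarrow> q x = 0" and int: "integrable M (\<lambda>x. indicator {..t} x *\<^sub>R q x)"
  shows "(LINT x|M. of_real (g (t - x)) * q x) = (LINT y|interval_measure g. LINT x|M. indicator {..t - y} x *\<^sub>R q x)"
    and "integrable (interval_measure g) (\<lambda>y. LINT x|M. indicator {..t - y} x *\<^sub>R q x)"
    and "integrable M (\<lambda>x. of_real (g (t - x)) * q x)"
proof -
  note [measurable] = tempered_increasing_measurable[OF g]
  interpret M: sigma_finite_measure M by (rule sf)
  interpret N: sigma_finite_measure "interval_measure g" by (rule sigma_finite_stieltjes)
  interpret P: pair_sigma_finite M "interval_measure g" ..
  have sw: "indicator {..t - x} y = (indicator {..t - y} x :: real)" for x y by (auto split: split_indicator)
  have i: "integrable (interval_measure g) (indicator {..u} :: real \<Rightarrow> real)" for u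
    by (rule integrable_real_indicator) (auto simp: emeasure_stieltjes)
  have inner: "(LINT y|interval_measure g. indicator {..t - x} y *\<^sub>R q x) = of_real (g (t - x)) * q x" for x
    using i[of "t - x"] by (simp add: measure_stieltjes scaleR_conv_of_real)
  have bnd: "AE x in M. cmod (of_real (g (t - x)) * q x) \<le> g t * cmod (indicator {..t} x *\<^sub>R q x)"
    using supp
  proof eventually_elim
    case (elim x)
    consider "x < 0" | "0 \<le> x" "x \<le> t" | "x > t" by linarith
    then show ?case
    proof cases
      case 1
      then show ?thesis using elim by simp
    next
      case 2
      then show ?thesis using tempered_increasing_monoD[of "t - x" t] tempered_increasing_nonneg[OF g] by (simp add: norm_mult mult_right_mono)
    next
      case 3
      then show ?thesis using tempered_increasing_neg[of "t - x"] by simp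
    qed
  qed
  show gi: "integrable M (\<lambda>x. of_real (g (t - x)) * q x)"
    by (rule Bochner_Integration.integrable_bound[OF integrable_mult_right[OF integrable_norm[OF int], of "g t"]])
      (use bnd tempered_increasing_nonneg[OF g] in \<open>auto elim!: eventually_mono\<close>)
  have meas: "(\<lambda>(x, y). indicator {..t - x} y *\<^sub>R q x) \<in> borel_measurable (M \<Otimes>\<^sub>M interval_measure g)"
  proof -
    have "(\<lambda>(x, y). indicator {..t - x} y *\<^sub>R q x) = (\<lambda>p. indicator {p. snd p \<le> t - fst p} p *\<^sub>R q (fst p))"
      by (auto simp: fun_eq_iff split: split_indicator)
    then show ?thesis by simp
  qed
  have pint: "integrable (M \<Otimes>\<^sub>M interval_measure g) (\<lambda>(x, y). indicator {..t - x} y *\<^sub>R q x)"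
  proof (rule P.Fubini_integrable[OF meas])
    have "(LINT y|interval_measure g. norm (case (x, y) of (x, y) \<Rightarrow> indicator {..t - x} y *\<^sub>R q x)) = norm (of_real (g (t - x)) * q x)" for x
      using i[of "t - x"] by (simp add: measure_stieltjes norm_mult tempered_increasing_nonneg[OF g])
    then show "integrable M (\<lambda>x. LINT y|interval_measure g. norm (case (x, y) of (x, y) \<Rightarrow> indicator {..t - x} y *\<^sub>R q x))"
      using integrable_norm[OF gi] by simp
    show "AE x in M. integrable (interval_measure g) (\<lambda>y. case (x, y) of (x, y) \<Rightarrow> indicator {..t - x} y *\<^sub>R q x)"
      using i by auto
  qed
  show "(LINT x|M. of_real (g (t - x)) * q x) = (LINT y|interval_measure g. LINT x|M. indicator {..t - y} x *\<^sub>R q x)"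
    using P.Fubini_integral[of "\<lambda>x y. indicator {..t - x} y *\<^sub>R q x", OF pint] unfolding inner by (simp add: sw)
  show "integrable (interval_measure g) (\<lambda>y. LINT x|M. indicator {..t - y} x *\<^sub>R q x)"
    using P.integrable_snd[OF pint] by (simp add: sw)
qed

text \<open>The error of the cumulative mass at \<open>t - y\<close> is at most
  \<open>C * exp (\<theta> * t) * exp (- \<theta> * y)\<close>, and the last factor is integrable
  against the Stieltjes measure of \<open>g\<close>. No rate is lost.\<close>

lemma stieltjes_convolution_bound:
  fixes U :: "real measure" and Q :: "real \<Rightarrow> complex"
  assumes sU: "sets U = sets borel" and sf: "sigma_finite_measure U" and Un: "AE x in U. x \<ge> 0"
    and intU: "\<And>t. integrable U (indicator {..t} :: real \<Rightarrow> real)"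
    and Q: "Q \<in> borel_measurable borel" and Q0: "\<And>x. x < 0 \<Longrightarrow> Q x = 0" and intQ: "\<And>t. integrable lborel (\<lambda>x. indicator {..t} x *\<^sub>R Q x)"
    and C: "\<And>t. t \<ge> 0 \<Longrightarrow> cmod (of_real (measure U {..t}) - (LINT x|lborel. indicator {..t} x *\<^sub>R Q x)) \<le> C * exp (\<theta> * t)"
  shows "cmod (of_real (LINT x|U. g (t - x)) - (LINT x|lborel. of_real (g (t - x)) * Q x))
     \<le> C * (LINT y|interval_measure g. exp (- \<theta> * y)) * exp (\<theta> * t)"
proof -
  have C0: "C \<ge> 0" using order_trans[OF norm_ge_zero C[of 0]] by simp
  have ind: "(\<lambda>x. indicator {..t} x *\<^sub>R (1::complex)) = (\<lambda>x. complex_of_real (indicator {..t} x))" for t :: real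
    by (simp add: scaleR_conv_of_real)
  have iU: "integrable U (\<lambda>x. indicator {..t} x *\<^sub>R (1::complex))" for t
    unfolding ind by (rule integrable_of_real[OF intU])
  have sp: "space U = UNIV" using sets_eq_imp_space_eq[OF sU] by simp
  have N: "(LINT x|U. indicator {..t} x *\<^sub>R (1::complex)) = of_real (measure U {..t})" for t
    unfolding ind integral_complex_of_real by (simp add: sp)
  note U1 = stieltjes_convolution[OF sU sf _ _ iU, of t, unfolded N]
  have "AE x in U. x < 0 \<longrightarrow> (1::complex) = 0" using Un by eventually_elim auto
  note U1 = U1[OF borel_measurable_const this]
  note Q1 = stieltjes_convolution[OF sets_lborel lborel.sigma_finite_measure_axioms Q _ intQ, of t]
  have "AE x in lborel. x < 0 \<longrightarrow> Q x = 0" using Q0 by auto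
  note Q1 = Q1[OF this]
  \<comment> \<open>For large \<open>y\<close> the argument \<open>t - y\<close> is negative; there
    both the mass and the integral of \<open>Q\<close> vanish.\<close>
  have pt: "cmod (of_real (measure U {..u}) - (LINT x|lborel. indicator {..u} x *\<^sub>R Q x)) \<le> C * exp (\<theta> * u)" for u
  proof (cases "u \<ge> 0")
    case False
    have z: "indicator {..u} x *\<^sub>R Q x = 0" for x using False Q0[of x] by (auto split: split_indicator)
    have "(LINT x|lborel. indicator {..u} x *\<^sub>R Q x) = 0" unfolding z by simp
    moreover have "AE x in U. \<not> x \<le> u" using Un by eventually_elim (use False in auto)
    then have "emeasure U {..u} = 0"
      using AE_iff_measurable[of "{..u}" U "\<lambda>x. \<not> x \<le> u"] sU sp by (auto simp: atMost_def)
    ultimately show ?thesis using C0 by (simp add: measure_def)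
  qed (rule C)
  have "of_real (LINT x|U. g (t - x)) = (LINT x|U. complex_of_real (g (t - x)) * 1)"
    by (simp add: integral_complex_of_real)
  then have "of_real (LINT x|U. g (t - x)) - (LINT x|lborel. of_real (g (t - x)) * Q x) =
     (LINT y|interval_measure g. of_real (measure U {..t - y}) - (LINT x|lborel. indicator {..t - y} x *\<^sub>R Q x))"
    unfolding U1(1) Q1(1) using Bochner_Integration.integral_diff[OF U1(2) Q1(2)] by simp
  also have "cmod \<dots> \<le> (LINT y|interval_measure g. C * exp (\<theta> * t) * exp (- \<theta> * y))"
  proof (rule Bochner_Integration.integral_norm_bound_integral)
    show "integrable (interval_measure g) (\<lambda>y. of_real (measure U {..t - y}) - (LINT x|lborel. indicator {..t - y} x *\<^sub>R Q x))"
      by (rule Bochner_Integration.integrable_diff[OF U1(2) Q1(2)])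
    show "integrable (interval_measure g) (\<lambda>y. C * exp (\<theta> * t) * exp (- \<theta> * y))"
      by (rule integrable_mult_right) (rule stieltjes_exp_integrable)
    fix y
    have e: "C * exp (\<theta> * (t - y)) = C * exp (\<theta> * t) * exp (- \<theta> * y)" by (simp add: mult.assoc exp_add[symmetric] algebra_simps)
    show "cmod (of_real (measure U {..t - y}) - (LINT x|lborel. indicator {..t - y} x *\<^sub>R Q x)) \<le> C * exp (\<theta> * t) * exp (- \<theta> * y)"
      using pt[of "t - y"] unfolding e .
  qed
  finally show ?thesis by (simp add: mult_ac)
qed

end

section \<open>Total variation and decomposition into increasing functions\<close>

lemma total_variation_mono: "x \<le> y \<Longrightarrow> total_variation f x \<le> total_variation f y"
  unfolding total_variation_def by (rule SUP_subset_mono) auto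

lemma total_variation_upper:
  fixes n :: nat
  assumes "1 \<le> n" "strict_mono_on {0..n} xs" "xs n \<le> x"
  shows "(\<Sum>j=1..n. ennreal \<bar>f (xs j) - f (xs (j - 1))\<bar>) \<le> total_variation f x"
  unfolding total_variation_def
  by (rule Sup_upper, rule image_eqI[where x="(n, xs)"]) (use assms in simp_all)

lemma chain_extend:
  fixes xs :: "nat \<Rightarrow> real"
  assumes "strict_mono_on {0..n} xs" "xs n < y"
  shows "strict_mono_on {0..Suc n} (xs(Suc n := y))"
    and "(\<Sum>j=1..Suc n. ennreal \<bar>f ((xs(Suc n := y)) j) - f ((xs(Suc n := y)) (j - 1))\<bar>) =
      (\<Sum>j=1..n. ennreal \<bar>f (xs j) - f (xs (j - 1))\<bar>) + ennreal \<bar>f y - f (xs n)\<bar>"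
proof -
  have le: "xs r \<le> xs n" if "r \<le> n" for r
    using assms(1) that unfolding strict_mono_on_def by (cases "r = n") (auto intro: less_imp_le)
  show "strict_mono_on {0..Suc n} (xs(Suc n := y))"
    unfolding strict_mono_on_def
  proof (intro allI impI)
    fix r k :: nat assume "r \<in> {0..Suc n} \<and> k \<in> {0..Suc n} \<and> r < k"
    then show "(xs(Suc n := y)) r < (xs(Suc n := y)) k"
      using assms le[of r] unfolding strict_mono_on_def by (cases "k = Suc n") (auto intro: le_less_trans)
  qed
  have "(\<Sum>j=1..n. ennreal \<bar>f ((xs(Suc n := y)) j) - f ((xs(Suc n := y)) (j - 1))\<bar>) = (\<Sum>j=1..n. ennreal \<bar>f (xs j) - f (xs (j - 1))\<bar>)"
    by (intro sum.cong refl) auto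
  then show "(\<Sum>j=1..Suc n. ennreal \<bar>f ((xs(Suc n := y)) j) - f ((xs(Suc n := y)) (j - 1))\<bar>) =
      (\<Sum>j=1..n. ennreal \<bar>f (xs j) - f (xs (j - 1))\<bar>) + ennreal \<bar>f y - f (xs n)\<bar>"
    by simp
qed

text \<open>Every chain ending at or before \<open>x\<close> can be continued through
  \<open>x\<close> to \<open>y\<close>, which adds the increment from \<open>x\<close> to
  \<open>y\<close>.\<close>

lemma total_variation_add:
  assumes xy: "x < y"
  shows "total_variation f x + ennreal \<bar>f y - f x\<bar> \<le> total_variation f y"
proof -
  let ?I = "{(n, xs :: nat \<Rightarrow> real). 1 \<le> n \<and> strict_mono_on {0..n} xs \<and> xs n \<le> x}"
  have "(1, \<lambda>k. x - 1 + real k) \<in> ?I" by (auto simp: strict_mono_on_def)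
  then have ne: "?I \<noteq> {}" by blast
  have "total_variation f x + ennreal \<bar>f y - f x\<bar> =
     (SUP p\<in>?I. (case p of (n, xs) \<Rightarrow> \<Sum>j=1..n. ennreal \<bar>f (xs j) - f (xs (j - 1))\<bar>) + ennreal \<bar>f y - f x\<bar>)"
    unfolding total_variation_def by (rule ennreal_SUP_add_left[OF ne, symmetric])
  also have "\<dots> \<le> total_variation f y"
  proof (rule SUP_least)
    fix p assume "p \<in> ?I"
    then obtain n xs where p: "p = (n, xs)" "1 \<le> n" "strict_mono_on {0..n} xs" "xs n \<le> x" by auto
    let ?S = "\<Sum>j=1..n. ennreal \<bar>f (xs j) - f (xs (j - 1))\<bar>"
    have "?S + ennreal \<bar>f y - f x\<bar> \<le> total_variation f y"
    proof (cases "xs n = x")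
      \<comment> \<open>Chains are strictly increasing, so \<open>x\<close> may be appended only if
        the chain does not already end there.\<close>
      case True
      have "?S + ennreal \<bar>f y - f x\<bar> = (\<Sum>j=1..Suc n. ennreal \<bar>f ((xs(Suc n := y)) j) - f ((xs(Suc n := y)) (j - 1))\<bar>)"
        using chain_extend(2)[OF p(3), of y f] True xy by simp
      also have "\<dots> \<le> total_variation f y"
        by (rule total_variation_upper[OF _ chain_extend(1)[OF p(3)]]) (use True xy in auto)
      finally show ?thesis .
    next
      case False
      define ys where "ys = xs(Suc n := x)"
      have ys: "strict_mono_on {0..Suc n} ys" "ys (Suc n) = x"
        "(\<Sum>j=1..Suc n. ennreal \<bar>f (ys j) - f (ys (j - 1))\<bar>) = ?S + ennreal \<bar>f x - f (xs n)\<bar>"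
        unfolding ys_def using chain_extend[OF p(3), of x] False p(4) by auto
      have "?S + ennreal \<bar>f y - f x\<bar> \<le> (?S + ennreal \<bar>f x - f (xs n)\<bar>) + ennreal \<bar>f y - f x\<bar>"
        by (intro add_right_mono) simp
      also have "\<dots> = (\<Sum>j=1..Suc (Suc n). ennreal \<bar>f ((ys(Suc (Suc n) := y)) j) - f ((ys(Suc (Suc n) := y)) (j - 1))\<bar>)"
        unfolding ys(3)[symmetric] using chain_extend(2)[OF ys(1), of y f] ys(2) xy by simp
      also have "\<dots> \<le> total_variation f y"
        by (rule total_variation_upper[OF _ chain_extend(1)[OF ys(1)]]) (use ys(2) xy in auto)
      finally show ?thesis .
    qed
    then show "(case p of (n, xs) \<Rightarrow> \<Sum>j=1..n. ennreal \<bar>f (xs j) - f (xs (j - 1))\<bar>) + ennreal \<bar>f y - f x\<bar> \<le> total_variation f y"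
      by (simp add: p(1))
  qed
  finally show ?thesis .
qed

lemma total_variation_neg:
  assumes "\<And>t. t < 0 \<Longrightarrow> f t = 0" "x < 0"
  shows "total_variation f x = 0"
proof -
  have "(\<Sum>j=1..n. ennreal \<bar>f (xs j) - f (xs (j - 1))\<bar>) = 0"
    if xs: "strict_mono_on {0..n} xs" "xs n \<le> x" for n and xs :: "nat \<Rightarrow> real"
  proof -
    have neg: "xs r < 0" if "r \<le> n" for r
      using xs assms(2) that unfolding strict_mono_on_def by (cases "r = n") force+
    show ?thesis by (rule sum.neutral) (auto simp: assms(1)[OF neg])
  qed
  then have "total_variation f x \<le> 0" unfolding total_variation_def by (intro SUP_least) auto
  then show ?thesis by simp
qed

text \<open>For an increasing function the infimum over \<open>{x<..}\<close> is the right limit. It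
  lies between \<open>h x\<close> and any later value of \<open>h\<close>, which yields all the
  claims.\<close>

lemma right_limit_mono:
  fixes h :: "real \<Rightarrow> real"
  assumes "mono h"
  defines "h' \<equiv> \<lambda>x. Inf (h ` {x<..})"
  shows "(h \<longlongrightarrow> h' x) (at_right x)" "mono h'" "continuous (at_right x) h'" "h x \<le> h' x" "x < y \<Longrightarrow> h' x \<le> h y"
proof -
  have hm: "a \<le> b \<Longrightarrow> h a \<le> h b" for a b using assms(1) by (auto simp: mono_def)
  have bb: "bdd_below (h ` {x<..})" for x by (rule bdd_belowI[of _ "h x"]) (auto intro: hm)
  have up: "h' x \<le> h y" if "x < y" for x y unfolding h'_def using that by (intro cINF_lower bb) auto
  have lo: "h x \<le> h' x" for x unfolding h'_def by (intro cINF_greatest) (auto intro: hm)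
  have near: "\<exists>y>x. h y < h' x + e" if "e > 0" for x e
  proof -
    have "Inf (h ` {x<..}) < h' x + e" using that by (simp add: h'_def)
    then show ?thesis using cInf_lessD[of "h ` {x<..}" "h' x + e"] by auto
  qed
  have m: "h' a \<le> h' b" if "a \<le> b" for a b
  proof (cases "a = b")
    case False
    then show ?thesis using that up[of a b] lo[of b] by simp
  qed simp
  show "mono h'" using m by (auto simp: mono_def)
  show "h x \<le> h' x" "x < y \<Longrightarrow> h' x \<le> h y" by (rule lo, rule up)
  \<comment> \<open>Stated for any \<open>k\<close> squeezed between \<open>h' x\<close> and later
    values of \<open>h\<close>, so that it gives both the limit of \<open>h\<close> and the
    right-continuity of \<open>h'\<close>.\<close>
  have lim: "(k \<longlongrightarrow> h' x) (at_right x)" if k: "\<And>z. x < z \<Longrightarrow> h' x \<le> k z" "\<And>z y. x < z \<Longrightarrow> z < y \<Longrightarrow> k z \<le> h y" for k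
  proof (rule tendstoI)
    fix e :: real assume "e > 0"
    then obtain y where y: "y > x" "h y < h' x + e" using near by blast
    have "eventually (\<lambda>z. z \<in> {x<..<y}) (at_right x)" using y(1) by (rule eventually_at_right_real)
    then show "eventually (\<lambda>z. dist (k z) (h' x) < e) (at_right x)"
    proof eventually_elim
      case (elim z)
      then show ?case using k(1)[of z] k(2)[of z y] y by (auto simp: dist_real_def)
    qed
  qed
  show "(h \<longlongrightarrow> h' x) (at_right x)" by (rule lim) (auto intro: up hm)
  show "continuous (at_right x) h'" unfolding continuous_within by (rule lim) (auto intro: m up)
qed

lemma tempered_increasing_right_limit:
  fixes h :: "real \<Rightarrow> real"
  assumes h: "mono h" "\<And>x. x < 0 \<Longrightarrow> h x = 0" and int: "(\<integral>\<^sup>+x\<in>{0..}. ennreal (exp (- \<theta> * x) * h x) \<partial>lborel) < \<infinity>"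
  shows "tempered_increasing \<theta> (\<lambda>x. Inf (h ` {x<..}))"
  unfolding tempered_increasing_def
proof (intro conjI allI impI)
  let ?h = "\<lambda>x. Inf (h ` {x<..})"
  note R = right_limit_mono[OF h(1)]
  show "mono ?h" "continuous (at_right a) ?h" for a by (rule R)+
  show "?h x = 0" if "x < 0" for x
    using R(4)[of x] R(5)[of x "x / 2"] h(2)[of x] h(2)[of "x / 2"] that by auto
  have [measurable]: "h \<in> borel_measurable borel" "?h \<in> borel_measurable borel"
    by (rule borel_measurable_mono; fact | rule borel_measurable_mono, rule R)+
  \<comment> \<open>The right limit at \<open>x\<close> is at most \<open>h (1 + x)\<close>.
    Translating the integral by \<open>1\<close> costs the constant factor
    \<open>exp \<theta>\<close>.\<close>
  have "(\<integral>\<^sup>+x\<in>{0..}. ennreal (exp (- \<theta> * x) * ?h x) \<partial>lborel) \<le>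
     (\<integral>\<^sup>+x. ennreal (exp \<theta>) * (ennreal (exp (- \<theta> * (1 + 1 * x)) * h (1 + 1 * x)) * indicator {0..} (1 + 1 * x)) \<partial>lborel)"
  proof (rule nn_integral_mono)
    fix x :: real
    have e: "exp (- \<theta> * x) = exp \<theta> * exp (- \<theta> * (1 + x))" unfolding exp_add[symmetric] by (simp add: algebra_simps)
    have "exp (- \<theta> * x) * ?h x \<le> exp (- \<theta> * x) * h (1 + x)" using R(5)[of x "1 + x"] by (intro mult_left_mono) auto
    also have "\<dots> = exp \<theta> * (exp (- \<theta> * (1 + x)) * h (1 + x))" unfolding e by (rule mult.assoc)
    finally show "ennreal (exp (- \<theta> * x) * ?h x) * indicator {0..} x \<le>
      ennreal (exp \<theta>) * (ennreal (exp (- \<theta> * (1 + 1 * x)) * h (1 + 1 * x)) * indicator {0..} (1 + 1 * x))"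
      by (auto simp: ennreal_mult'[symmetric] split: split_indicator intro!: ennreal_leI)
  qed
  also have "\<dots> = ennreal (exp \<theta>) * (\<integral>\<^sup>+x. ennreal (exp (- \<theta> * (1 + 1 * x)) * h (1 + 1 * x)) * indicator {0..} (1 + 1 * x) \<partial>lborel)"
    by (rule nn_integral_cmult) simp
  also have "(\<integral>\<^sup>+x. ennreal (exp (- \<theta> * (1 + 1 * x)) * h (1 + 1 * x)) * indicator {0..} (1 + 1 * x) \<partial>lborel) = (\<integral>\<^sup>+x\<in>{0..}. ennreal (exp (- \<theta> * x) * h x) \<partial>lborel)"
    by (subst nn_integral_real_affine[where c=1 and t=1 and f="\<lambda>x. ennreal (exp (- \<theta> * x) * h x) * indicator {0..} x"]) auto
  also have "ennreal (exp \<theta>) * \<dots> < \<infinity>" using int by (simp add: ennreal_mult_less_top)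
  finally show "(\<integral>\<^sup>+x\<in>{0..}. ennreal (exp (- \<theta> * x) * ?h x) \<partial>lborel) < \<infinity>" .
qed

text \<open>The variation is increasing, so on \<open>{x..x + real n}\<close> it is at least its
  value at \<open>x\<close>. With \<open>n = 1\<close> this yields finiteness, with all
  \<open>n\<close> the vanishing for nonpositive rates.\<close>

lemma total_variation_lower_integral:
  assumes x: "x \<ge> 0" and c: "\<And>y. y \<in> {x..x + real n} \<Longrightarrow> ennreal c \<le> ennreal (exp (- \<theta> * y))"
  shows "ennreal c * ennreal (real n) * total_variation f x \<le> (\<integral>\<^sup>+y\<in>{0..}. ennreal (exp (- \<theta> * y)) * total_variation f y \<partial>lborel)"
proof -
  have "ennreal c * ennreal (real n) * total_variation f x = (\<integral>\<^sup>+y. ennreal c * total_variation f x * indicator {x..x + real n} y \<partial>lborel)"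
    by (subst nn_integral_cmult_indicator) (auto simp: mult_ac)
  also have "\<dots> \<le> (\<integral>\<^sup>+y\<in>{0..}. ennreal (exp (- \<theta> * y)) * total_variation f y \<partial>lborel)"
    using x c by (intro nn_integral_mono) (auto split: split_indicator intro!: mult_mono total_variation_mono)
  finally show ?thesis .
qed

lemma total_variation_finite:
  assumes "(\<integral>\<^sup>+y\<in>{0..}. ennreal (exp (- \<theta> * y)) * total_variation f y \<partial>lborel) < \<infinity>"
  shows "total_variation f x < \<infinity>"
proof -
  let ?x = "max x 0"
  define c where "c = exp (- \<bar>\<theta>\<bar> * (?x + 1))"
  have "ennreal c * ennreal (real 1) * total_variation f ?x \<le> (\<integral>\<^sup>+y\<in>{0..}. ennreal (exp (- \<theta> * y)) * total_variation f y \<partial>lborel)"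
  proof (rule total_variation_lower_integral)
    fix y assume y: "y \<in> {?x..?x + real 1}"
    have "\<theta> * y \<le> \<bar>\<theta> * y\<bar>" by simp
    also have "\<dots> \<le> \<bar>\<theta>\<bar> * (?x + 1)" using y unfolding abs_mult by (intro mult_left_mono) auto
    finally show "ennreal c \<le> ennreal (exp (- \<theta> * y))" by (simp add: c_def)
  qed simp
  then have "ennreal c * total_variation f ?x < \<infinity>" using assms by simp
  moreover have "ennreal c \<noteq> 0" by (simp add: c_def)
  ultimately have "total_variation f ?x < \<infinity>" by (auto simp: ennreal_mult_less_top)
  then show ?thesis using total_variation_mono[of x ?x f] by (auto intro: le_less_trans)
qed

text \<open>The weight is at least \<open>1\<close> on \<open>{0..}\<close>, so the integral
  dominates \<open>real n\<close> times the variation at \<open>x\<close> for every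
  \<open>n\<close>. The variation is therefore \<open>0\<close>, and comparison with the point
  \<open>-1\<close> gives the claim.\<close>

lemma tempered_variation_nonpos_zero:
  assumes \<theta>: "\<theta> \<le> 0" and fin: "(\<integral>\<^sup>+y\<in>{0..}. ennreal (exp (- \<theta> * y)) * total_variation f y \<partial>lborel) < \<infinity>"
    and f: "\<And>t. t < 0 \<Longrightarrow> f t = 0"
  shows "f x = 0"
proof (cases "x < 0")
  case False
  let ?J = "\<integral>\<^sup>+y\<in>{0..}. ennreal (exp (- \<theta> * y)) * total_variation f y \<partial>lborel"
  obtain a where a: "total_variation f x = ennreal a" "a \<ge> 0"
    using total_variation_finite[OF fin, of x] by (cases "total_variation f x") auto
  obtain J where J: "?J = ennreal J" "J \<ge> 0" using fin by (cases ?J) auto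
  have "real n * a \<le> J" for n
  proof -
    have "ennreal 1 * ennreal (real n) * total_variation f x \<le> ?J"
      by (rule total_variation_lower_integral) (use False \<theta> in \<open>auto simp: mult_nonpos_nonneg\<close>)
    then show ?thesis using J a by (simp add: ennreal_mult'[symmetric])
  qed
  then have "a = 0" using a(2) reals_Archimedean3[of a] by (metis leD le_less)
  moreover have "ennreal \<bar>f x - f (-1)\<bar> \<le> total_variation f x"
    using total_variation_add[of "-1" x f] False order_trans[OF _ total_variation_add[of "-1" x f]] by (simp add: add_increasing)
  ultimately show ?thesis using a(1) f[of "-1"] by simp
qed (rule f)

text \<open>The right limits of \<open>Vf\<close> and \<open>Vf - f\<close> are used instead of these functions themselves, which
  avoids proving that \<open>Vf\<close> is right-continuous.\<close>
lemma tempered_increasing_decomposition: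
  fixes f :: "real \<Rightarrow> real"
  assumes fin: "(\<integral>\<^sup>+y\<in>{0..}. ennreal (exp (- \<theta> * y)) * total_variation f y \<partial>lborel) < \<infinity>"
    and f: "\<And>t. t < 0 \<Longrightarrow> f t = 0" and right: "\<And>t. (f \<longlongrightarrow> f t) (at_right t)"
  obtains g\<^sub>1 g\<^sub>2 where "tempered_increasing \<theta> g\<^sub>1" "tempered_increasing \<theta> g\<^sub>2" "\<And>t. f t = g\<^sub>1 t - g\<^sub>2 t"
proof -
  define V where "V x = enn2real (total_variation f x)" for x
  have V: "total_variation f x = ennreal (V x)" for x
    using total_variation_finite[OF fin, of x] by (simp add: V_def less_top)
  have V0: "V x \<ge> 0" for x by (simp add: V_def)
  have Vneg: "V x = 0" if "x < 0" for x using total_variation_neg[OF f that] by (simp add: V_def)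
  \<comment> \<open>Source of three facts: both \<open>V\<close> and \<open>V - f\<close> are
    increasing, and \<open>\<bar>f x\<bar> \<le> V x\<close>.\<close>
  have add: "V x + \<bar>f y - f x\<bar> \<le> V y" if "x \<le> y" for x y
  proof (cases "x = y")
    case False
    then have "ennreal (V x + \<bar>f y - f x\<bar>) \<le> ennreal (V y)"
      using total_variation_add[of x y f] that V0 unfolding V by (subst ennreal_plus) auto
    then show ?thesis using V0[of y] by (subst (asm) ennreal_le_iff) auto
  qed simp
  have mV: "mono V"
  proof (rule monoI)
    show "V x \<le> V y" if "x \<le> y" for x y using add[OF that] by linarith
  qed
  have mVf: "mono (\<lambda>x. V x - f x)"
  proof (rule monoI)
    show "V x - f x \<le> V y - f y" if "x \<le> y" for x y using add[OF that] by linarith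
  qed
  have fV: "\<bar>f x\<bar> \<le> V x" for x
  proof (cases "x < 0")
    case False
    then show ?thesis using add[of "-1" x] f[of "-1"] Vneg[of "-1"] by simp
  qed (use f V0 in simp)
  have iV: "(\<integral>\<^sup>+x\<in>{0..}. ennreal (exp (- \<theta> * x) * V x) \<partial>lborel) < \<infinity>"
    using fin by (simp add: V ennreal_mult'[symmetric])
  have [measurable]: "V \<in> borel_measurable borel" using mV by (rule borel_measurable_mono)
  have iVf: "(\<integral>\<^sup>+x\<in>{0..}. ennreal (exp (- \<theta> * x) * (V x - f x)) \<partial>lborel) < \<infinity>"
  proof -
    have "(\<integral>\<^sup>+x\<in>{0..}. ennreal (exp (- \<theta> * x) * (V x - f x)) \<partial>lborel) \<le> (\<integral>\<^sup>+x. ennreal 2 * (ennreal (exp (- \<theta> * x) * V x) * indicator {0..} x) \<partial>lborel)"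
    proof (rule nn_integral_mono)
      fix x
      have "V x - f x \<le> 2 * V x" using fV[of x] by linarith
      then have "exp (- \<theta> * x) * (V x - f x) \<le> exp (- \<theta> * x) * (2 * V x)" by (rule mult_left_mono) simp
      then have "ennreal (exp (- \<theta> * x) * (V x - f x)) \<le> ennreal (2 * (exp (- \<theta> * x) * V x))" by (intro ennreal_leI) (simp add: mult_ac)
      also have "\<dots> = ennreal 2 * ennreal (exp (- \<theta> * x) * V x)" by (rule ennreal_mult') simp
      finally show "ennreal (exp (- \<theta> * x) * (V x - f x)) * indicator {0..} x \<le> ennreal 2 * (ennreal (exp (- \<theta> * x) * V x) * indicator {0..} x)"
        by (auto split: split_indicator)
    qed
    also have "\<dots> = ennreal 2 * (\<integral>\<^sup>+x\<in>{0..}. ennreal (exp (- \<theta> * x) * V x) \<partial>lborel)" by (rule nn_integral_cmult) simp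
    also have "\<dots> < \<infinity>" using iV unfolding infinity_ennreal_def ennreal_mult_less_top by auto
    finally show ?thesis .
  qed
  let ?g1 = "\<lambda>x. Inf (V ` {x<..})" and ?g2 = "\<lambda>x. Inf ((\<lambda>x. V x - f x) ` {x<..})"
  show ?thesis
  proof (rule that[of ?g1 ?g2])
    show "tempered_increasing \<theta> ?g1" by (rule tempered_increasing_right_limit[OF mV Vneg iV])
    show "tempered_increasing \<theta> ?g2" by (rule tempered_increasing_right_limit[OF mVf _ iVf]) (use Vneg f in auto)
    fix t
    \<comment> \<open>The right limits of \<open>V\<close> and \<open>V - f\<close> differ by the
      right limit of \<open>f\<close>, which is \<open>f t\<close> by right-continuity.\<close>
    have "((\<lambda>x. V x - (V x - f x)) \<longlongrightarrow> ?g1 t - ?g2 t) (at_right t)"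
      by (intro tendsto_diff right_limit_mono(1) mV mVf)
    then have "(f \<longlongrightarrow> ?g1 t - ?g2 t) (at_right t)" by simp
    then show "f t = ?g1 t - ?g2 t" using right[of t] tendsto_unique trivial_limit_at_right_real by blast
  qed
qed

section \<open>The expansion\<close>

lemma integrable_exp_decay: "c > 0 \<Longrightarrow> integrable lborel (\<lambda>x::real. indicator {0..} x * exp (- c * x))"
  using integrable_norm[OF integrable_power_times_exp[of "complex_of_real c" 0, unfolded set_integrable_def]]
  by (simp add: norm_exp_eq_Re)

lemma weighted_integrable:
  fixes f :: "real \<Rightarrow> real"
  assumes f[measurable]: "f \<in> borel_measurable borel" and J: "\<And>x. x \<ge> 0 \<Longrightarrow> \<bar>f x\<bar> \<le> J * exp (\<theta> * x)" and l: "Re l > \<theta>"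
  shows "set_integrable lborel {0..} (\<lambda>x. complex_of_real (f x * (t - x) ^ m) * exp (- l * complex_of_real x))"
proof -
  \<comment> \<open>Half of the gap \<open>Re l - \<theta>\<close> absorbs the polynomial factor,
    the other half makes the integral converge.\<close>
  define c where "c = (Re l - \<theta>) / 2"
  have c: "c > 0" "Re l = \<theta> + 2 * c" using l by (auto simp: c_def field_simps)
  have J0: "J \<ge> 0" using order_trans[OF abs_ge_zero J[of 0]] by simp
  have bd: "\<bar>f x\<bar> * \<bar>t - x\<bar> ^ m * exp (- Re l * x) \<le> J * (fact m / c ^ m * exp (c * \<bar>t\<bar>)) * exp (- c * x)" if x: "x \<ge> 0" for x
  proof -
    have "\<bar>t - x\<bar> ^ m \<le> (\<bar>t\<bar> + x) ^ m" using x by (intro power_mono) auto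
    also have "\<dots> \<le> fact m / c ^ m * exp (c * (\<bar>t\<bar> + x))" using x c by (intro power_le_exp) auto
    finally have "\<bar>f x\<bar> * \<bar>t - x\<bar> ^ m * exp (- Re l * x) \<le> J * exp (\<theta> * x) * (fact m / c ^ m * exp (c * (\<bar>t\<bar> + x))) * exp (- Re l * x)"
      using J[OF x] J0 by (intro mult_right_mono mult_mono) auto
    also have "\<dots> = J * (fact m / c ^ m) * (exp (\<theta> * x) * exp (c * (\<bar>t\<bar> + x)) * exp (- Re l * x))" by (simp add: mult_ac)
    also have "exp (\<theta> * x) * exp (c * (\<bar>t\<bar> + x)) * exp (- Re l * x) = exp (c * \<bar>t\<bar>) * exp (- c * x)"
      unfolding exp_add[symmetric] c(2) by (simp add: algebra_simps)
    finally show ?thesis by (simp add: mult_ac)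
  qed
  show ?thesis unfolding set_integrable_def
  proof (rule Bochner_Integration.integrable_bound[OF integrable_mult_right[OF integrable_exp_decay[OF c(1)], of "J * (fact m / c ^ m * exp (c * \<bar>t\<bar>))"]])
    show "AE x in lborel. norm (indicator {0..} x *\<^sub>R (complex_of_real (f x * (t - x) ^ m) * exp (- l * complex_of_real x)))
      \<le> norm (J * (fact m / c ^ m * exp (c * \<bar>t\<bar>)) * (indicator {0..} x * exp (- c * x)))"
      using bd J0 c(1) by (intro AE_I2) (auto simp: norm_mult norm_power norm_exp_eq_Re abs_mult power_abs split: split_indicator simp del: of_real_diff)
  qed simp
qed

text \<open>Beyond \<open>t\<close> the integrand, multiplied by \<open>exp (l * t)\<close>, is at
  most a constant times \<open>exp (\<theta> * t) * exp (- c * (x - t))\<close>: the rate of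
  \<open>f\<close> is \<open>\<theta>\<close>, and half of the gap to \<open>Re l\<close> absorbs
  \<open>(x - t) ^ m\<close>. Completing the integral to infinity thus costs no more than the error
  already present.\<close>

lemma weighted_tail_bound:
  fixes f :: "real \<Rightarrow> real"
  assumes f[measurable]: "f \<in> borel_measurable borel" and J: "\<And>x. x \<ge> 0 \<Longrightarrow> \<bar>f x\<bar> \<le> J * exp (\<theta> * x)" and l: "Re l > \<theta>"
  obtains C where "\<And>t. t \<ge> 0 \<Longrightarrow> cmod (exp (l * complex_of_real t) *
      ((LINT x:{0..}|lborel. complex_of_real (f x * (t - x) ^ m) * exp (- l * complex_of_real x))
      - (LINT x:{0..t}|lborel. complex_of_real (f x * (t - x) ^ m) * exp (- l * complex_of_real x)))) \<le> C * exp (\<theta> * t)"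
proof -
  define c where "c = (Re l - \<theta>) / 2"
  have c: "c > 0" "Re l = \<theta> + 2 * c" using l by (auto simp: c_def field_simps)
  have J0: "J \<ge> 0" using order_trans[OF abs_ge_zero J[of 0]] by simp
  define E where "E = (LINT x|lborel. indicator {0..} x * exp (- c * x))"
  show ?thesis
  proof (rule that[of "J * (fact m / c ^ m) * E"])
    fix t :: real assume t: "t \<ge> 0"
    let ?h = "\<lambda>x. complex_of_real (f x * (t - x) ^ m) * exp (- l * complex_of_real x)"
    let ?w = "\<lambda>x. indicator {0..} (- t + 1 * x) * exp (- c * (- t + 1 * x))"
    have i1: "set_integrable lborel {0..} ?h" by (rule weighted_integrable[OF f J l])
    have i2: "set_integrable lborel {0..t} ?h" by (rule set_integrable_subset[OF i1]) auto
    have iw: "integrable lborel ?w" and Ew: "(LINT x|lborel. ?w x) = E"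
      unfolding E_def using lborel_integrable_real_affine[OF integrable_exp_decay[OF c(1)], of 1 "-t"]
        lborel_integral_real_affine[of 1 "\<lambda>x. indicator {0..} x * exp (- c * x)" "-t"] by simp_all
    have i3: "integrable lborel (\<lambda>x. exp (l * complex_of_real t) * (indicator {0..} x *\<^sub>R ?h x - indicator {0..t} x *\<^sub>R ?h x))"
      using i1 i2 unfolding set_integrable_def by (intro integrable_mult_right Bochner_Integration.integrable_diff)
    have "exp (l * complex_of_real t) * ((LINT x:{0..}|lborel. ?h x) - (LINT x:{0..t}|lborel. ?h x)) =
       (LINT x|lborel. exp (l * complex_of_real t) * (indicator {0..} x *\<^sub>R ?h x - indicator {0..t} x *\<^sub>R ?h x))"
      using i1 i2 unfolding set_integrable_def set_lebesgue_integral_def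
      by (simp only: Bochner_Integration.integral_diff[symmetric] Bochner_Integration.integral_mult_right_zero)
    moreover have "cmod (LINT x|lborel. exp (l * complex_of_real t) * (indicator {0..} x *\<^sub>R ?h x - indicator {0..t} x *\<^sub>R ?h x))
      \<le> (LINT x|lborel. J * (fact m / c ^ m) * exp (\<theta> * t) * ?w x)"
    proof (rule Bochner_Integration.integral_norm_bound_integral[OF i3])
      show "integrable lborel (\<lambda>x. J * (fact m / c ^ m) * exp (\<theta> * t) * ?w x)" by (rule integrable_mult_right[OF iw])
      fix x :: real
      show "cmod (exp (l * complex_of_real t) * (indicator {0..} x *\<^sub>R ?h x - indicator {0..t} x *\<^sub>R ?h x)) \<le> J * (fact m / c ^ m) * exp (\<theta> * t) * ?w x"
      proof (cases "x > t")
        case True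
        have "cmod (exp (l * complex_of_real t) * (indicator {0..} x *\<^sub>R ?h x - indicator {0..t} x *\<^sub>R ?h x)) =
           \<bar>f x\<bar> * (x - t) ^ m * (exp (Re l * t) * exp (- Re l * x))"
          using True t by (simp add: norm_mult norm_power norm_exp_eq_Re abs_mult power_abs abs_minus_commute mult_ac del: of_real_diff)
        also have "\<dots> \<le> J * exp (\<theta> * x) * (fact m / c ^ m * exp (c * (x - t))) * (exp (Re l * t) * exp (- Re l * x))"
          using True t c J0 by (intro mult_right_mono mult_mono J power_le_exp) auto
        also have "\<dots> = J * (fact m / c ^ m) * (exp (\<theta> * x) * exp (c * (x - t)) * (exp (Re l * t) * exp (- Re l * x)))"
          by (simp add: mult_ac)
        also have "exp (\<theta> * x) * exp (c * (x - t)) * (exp (Re l * t) * exp (- Re l * x)) = exp (\<theta> * t) * exp (- c * (x - t))"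
          unfolding exp_add[symmetric] c(2) by (simp add: algebra_simps)
        finally show ?thesis using True by (simp add: mult_ac)
      next
        case False
        then have "indicator {0..} x *\<^sub>R ?h x - indicator {0..t} x *\<^sub>R ?h x = 0" by (auto split: split_indicator)
        then have "cmod (exp (l * complex_of_real t) * (indicator {0..} x *\<^sub>R ?h x - indicator {0..t} x *\<^sub>R ?h x)) = 0"
          by (simp only: mult_zero_right norm_zero)
        moreover have "0 \<le> J * (fact m / c ^ m) * exp (\<theta> * t) * ?w x" using J0 c(1) by (auto intro!: mult_nonneg_nonneg)
        ultimately show ?thesis by linarith
      qed
    qed
    moreover have "(LINT x|lborel. J * (fact m / c ^ m) * exp (\<theta> * t) * ?w x) = J * (fact m / c ^ m) * E * exp (\<theta> * t)"
      unfolding Bochner_Integration.integral_mult_right_zero Ew by simp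
    ultimately show "cmod (exp (l * complex_of_real t) * ((LINT x:{0..}|lborel. ?h x) - (LINT x:{0..t}|lborel. ?h x))) \<le> J * (fact m / c ^ m) * E * exp (\<theta> * t)"
      by (simp only:)
  qed
qed

text \<open>Powers of \<open>t\<close> are separated by the binomial theorem. The factor
  \<open>0 - x\<close> presents the coefficients as the same kind of integral at
  \<open>t = 0\<close>.\<close>

lemma weighted_binomial:
  fixes f :: "real \<Rightarrow> real"
  assumes f: "f \<in> borel_measurable borel" and J: "\<And>x. x \<ge> 0 \<Longrightarrow> \<bar>f x\<bar> \<le> J * exp (\<theta> * x)" and l: "Re l > \<theta>"
  shows "(LINT x:{0..}|lborel. complex_of_real (f x * (t - x) ^ m) * exp (- l * complex_of_real x)) =
    (\<Sum>k\<le>m. of_nat (m choose k) * complex_of_real (t ^ k) *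
      (LINT x:{0..}|lborel. complex_of_real (f x * (0 - x) ^ (m - k)) * exp (- l * complex_of_real x)))"
proof -
  let ?h = "\<lambda>n x. indicator {0..} x *\<^sub>R (complex_of_real (f x * (0 - x) ^ n) * exp (- l * complex_of_real x))"
  have i: "integrable lborel (?h n)" for n
    using weighted_integrable[OF f J l, of 0 n] unfolding set_integrable_def .
  have pt: "indicator {0..} x *\<^sub>R (complex_of_real (f x * (t - x) ^ m) * exp (- l * complex_of_real x)) =
     (\<Sum>k\<le>m. of_nat (m choose k) * complex_of_real (t ^ k) * ?h (m - k) x)" for x
  proof -
    have "(t - x) ^ m = (\<Sum>k\<le>m. of_nat (m choose k) * t ^ k * (0 - x) ^ (m - k))"
      using binomial_ring[of t "- x" m] by simp
    then show ?thesis by (simp add: scaleR_conv_of_real sum_distrib_left sum_distrib_right mult_ac)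
  qed
  show ?thesis
    unfolding set_lebesgue_integral_def pt
    by (subst Bochner_Integration.integral_sum) (intro integrable_mult_right i sum.cong refl Bochner_Integration.integral_mult_right_zero)+
qed

lemma bigo_vecI:
  fixes F :: "real \<Rightarrow> real^'n" and G :: "real \<Rightarrow> complex^'n"
  assumes C: "\<And>i. \<exists>C. \<forall>t\<ge>0. cmod (complex_of_real (F t $ i) - G t $ i) \<le> C * exp (\<theta> * t)" and a: "\<theta> \<le> a"
  shows "bigo_vec F G a"
  unfolding bigo_vec_def
proof
  fix i
  obtain C where C: "\<And>t. t \<ge> 0 \<Longrightarrow> cmod (complex_of_real (F t $ i) - G t $ i) \<le> C * exp (\<theta> * t)" using C by blast
  have C0: "C \<ge> 0" using order_trans[OF norm_ge_zero C[of 0]] by simp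
  show "(\<lambda>t. complex_of_real (F t $ i) - G t $ i) \<in> O[at_top](\<lambda>t. complex_of_real (exp (a * t)))"
  proof (rule bigoI[of _ C])
    show "\<forall>\<^sub>F t in at_top. norm (complex_of_real (F t $ i) - G t $ i) \<le> C * norm (complex_of_real (exp (a * t)))"
      using eventually_ge_at_top[of 0]
    proof eventually_elim
      case (elim t)
      have "C * exp (\<theta> * t) \<le> C * exp (a * t)" using C0 a elim by (intro mult_left_mono) (auto intro: mult_right_mono)
      then show ?case using C[OF elim] by simp
    qed
  qed
qed

section \<open>Assembling the expansion\<close>

context renewal_strip begin

text \<open>The Stieltjes bound is applied to the two increasing parts of \<open>f\<close> and the
  results are subtracted; the convolution of \<open>f\<close> with the residue density is then
  rewritten as the explicit sum over the roots.\<close>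

lemma scalar_expansion:
  fixes f :: "real \<Rightarrow> real"
  assumes B: "principal_coefficients \<mu> \<theta>\<^sub>0 B" and \<theta>: "\<theta>\<^sub>0 < \<theta>" "0 < \<theta>" "\<theta> < \<sigma>"
    and R: "\<And>l. l \<in> roots_gt \<mu> \<theta>\<^sub>0 \<Longrightarrow> Re l > \<theta>"
    and g1: "tempered_increasing \<theta> g\<^sub>1" and g2: "tempered_increasing \<theta> g\<^sub>2" and f: "\<And>t. f t = g\<^sub>1 t - g\<^sub>2 t"
    and J: "\<And>x. x \<ge> 0 \<Longrightarrow> \<bar>f x\<bar> \<le> J * exp (\<theta> * x)"
  obtains C where "\<And>t. t \<ge> 0 \<Longrightarrow> cmod (of_real (LINT x|U i j. f (t - x)) -
     (\<Sum>l\<in>roots_gt \<mu> \<theta>\<^sub>0. \<Sum>m<pole_order \<mu> l. exp (l * complex_of_real t) * (B l m $ i $ j *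
       (LINT x:{0..t}|lborel. complex_of_real (f x * (t - x) ^ m) * exp (- l * complex_of_real x))))) \<le> C * exp (\<theta> * t)"
proof -
  let ?Q = "residue_density \<mu> \<theta>\<^sub>0 B i j"
  obtain C where C: "\<And>t. t \<ge> 0 \<Longrightarrow> cmod (of_real (measure (U i j) {..t}) - (LINT x|lborel. indicator {..t} x *\<^sub>R ?Q x)) \<le> C * exp (\<theta> * t)"
  proof (rule renewal_function_asymptotics[OF B \<theta>, of i j])
    fix C assume "\<And>t. t \<ge> 0 \<Longrightarrow> cmod (of_real (measure (U i j) {..t}) - (LINT x|lborel. indicator {..t} x *\<^sub>R ?Q x)) \<le> C * exp (\<theta> * t)"
    then show thesis by (rule that)
  qed
  have fm[measurable]: "f \<in> borel_measurable borel"
    using tempered_increasing_measurable[OF g1] tempered_increasing_measurable[OF g2] unfolding f[abs_def] by measurable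
  have f0: "f x = 0" if "x < 0" for x using g1 g2 that by (simp add: f tempered_increasing_def)
  have iU: "integrable (U i j) (indicator {..t} :: real \<Rightarrow> real)" for t
  proof (rule Bochner_Integration.integrable_bound[OF integrable_mult_right[OF U_exp_integrable, where c="exp (\<sigma> * t)"]])
    show "AE x in U i j. norm (indicator {..t} x :: real) \<le> norm (exp (\<sigma> * t) * exp (- \<sigma> * x))"
      using \<theta> by (intro AE_I2) (auto simp: exp_add[symmetric] split: split_indicator)
  qed (rule borel_measurable_indicator, simp)
  have Q0: "?Q x = 0" if "x < 0" for x using that by (simp add: residue_density_def)
  obtain CQ where CQ: "\<And>x. x \<ge> 0 \<Longrightarrow> cmod (?Q x) \<le> CQ * exp (\<sigma> * x)"
  proof (rule residue_density_bound[OF roots_gt_less, of B i j])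
    fix C assume "\<And>x. 0 \<le> x \<Longrightarrow> cmod (?Q x) \<le> C * exp (\<sigma> * x)"
    then show thesis by (rule that)
  qed
  have CQ0: "CQ \<ge> 0" using order_trans[OF norm_ge_zero CQ[of 0]] by simp
  have iQ: "integrable lborel (\<lambda>x. indicator {..t} x *\<^sub>R ?Q x)" for t
  proof (rule Bochner_Integration.integrable_bound[of _ "\<lambda>x. CQ * exp (\<sigma> * \<bar>t\<bar>) * indicator {0..\<bar>t\<bar>} x"])
    show "integrable lborel (\<lambda>x. CQ * exp (\<sigma> * \<bar>t\<bar>) * indicator {0..\<bar>t\<bar>} x)"
      by (intro integrable_mult_right integrable_real_indicator) auto
    have "cmod (indicator {..t} x *\<^sub>R ?Q x) \<le> CQ * exp (\<sigma> * \<bar>t\<bar>) * indicator {0..\<bar>t\<bar>} x" for x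
    proof (cases "0 \<le> x \<and> x \<le> t")
      case True
      have "cmod (?Q x) \<le> CQ * exp (\<sigma> * \<bar>t\<bar>)"
        using True \<theta> CQ0 by (intro order_trans[OF CQ] mult_left_mono) auto
      then show ?thesis using True by simp
    next
      case False
      then have z: "indicator {..t} x *\<^sub>R ?Q x = 0" using Q0[of x] by (auto split: split_indicator)
      show ?thesis unfolding z using CQ0 by simp
    qed
    then show "AE x in lborel. norm (indicator {..t} x *\<^sub>R ?Q x) \<le> norm (CQ * exp (\<sigma> * \<bar>t\<bar>) * indicator {0..\<bar>t\<bar>} x)"
      using CQ0 by (intro AE_I2) simp
  qed simp
  have bound: "cmod (of_real (LINT x|U i j. g (t - x)) - (LINT x|lborel. of_real (g (t - x)) * ?Q x)) \<le> C * (LINT y|interval_measure g. exp (- \<theta> * y)) * exp (\<theta> * t)"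
    and ig: "integrable (U i j) (\<lambda>x. g (t - x))" and igQ: "integrable lborel (\<lambda>x. of_real (g (t - x)) * ?Q x)"
    if g: "tempered_increasing \<theta> g" for g t
  proof -
    show "cmod (of_real (LINT x|U i j. g (t - x)) - (LINT x|lborel. of_real (g (t - x)) * ?Q x)) \<le> C * (LINT y|interval_measure g. exp (- \<theta> * y)) * exp (\<theta> * t)"
      by (rule stieltjes_convolution_bound[OF g \<theta>(2) sets_renewal_measure sigma_finite_U U_nonneg iU residue_density_measurable Q0 iQ C])
    show "integrable lborel (\<lambda>x. of_real (g (t - x)) * ?Q x)"
      by (rule stieltjes_convolution(3)[OF g \<theta>(2) sets_lborel lborel.sigma_finite_measure_axioms residue_density_measurable _ iQ]) (use Q0 in auto)
    have "integrable (U i j) (\<lambda>x. complex_of_real (g (t - x)) * 1)"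
    proof (rule stieltjes_convolution(3)[OF g \<theta>(2) sets_renewal_measure sigma_finite_U])
      show "AE x in U i j. x < 0 \<longrightarrow> (1::complex) = 0" using U_nonneg by eventually_elim auto
      show "integrable (U i j) (\<lambda>x. indicator {..t} x *\<^sub>R (1::complex))"
        using integrable_of_real[OF iU[of t], where 'a=complex] by (simp add: scaleR_conv_of_real)
    qed simp
    from integrable_Re[OF this] show "integrable (U i j) (\<lambda>x. g (t - x))" by simp
  qed
  define C' where "C' = C * (LINT y|interval_measure g\<^sub>1. exp (- \<theta> * y)) + C * (LINT y|interval_measure g\<^sub>2. exp (- \<theta> * y))"
  have main: "cmod (of_real (LINT x|U i j. f (t - x)) - (LINT x|lborel. of_real (f (t - x)) * ?Q x)) \<le> C' * exp (\<theta> * t)" for t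
  proof -
    have 1: "(LINT x|U i j. f (t - x)) = (LINT x|U i j. g\<^sub>1 (t - x)) - (LINT x|U i j. g\<^sub>2 (t - x))"
      unfolding f by (rule Bochner_Integration.integral_diff[OF ig[OF g1] ig[OF g2]])
    have 2: "(LINT x|lborel. of_real (f (t - x)) * ?Q x) = (LINT x|lborel. of_real (g\<^sub>1 (t - x)) * ?Q x) - (LINT x|lborel. of_real (g\<^sub>2 (t - x)) * ?Q x)"
      unfolding f of_real_diff left_diff_distrib by (rule Bochner_Integration.integral_diff[OF igQ[OF g1] igQ[OF g2]])
    have "of_real (LINT x|U i j. f (t - x)) - (LINT x|lborel. of_real (f (t - x)) * ?Q x) =
      (of_real (LINT x|U i j. g\<^sub>1 (t - x)) - (LINT x|lborel. of_real (g\<^sub>1 (t - x)) * ?Q x)) -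
      (of_real (LINT x|U i j. g\<^sub>2 (t - x)) - (LINT x|lborel. of_real (g\<^sub>2 (t - x)) * ?Q x))"
      unfolding 1 2 by (simp only: of_real_diff) (simp add: algebra_simps)
    then show ?thesis
      unfolding C'_def distrib_right by (simp only:) (rule order_trans[OF norm_triangle_ineq4 add_mono[OF bound[OF g1] bound[OF g2]]])
  qed
  have conv: "(LINT x|lborel. of_real (f (t - x)) * ?Q x) =
     (\<Sum>l\<in>roots_gt \<mu> \<theta>\<^sub>0. \<Sum>m<pole_order \<mu> l. exp (l * complex_of_real t) * (B l m $ i $ j *
       (LINT x:{0..t}|lborel. complex_of_real (f x * (t - x) ^ m) * exp (- l * complex_of_real x))))" if t: "t \<ge> 0" for t
  proof -
    let ?h = "\<lambda>l m x. indicator {0..t} x *\<^sub>R (complex_of_real (f x * (t - x) ^ m) * exp (- l * complex_of_real x))"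
    have i: "integrable lborel (?h l m)" if "l \<in> roots_gt \<mu> \<theta>\<^sub>0" for l m
      using set_integrable_subset[OF weighted_integrable[OF fm J R[OF that], of t m], of "{0..t}"] unfolding set_integrable_def by auto
    \<comment> \<open>The reflection \<open>x \<mapsto> t - x\<close> moves the shift from
      \<open>f\<close> to the density.\<close>
    have "(LINT x|lborel. of_real (f (t - x)) * ?Q x) = (LINT x|lborel. of_real (f (t - (t + (-1) * x))) * ?Q (t + (-1) * x))"
      by (subst lborel_integral_real_affine[where c="-1" and t=t]) auto
    also have "(\<lambda>x. of_real (f (t - (t + (-1) * x))) * ?Q (t + (-1) * x)) =
      (\<lambda>x. \<Sum>l\<in>roots_gt \<mu> \<theta>\<^sub>0. \<Sum>m<pole_order \<mu> l. exp (l * complex_of_real t) * (B l m $ i $ j * ?h l m x))"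
    proof
      fix x
      have e: "exp (l * complex_of_real (t - x)) = exp (l * complex_of_real t) * exp (- l * complex_of_real x)" for l
        unfolding exp_add[symmetric] by (simp add: algebra_simps)
      \<comment> \<open>The density restricts to \<open>x \<le> t\<close> and the vanishing of
        \<open>f\<close> to \<open>x \<ge> 0\<close>, which leaves the interval
        \<open>{0..t}\<close>.\<close>
      have ind: "of_real (f x) * (indicator {0..} (t - x) *\<^sub>R z) = indicator {0..t} x *\<^sub>R (of_real (f x) * z)" for z :: complex
        using f0[of x] by (auto split: split_indicator)
      have "of_real (f x) * ?Q (t - x) = (\<Sum>l\<in>roots_gt \<mu> \<theta>\<^sub>0. \<Sum>m<pole_order \<mu> l. B l m $ i $ j *
          (of_real (f x) * (indicator {0..} (t - x) *\<^sub>R (of_real (t - x) ^ m * exp (l * of_real (t - x))))))"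
        unfolding residue_density_def sum_distrib_left by (intro sum.cong refl) (simp only: mult.left_commute)
      also have "\<dots> = (\<Sum>l\<in>roots_gt \<mu> \<theta>\<^sub>0. \<Sum>m<pole_order \<mu> l. exp (l * complex_of_real t) * (B l m $ i $ j * ?h l m x))"
        unfolding ind e by (intro sum.cong refl) (simp add: scaleR_conv_of_real mult_ac)
      finally show "of_real (f (t - (t + (-1) * x))) * ?Q (t + (-1) * x) =
        (\<Sum>l\<in>roots_gt \<mu> \<theta>\<^sub>0. \<Sum>m<pole_order \<mu> l. exp (l * complex_of_real t) * (B l m $ i $ j * ?h l m x))" by simp
    qed
    also have "(LINT x|lborel. (\<Sum>l\<in>roots_gt \<mu> \<theta>\<^sub>0. \<Sum>m<pole_order \<mu> l. exp (l * complex_of_real t) * (B l m $ i $ j * ?h l m x))) =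
       (\<Sum>l\<in>roots_gt \<mu> \<theta>\<^sub>0. LINT x|lborel. (\<Sum>m<pole_order \<mu> l. exp (l * complex_of_real t) * (B l m $ i $ j * ?h l m x)))"
      by (intro Bochner_Integration.integral_sum Bochner_Integration.integrable_sum integrable_mult_right i)
    also have "\<dots> = (\<Sum>l\<in>roots_gt \<mu> \<theta>\<^sub>0. \<Sum>m<pole_order \<mu> l. LINT x|lborel. exp (l * complex_of_real t) * (B l m $ i $ j * ?h l m x))"
      by (intro sum.cong refl Bochner_Integration.integral_sum integrable_mult_right i)
    finally show ?thesis unfolding set_lebesgue_integral_def Bochner_Integration.integral_mult_right_zero .
  qed
  show ?thesis
  proof (rule that[of C'])
    fix t :: real assume t: "t \<ge> 0"
    show "cmod (of_real (LINT x|U i j. f (t - x)) -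
     (\<Sum>l\<in>roots_gt \<mu> \<theta>\<^sub>0. \<Sum>m<pole_order \<mu> l. exp (l * complex_of_real t) * (B l m $ i $ j *
       (LINT x:{0..t}|lborel. complex_of_real (f x * (t - x) ^ m) * exp (- l * complex_of_real x))))) \<le> C' * exp (\<theta> * t)"
      using main[of t] unfolding conv[OF t] .
  qed
qed

end

lemma exponential_sum_nth:
  fixes B :: "complex \<Rightarrow> nat \<Rightarrow> complex^'n::finite^'n" and V :: "nat \<Rightarrow> complex \<Rightarrow> complex^'n"
  shows "(\<Sum>l\<in>R. c l *s (\<Sum>m<k l. B l m *v V m l)) $ i =
    (\<Sum>j\<in>UNIV. \<Sum>l\<in>R. \<Sum>m<k l. c l * (B l m $ i $ j * V m l $ j))"
proof -
  have "(\<Sum>l\<in>R. c l *s (\<Sum>m<k l. B l m *v V m l)) $ i = (\<Sum>l\<in>R. \<Sum>m<k l. \<Sum>j\<in>UNIV. c l * (B l m $ i $ j * V m l $ j))"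
    by (simp add: matrix_vector_mult_def sum_distrib_left)
  also have "\<dots> = (\<Sum>l\<in>R. \<Sum>j\<in>UNIV. \<Sum>m<k l. c l * (B l m $ i $ j * V m l $ j))"
    by (intro sum.cong refl sum.swap)
  also have "\<dots> = (\<Sum>j\<in>UNIV. \<Sum>l\<in>R. \<Sum>m<k l. c l * (B l m $ i $ j * V m l $ j))"
    by (rule sum.swap)
  finally show ?thesis .
qed

theorem theorem2p5:
  fixes \<mu> :: "'n::finite \<Rightarrow> 'n \<Rightarrow> real measure" and \<theta>\<^sub>0 :: real
  assumes "\<And>i j. locally_finite_nonneg (\<mu> i j)"
    and "non_lattice \<mu>"
    and "complex_of_real \<theta>\<^sub>0 \<in> interior (laplace_domain \<mu>)"
    and "spectral_radius (atom0 \<mu>) < 1"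
    and "\<And>\<eta>. invertible (mat 1 - laplace \<mu> (Complex \<theta>\<^sub>0 \<eta>))"
    and "bdd_above (range (\<lambda>\<eta>. norm (matrix_inv (mat 1 - laplace \<mu> (Complex \<theta>\<^sub>0 \<eta>)))))"
    and "finite (roots_gt \<mu> \<theta>\<^sub>0)"
  shows "\<exists>B :: complex \<Rightarrow> nat \<Rightarrow> complex^'n^'n.
    \<forall>(f :: real \<Rightarrow> real^'n) \<theta> F.
      cadlag f \<longrightarrow> (\<forall>t<0. f t = 0) \<longrightarrow>
      \<theta>\<^sub>0 < \<theta> \<longrightarrow> roots_gt \<mu> \<theta>\<^sub>0 = roots_gt \<mu> \<theta> \<longrightarrow>
      (\<forall>i. (\<integral>\<^sup>+x\<in>{0..}. ennreal (exp (- \<theta> * x)) * total_variation (\<lambda>s. f s $ i) x \<partial>lborel) < \<infinity>) \<longrightarrow>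
      F = conv_fun (renewal_measure \<mu>) f \<longrightarrow>
        locally_bounded_renewal_solution \<mu> f F \<and>
        (\<forall>G. locally_bounded_renewal_solution \<mu> f G \<longrightarrow> G = F) \<and>
        (\<exists>b :: complex \<Rightarrow> nat \<Rightarrow> complex^'n.
          bigo_vec F (\<lambda>t. \<Sum>l\<in>roots_gt \<mu> \<theta>. exp (l * t) *s
            (\<Sum>k<pole_order \<mu> l. B l k *v main_integral {0..t} f t k l)) \<theta> \<and>
          (\<forall>\<epsilon>>0. bigo_vec F (\<lambda>t. \<Sum>l\<in>roots_gt \<mu> \<theta>. exp (l * t) *s
            (\<Sum>k<pole_order \<mu> l. B l k *v main_integral {0..} f t k l)) (\<theta> + \<epsilon>)) \<and>
          (\<forall>\<epsilon>>0. bigo_vec F (\<lambda>t. \<Sum>l\<in>roots_gt \<mu> \<theta>. exp (l * t) *s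
            (\<Sum>k<pole_order \<mu> l. complex_of_real (t ^ k) *s b l k)) (\<theta> + \<epsilon>)))"
proof -
  obtain s where s: "s < \<theta>\<^sub>0" and dom: "\<And>z. Re z \<ge> s \<Longrightarrow> z \<in> laplace_domain \<mu>"
    using interior_laplace_domain[OF assms(3)] by metis
  \<comment> \<open>The abscissa must lie beyond a rate \<open>\<theta>\<close> that is introduced
    only after \<open>B\<close>, hence the arbitrary lower bound \<open>T\<close>.\<close>
  have strip: "\<exists>\<sigma> \<rho> v. T < \<sigma> \<and> renewal_strip \<mu> \<sigma> \<rho> v s \<theta>\<^sub>0" for T
  proof -
    have "complex_of_real s \<in> laplace_domain \<mu>" by (rule dom) simp
    then obtain \<sigma> \<rho> v where \<sigma>: "\<sigma> \<ge> max T \<theta>\<^sub>0 + 1" and ker: "renewal_kernel \<mu> \<sigma> \<rho> v"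
      using renewal_kernel_exists[OF assms(1) _ assms(4)] by metis
    have "renewal_strip \<mu> \<sigma> \<rho> v s \<theta>\<^sub>0"
      unfolding renewal_strip_def renewal_strip_axioms_def using ker s \<sigma> dom assms(5,6,7) by auto
    then show ?thesis using \<sigma> by (intro exI[of _ \<sigma>] exI[of _ \<rho>] exI[of _ v]) auto
  qed
  obtain B where B: "principal_coefficients \<mu> \<theta>\<^sub>0 B"
    using strip[of 0] renewal_strip.principal_coefficients_exist by blast
  show ?thesis
  proof (rule exI[of _ B], intro allI impI)
    fix f :: "real \<Rightarrow> real^'n" and \<theta> F
    assume cad: "cadlag f" and neg: "\<forall>t<0. f t = 0" and \<theta>: "\<theta>\<^sub>0 < \<theta>" and roots: "roots_gt \<mu> \<theta>\<^sub>0 = roots_gt \<mu> \<theta>"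
      and tv: "\<forall>i. (\<integral>\<^sup>+x\<in>{0..}. ennreal (exp (- \<theta> * x)) * total_variation (\<lambda>s. f s $ i) x \<partial>lborel) < \<infinity>"
      and F: "F = conv_fun (renewal_measure \<mu>) f"
    obtain \<sigma> \<rho> v where \<sigma>: "\<theta> < \<sigma>" and loc: "renewal_strip \<mu> \<sigma> \<rho> v s \<theta>\<^sub>0" using strip by blast
    interpret renewal_strip \<mu> \<sigma> \<rho> v s \<theta>\<^sub>0 by (rule loc)
    let ?R = "roots_gt \<mu> \<theta>\<^sub>0" and ?k = "pole_order \<mu>"
    have R: "Re l > \<theta>" if "l \<in> ?R" for l using that unfolding roots by (simp add: roots_gt_def)
    have "\<exists>g1 g2. tempered_increasing \<theta> g1 \<and> tempered_increasing \<theta> g2 \<and> (\<forall>t. f t $ j = g1 t - g2 t)" for j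
    proof (rule tempered_increasing_decomposition[of \<theta> "\<lambda>t. f t $ j"])
      show "f t $ j = 0" if "t < 0" for t using neg that by simp
      show "((\<lambda>t. f t $ j) \<longlongrightarrow> f t $ j) (at_right t)" for t
        using cad unfolding cadlag_def by (intro tendsto_vec_nth) blast
    qed (use tv in auto)
    then obtain g1 g2 where g1: "\<And>j. tempered_increasing \<theta> (g1 j)" and g2: "\<And>j. tempered_increasing \<theta> (g2 j)"
      and fg: "\<And>j t. f t $ j = g1 j t - g2 j t" by metis
    have fmj: "(\<lambda>x. f x $ j) \<in> borel_measurable borel" for j
      unfolding fg using tempered_increasing_measurable[OF g1] tempered_increasing_measurable[OF g2] by (intro borel_measurable_diff)
    have fm: "f \<in> borel_measurable borel"
      using fmj by (subst borel_measurable_euclidean_space) (auto simp: Basis_vec_def cart_eq_inner_axis[symmetric])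
    have bd: "bounded (f ` K)" if K: "compact K" for K
    proof -
      obtain T where T: "\<And>t. t \<in> K \<Longrightarrow> \<bar>t\<bar> \<le> T" using compact_imp_bounded[OF K] by (auto simp: bounded_iff)
      have "norm (f t) \<le> (\<Sum>j\<in>UNIV. g1 j T + g2 j T)" if "t \<in> K" for t
      proof (rule order_trans[OF norm_le_l1_cart sum_mono])
        fix j
        have "g1 j t \<le> g1 j T" "g2 j t \<le> g2 j T"
          using g1[of j] g2[of j] T[OF that] by (auto simp: tempered_increasing_def mono_def)
        then show "\<bar>f t $ j\<bar> \<le> g1 j T + g2 j T"
          using tempered_increasing_nonneg[OF g1, of j t] tempered_increasing_nonneg[OF g2, of j t] by (simp add: fg)
      qed
      then show ?thesis by (auto simp: bounded_iff)
    qed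
    have sol: "locally_bounded_renewal_solution \<mu> f F"
      unfolding F by (rule conv_fun_renewal_solution[OF fm bd]) (use neg in auto)
    moreover have "\<forall>G. locally_bounded_renewal_solution \<mu> f G \<longrightarrow> G = F"
      using renewal_solution_unique[OF sol] by blast
    moreover have "\<exists>b :: complex \<Rightarrow> nat \<Rightarrow> complex^'n.
          bigo_vec F (\<lambda>t. \<Sum>l\<in>?R. exp (l * t) *s (\<Sum>k<?k l. B l k *v main_integral {0..t} f t k l)) \<theta> \<and>
          (\<forall>\<epsilon>>0. bigo_vec F (\<lambda>t. \<Sum>l\<in>?R. exp (l * t) *s (\<Sum>k<?k l. B l k *v main_integral {0..} f t k l)) (\<theta> + \<epsilon>)) \<and>
          (\<forall>\<epsilon>>0. bigo_vec F (\<lambda>t. \<Sum>l\<in>?R. exp (l * t) *s (\<Sum>k<?k l. complex_of_real (t ^ k) *s b l k)) (\<theta> + \<epsilon>))"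
    \<comment> \<open>For a nonpositive rate \<open>f\<close> vanishes, so both sides are
      \<open>0\<close>. Otherwise the line of integration can be placed between \<open>0\<close> and
      \<open>\<theta>\<close>.\<close>
    proof (cases "\<theta> \<le> 0")
      case True
      have "f t $ j = 0" for t j
        by (rule tempered_variation_nonpos_zero[OF True, of "\<lambda>t. f t $ j"]) (use tv neg in auto)
      then have f0: "f = (\<lambda>_. 0)" by (simp add: fun_eq_iff vec_eq_iff)
      have F0: "F t = 0" for t unfolding F f0 by (simp add: conv_fun_def vec_eq_iff)
      have m0: "main_integral A f t k l = 0" for A t k l
        unfolding f0 by (simp add: main_integral_def vec_eq_iff set_lebesgue_integral_def)
      show ?thesis
        by (rule exI[of _ "\<lambda>_ _. 0"]) (simp add: bigo_vec_def F0 m0)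
    next
      case False
      then have \<theta>0: "0 < \<theta>" by simp
      have "\<exists>J. \<forall>x\<ge>0. \<bar>f x $ j\<bar> \<le> J * exp (\<theta> * x)" for j
      proof (intro exI allI impI)
        fix x :: real
        show "\<bar>f x $ j\<bar> \<le> ((LINT y|interval_measure (g1 j). exp (- \<theta> * y)) + (LINT y|interval_measure (g2 j). exp (- \<theta> * y))) * exp (\<theta> * x)"
          using tempered_increasing_le[OF g1 \<theta>0, of j x] tempered_increasing_le[OF g2 \<theta>0, of j x]
            tempered_increasing_nonneg[OF g1, of j x] tempered_increasing_nonneg[OF g2, of j x]
          unfolding fg distrib_right by linarith
      qed
      then obtain J where J: "\<And>j x. x \<ge> 0 \<Longrightarrow> \<bar>f x $ j\<bar> \<le> J j * exp (\<theta> * x)" by metis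
      define I where "I A t j m l = (LINT x:A|lborel. complex_of_real (f x $ j * (t - x) ^ m) * exp (- l * complex_of_real x))"
        for A :: "real set" and t j m l
      have mI: "main_integral A f t m l $ j = I A t j m l" for A t m l j by (simp add: main_integral_def I_def)
      let ?G = "\<lambda>A t. \<Sum>l\<in>?R. exp (l * complex_of_real t) *s (\<Sum>k<?k l. B l k *v main_integral (A t) f t k l)"
      have G: "?G A t $ i = (\<Sum>j\<in>UNIV. \<Sum>l\<in>?R. \<Sum>m<?k l. exp (l * complex_of_real t) * (B l m $ i $ j * I (A t) t j m l))" for A t i
        unfolding exponential_sum_nth mI ..
      have c1: "\<exists>C. \<forall>t\<ge>0. cmod (complex_of_real (F t $ i) - ?G (\<lambda>t. {0..t}) t $ i) \<le> C * exp (\<theta> * t)" for i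
      proof -
        define D where "D j t = of_real (LINT x|U i j. f (t - x) $ j) -
          (\<Sum>l\<in>?R. \<Sum>m<?k l. exp (l * complex_of_real t) * (B l m $ i $ j * I {0..t} t j m l))" for j t
        have "\<exists>C. \<forall>t\<ge>0. cmod (D j t) \<le> C * exp (\<theta> * t)" for j
        proof (rule scalar_expansion[OF B \<theta> \<theta>0 \<sigma> R g1 g2 fg J, of i j])
          fix C
          assume "\<And>t. t \<ge> 0 \<Longrightarrow> cmod (of_real (LINT x|U i j. f (t - x) $ j) -
            (\<Sum>l\<in>?R. \<Sum>m<?k l. exp (l * complex_of_real t) * (B l m $ i $ j *
              (LINT x:{0..t}|lborel. complex_of_real (f x $ j * (t - x) ^ m) * exp (- l * complex_of_real x))))) \<le> C * exp (\<theta> * t)"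
          then have "\<forall>t\<ge>0. cmod (D j t) \<le> C * exp (\<theta> * t)" unfolding D_def I_def by blast
          then show ?thesis ..
        qed
        then obtain C where C: "\<And>j t. t \<ge> 0 \<Longrightarrow> cmod (D j t) \<le> C j * exp (\<theta> * t)" by metis
        have "cmod (complex_of_real (F t $ i) - ?G (\<lambda>t. {0..t}) t $ i) \<le> (\<Sum>j\<in>UNIV. C j) * exp (\<theta> * t)" if t: "t \<ge> 0" for t
        proof -
          have "complex_of_real (F t $ i) - ?G (\<lambda>t. {0..t}) t $ i = (\<Sum>j\<in>UNIV. D j t)"
            unfolding D_def G F conv_fun_def sum_subtractf by simp
          then show ?thesis unfolding sum_distrib_right by (simp only:) (intro sum_norm_le C t)
        qed
        then show ?thesis by blast
      qed
      have c2: "\<exists>C. \<forall>t\<ge>0. cmod (complex_of_real (F t $ i) - ?G (\<lambda>t. {0..}) t $ i) \<le> C * exp (\<theta> * t)" for i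
      proof -
        obtain C1 where C1: "\<And>t. t \<ge> 0 \<Longrightarrow> cmod (complex_of_real (F t $ i) - ?G (\<lambda>t. {0..t}) t $ i) \<le> C1 * exp (\<theta> * t)"
          using c1[of i] by blast
        define P where "P j l m C \<longleftrightarrow> (\<forall>t\<ge>0. cmod (exp (l * complex_of_real t) * (I {0..} t j m l - I {0..t} t j m l)) \<le> C * exp (\<theta> * t))"
          for j l m C
        \<comment> \<open>A constant exists for each root only. The choice is made for all indices
          at once so that the constants can be summed over the roots, columns and powers.\<close>
        define C2 where "C2 j l m = (SOME C. P j l m C)" for j l m
        have C2: "P j l m (C2 j l m)" if "l \<in> ?R" for j l m
        proof -
          have "\<exists>C. P j l m C"
          proof (rule weighted_tail_bound[OF fmj J R[OF that], of j m])
            fix C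
            assume "\<And>t. t \<ge> 0 \<Longrightarrow> cmod (exp (l * complex_of_real t) *
              ((LINT x:{0..}|lborel. complex_of_real (f x $ j * (t - x) ^ m) * exp (- l * complex_of_real x))
              - (LINT x:{0..t}|lborel. complex_of_real (f x $ j * (t - x) ^ m) * exp (- l * complex_of_real x)))) \<le> C * exp (\<theta> * t)"
            then have "P j l m C" unfolding P_def I_def by blast
            then show ?thesis ..
          qed
          then show ?thesis unfolding C2_def by (rule someI_ex)
        qed
        define C3 where "C3 = (\<Sum>j\<in>UNIV. \<Sum>l\<in>?R. \<Sum>m<?k l. cmod (B l m $ i $ j) * C2 j l m)"
        have "cmod (complex_of_real (F t $ i) - ?G (\<lambda>t. {0..}) t $ i) \<le> (C1 + C3) * exp (\<theta> * t)" if t: "t \<ge> 0" for t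
        proof -
          have "?G (\<lambda>t. {0..}) t $ i - ?G (\<lambda>t. {0..t}) t $ i =
            (\<Sum>j\<in>UNIV. \<Sum>l\<in>?R. \<Sum>m<?k l. B l m $ i $ j * (exp (l * complex_of_real t) * (I {0..} t j m l - I {0..t} t j m l)))"
            unfolding G[where A="\<lambda>t. {0..}"] G[where A="\<lambda>t. {0..t}"] sum_subtractf[symmetric] by (intro sum.cong refl) (simp add: algebra_simps)
          also have "cmod \<dots> \<le> C3 * exp (\<theta> * t)"
            unfolding C3_def sum_distrib_right
          proof (intro sum_norm_le)
            fix j l m assume l: "l \<in> ?R"
            have "cmod (exp (l * complex_of_real t) * (I {0..} t j m l - I {0..t} t j m l)) \<le> C2 j l m * exp (\<theta> * t)"
              using C2[OF l, of j m] t unfolding P_def by blast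
            then show "cmod (B l m $ i $ j * (exp (l * complex_of_real t) * (I {0..} t j m l - I {0..t} t j m l)))
              \<le> cmod (B l m $ i $ j) * C2 j l m * exp (\<theta> * t)"
              unfolding norm_mult[of "B l m $ i $ j"] mult.assoc[of "cmod (B l m $ i $ j)"] by (rule mult_left_mono) simp
          qed
          finally have 2: "cmod (?G (\<lambda>t. {0..}) t $ i - ?G (\<lambda>t. {0..t}) t $ i) \<le> C3 * exp (\<theta> * t)" .
          have "complex_of_real (F t $ i) - ?G (\<lambda>t. {0..}) t $ i =
            (complex_of_real (F t $ i) - ?G (\<lambda>t. {0..t}) t $ i) - (?G (\<lambda>t. {0..}) t $ i - ?G (\<lambda>t. {0..t}) t $ i)"
            by (rule diff_diff_eq2[THEN trans, symmetric]) simp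
          then show ?thesis unfolding distrib_right
            by (simp only:) (rule order_trans[OF norm_triangle_ineq4 add_mono[OF C1[OF t] 2]])
        qed
        then show ?thesis by blast
      qed
      \<comment> \<open>Collects the coefficient of \<open>t ^ k\<close> from the binomial
        expansions of all powers \<open>m \<ge> k\<close>, weighted by the matrices
        \<open>B l m\<close>.\<close>
      define b where "b l k = (\<chi> i. \<Sum>m<?k l. \<Sum>j\<in>UNIV. B l m $ i $ j * (if k \<le> m then of_nat (m choose k) * I {0..} 0 j (m - k) l else 0))"
        for l k
      have c3: "(\<Sum>l\<in>?R. exp (l * complex_of_real t) *s (\<Sum>k<?k l. complex_of_real (t ^ k) *s b l k)) = ?G (\<lambda>t. {0..}) t" for t
      proof (rule sum.cong[OF refl])
        fix l assume l: "l \<in> ?R"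
        have I: "I {0..} t j m l = (\<Sum>k<?k l. complex_of_real (t ^ k) * (if k \<le> m then of_nat (m choose k) * I {0..} 0 j (m - k) l else 0))"
          if m: "m < ?k l" for j m
        proof -
          have "I {0..} t j m l = (\<Sum>k\<le>m. of_nat (m choose k) * complex_of_real (t ^ k) * I {0..} 0 j (m - k) l)"
            unfolding I_def by (rule weighted_binomial[OF fmj J R[OF l]])
          also have "\<dots> = (\<Sum>k\<in>{..<?k l} \<inter> {k. k \<le> m}. of_nat (m choose k) * complex_of_real (t ^ k) * I {0..} 0 j (m - k) l)"
            by (rule sum.cong) (use m in auto)
          also have "\<dots> = (\<Sum>k<?k l. if k \<le> m then of_nat (m choose k) * complex_of_real (t ^ k) * I {0..} 0 j (m - k) l else 0)"
            by (subst sum.inter_restrict) auto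
          also have "\<dots> = (\<Sum>k<?k l. complex_of_real (t ^ k) * (if k \<le> m then of_nat (m choose k) * I {0..} 0 j (m - k) l else 0))"
            by (intro sum.cong refl) auto
          finally show ?thesis .
        qed
        have "(\<Sum>k<?k l. complex_of_real (t ^ k) *s b l k) $ i = (\<Sum>k<?k l. B l k *v main_integral {0..} f t k l) $ i" for i
        proof -
          have "(\<Sum>k<?k l. complex_of_real (t ^ k) *s b l k) $ i =
            (\<Sum>k<?k l. \<Sum>m<?k l. \<Sum>j\<in>UNIV. B l m $ i $ j * (complex_of_real (t ^ k) * (if k \<le> m then of_nat (m choose k) * I {0..} 0 j (m - k) l else 0)))"
            by (simp add: b_def sum_distrib_left mult.left_commute)
          also have "\<dots> = (\<Sum>m<?k l. \<Sum>k<?k l. \<Sum>j\<in>UNIV. B l m $ i $ j * (complex_of_real (t ^ k) * (if k \<le> m then of_nat (m choose k) * I {0..} 0 j (m - k) l else 0)))"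
            by (rule sum.swap)
          also have "\<dots> = (\<Sum>m<?k l. \<Sum>j\<in>UNIV. \<Sum>k<?k l. B l m $ i $ j * (complex_of_real (t ^ k) * (if k \<le> m then of_nat (m choose k) * I {0..} 0 j (m - k) l else 0)))"
            by (intro sum.cong refl sum.swap)
          also have "\<dots> = (\<Sum>m<?k l. \<Sum>j\<in>UNIV. B l m $ i $ j * I {0..} t j m l)"
            by (intro sum.cong refl) (simp only: sum_distrib_left[symmetric] I lessThan_iff)
          also have "\<dots> = (\<Sum>k<?k l. B l k *v main_integral {0..} f t k l) $ i"
            by (simp add: matrix_vector_mult_def mI)
          finally show ?thesis .
        qed
        then have "(\<Sum>k<?k l. complex_of_real (t ^ k) *s b l k) = (\<Sum>k<?k l. B l k *v main_integral {0..} f t k l)"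
          by (simp only: vec_eq_iff) simp
        then show "exp (l * complex_of_real t) *s (\<Sum>k<?k l. complex_of_real (t ^ k) *s b l k) =
          exp (l * complex_of_real t) *s (\<Sum>k<?k l. B l k *v main_integral {0..} f t k l)" by (simp only:)
      qed
      show ?thesis
      proof (intro exI[of _ b] conjI allI impI)
        show "bigo_vec F (?G (\<lambda>t. {0..t})) \<theta>" by (rule bigo_vecI[OF c1]) simp
        \<comment> \<open>The completed sum has error rate \<open>\<theta>\<close> itself; here it
          is weakened to \<open>\<theta> + \<epsilon>\<close>, and the last expansion is the same
          sum reordered.\<close>
        show 2: "bigo_vec F (?G (\<lambda>t. {0..})) (\<theta> + \<epsilon>)" if "\<epsilon> > 0" for \<epsilon> by (rule bigo_vecI[OF c2]) (use that in simp)
        show "bigo_vec F (\<lambda>t. \<Sum>l\<in>?R. exp (l * t) *s (\<Sum>k<?k l. complex_of_real (t ^ k) *s b l k)) (\<theta> + \<epsilon>)" if "\<epsilon> > 0" for \<epsilon>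
          unfolding c3 by (rule 2[OF that])
      qed
    qed
    ultimately show "locally_bounded_renewal_solution \<mu> f F \<and>
        (\<forall>G. locally_bounded_renewal_solution \<mu> f G \<longrightarrow> G = F) \<and>
        (\<exists>b :: complex \<Rightarrow> nat \<Rightarrow> complex^'n.
          bigo_vec F (\<lambda>t. \<Sum>l\<in>roots_gt \<mu> \<theta>. exp (l * t) *s
            (\<Sum>k<pole_order \<mu> l. B l k *v main_integral {0..t} f t k l)) \<theta> \<and>
          (\<forall>\<epsilon>>0. bigo_vec F (\<lambda>t. \<Sum>l\<in>roots_gt \<mu> \<theta>. exp (l * t) *s
            (\<Sum>k<pole_order \<mu> l. B l k *v main_integral {0..} f t k l)) (\<theta> + \<epsilon>)) \<and>
          (\<forall>\<epsilon>>0. bigo_vec F (\<lambda>t. \<Sum>l\<in>roots_gt \<mu> \<theta>. exp (l * t) *s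
            (\<Sum>k<pole_order \<mu> l. complex_of_real (t ^ k) *s b l k)) (\<theta> + \<epsilon>)))"
      unfolding roots by blast
  qed
qed

end
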